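(* Let $I$ be a nonzero proper monomial ideal of $\mathbb{Z}[x_1,\ldots,x_n]$ (i.e. a nonzero proper ideal generated by monomials). Then for every prime $p$ and every pole $s$ of (the meromorphic continuation to $\mathbb{C}$ of) the $p$-adic Igusa zeta function $Z_I$, the real part $\mathrm{Re}(s)$ is a root of the Bernstein-Sato polynomial $b_I$ of $I$.
   Context: **Igusa zeta function.** Fix a prime $p$. Let $\mathbb{Z}_p$ be the ring of $p$-adic integers with valuation $\mathrm{ord}_p$ (with $\mathrm{ord}_p(0)=\infty$), and let $|dy|$ denote the Haar measure $\mu$ on $(\mathbb{Z}_p)^n$ with $\mu\left(\prod_{i=1}^n p^{m_i}\mathbb{Z}_p\right)=(1/p)^{\sum_i m_i}$. For an ideal $I$ of $\mathbb{Z}[x_1,\ldots,x_n]$ and $y\in(\mathbb{Z}_p)^n$ put $\mathrm{ord}_pI(y)=\min\{\mathrm{ord}_p(f(y))\mid f\in I\}$. For $I$ nonzero and proper, and $\mathrm{Re}(s)>0$, define $$Z_I(s)=\int_{(\mathbb{Z}_p)^n}\left(\frac1p\right)^{s\cdot \mathrm{ord}_pI(y)}|dy| .$$ This is holomorphic on $\{\mathrm{Re}(s)>0\}$ and is a rational function of $(1/p)^s$, hence extends meromorphically to $\mathbb{C}$; poles refer to this extension. **Bernstein-Sato polynomial of an ideal** (Budur–Mustaţă–Saito). View $I$ as an ideal of $\mathbb{C}[x_1,\ldots,x_n]$ by extension of scalars, and choose nonzero generators $f_1,\ldots,f_r$ of it. Let $D$ be the Weyl algebra of differential operators on $\mathbb{A}^n_{\mathbb{C}}$,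 and let $s_1,\ldots,s_r$ be independent variables. $D[s_1,\ldots,s_r]$ acts in the usual way on the free rank-one module $\mathbb{C}[x_1,\ldots,x_n]\left[\prod_i f_i^{-1},s_1,\ldots,s_r\right]\cdot\prod_i f_i^{s_i}$, i.e. $\partial_{x_j}\left(\prod_i f_i^{s_i}\right)=\left(\sum_i s_i\frac{\partial f_i/\partial x_j}{f_i}\right)\prod_i f_i^{s_i}$. The Bernstein-Sato polynomial $b_I$ is the monic polynomial $b$ in one variable of smallest degree such that $b(s_1+\cdots+s_r)\prod_i f_i^{s_i}$ belongs to the $D[s_1,\ldots,s_r]$-submodule generated by the elements $$\prod_{i:\,c_i<0}\binom{s_i}{-c_i}\cdot\prod_{i=1}^r f_i^{s_i+c_i},\qquad c=(c_1,\ldots,c_r)\in\mathbb{Z}^r,\ \sum_i c_i=1,$$ where $\binom{s_i}{m}=s_i(s_i-1)\cdots(s_i-m+1)/m!$. It exists, is nonzero, and does not depend on the choice of generators of $I$. (For $r=1$ it is the classical Bernstein-Sato polynomial.) *)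

theory Defs
  imports
    "HOL-Library.Poly_Mapping"
    "HOL-Library.Extended_Nat"
    "HOL-Computational_Algebra.Computational_Algebra"
    "HOL-Probability.Probability"
    "HOL-Complex_Analysis.Complex_Analysis"
begin

section \<open>Polynomials and ideals\<close>

text \<open>
  Polynomials over \<open>'a\<close> in finitely many variables indexed by \<open>'n\<close>; an exponent vector is an
  element of \<^typ>\<open>'n \<Rightarrow>\<^sub>0 nat\<close>. The linear order on \<open>'n\<close> required below serves only to obtain the
  library's \<open>idom\<close> instance, without which the field of fractions is not available.
\<close>

type_synonym ('n, 'a) mpoly = "('n \<Rightarrow>\<^sub>0 nat) \<Rightarrow>\<^sub>0 'a"

definition mpoly_eval :: "('n::finite, 'a::comm_ring_1) mpoly \<Rightarrow> ('n \<Rightarrow> 'a) \<Rightarrow> 'a" where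
  "mpoly_eval f v =
     (\<Sum>m\<in>Poly_Mapping.keys f. Poly_Mapping.lookup f m * (\<Prod>i\<in>UNIV. v i ^ Poly_Mapping.lookup m i))"

definition is_ideal :: "'a::comm_ring_1 set \<Rightarrow> bool" where
  "is_ideal I \<longleftrightarrow> 0 \<in> I \<and> (\<forall>a\<in>I. \<forall>b\<in>I. a + b \<in> I) \<and> (\<forall>a\<in>I. \<forall>r. r * a \<in> I)"

definition ideal_gen :: "'a::comm_ring_1 set \<Rightarrow> 'a set" where
  "ideal_gen S = is_ideal hull S"

definition monomial_ideal :: "('n, 'a::comm_ring_1) mpoly set \<Rightarrow> bool" where
  "monomial_ideal I \<longleftrightarrow> (\<exists>A. I = ideal_gen ((\<lambda>m. Poly_Mapping.single m 1) ` A))"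

section \<open>The \<open>p\<close>-adic integers and the Igusa zeta function\<close>

text \<open>
  \<open>\<int>\<^sub>p\<close> is the inverse limit of the rings \<open>\<int>/p\<^sup>k\<close>: a \<open>p\<close>-adic integer is the compatible sequence of
  its residues modulo \<open>p\<^sup>k\<close>, each represented in \<open>{0..<p\<^sup>k}\<close>. The ring operations are
  componentwise modulo \<open>p\<^sup>k\<close>, and hence so is the evaluation of integer polynomials.
\<close>

definition padic_int :: "nat \<Rightarrow> (nat \<Rightarrow> int) set" where
  "padic_int p = {a. \<forall>k. 0 \<le> a k \<and> a k < int p ^ k \<and> a (Suc k) mod int p ^ k = a k}"

definition padic_add :: "nat \<Rightarrow> (nat \<Rightarrow> int) \<Rightarrow> (nat \<Rightarrow> int) \<Rightarrow> nat \<Rightarrow> int" where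
  "padic_add p a b = (\<lambda>k. (a k + b k) mod int p ^ k)"

definition padic_eval :: "nat \<Rightarrow> ('n::finite, int) mpoly \<Rightarrow> ('n \<Rightarrow> nat \<Rightarrow> int) \<Rightarrow> nat \<Rightarrow> int" where
  "padic_eval p f y = (\<lambda>k. mpoly_eval f (\<lambda>i. y i k) mod int p ^ k)"

text \<open>\<open>p\<^sup>k\<close> divides \<open>a\<close> in \<open>\<int>\<^sub>p\<close> iff the residue of \<open>a\<close> modulo \<open>p\<^sup>k\<close> is 0.\<close>

definition padic_ord :: "(nat \<Rightarrow> int) \<Rightarrow> enat" where
  "padic_ord a = Sup {enat k | k. a k = 0}"

definition padic_ord_ideal :: "nat \<Rightarrow> ('n::finite, int) mpoly set \<Rightarrow> ('n \<Rightarrow> nat \<Rightarrow> int) \<Rightarrow> enat" where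
  "padic_ord_ideal p I y = (INF f\<in>I. padic_ord (padic_eval p f y))"

definition padic_space :: "nat \<Rightarrow> ('n \<Rightarrow> nat \<Rightarrow> int) set" where
  "padic_space p = {y. \<forall>i. y i \<in> padic_int p}"

definition padic_translate :: "nat \<Rightarrow> ('n \<Rightarrow> nat \<Rightarrow> int) \<Rightarrow> ('n \<Rightarrow> nat \<Rightarrow> int) \<Rightarrow> 'n \<Rightarrow> nat \<Rightarrow> int" where
  "padic_translate p a y = (\<lambda>i. padic_add p (a i) (y i))"

text \<open>The coset \<open>y + \<Prod>\<^sub>i p\<^bsup>m i\<^esup> \<int>\<^sub>p\<close>. These cosets form a countable base of the topology of \<open>\<int>\<^sub>p\<^sup>n\<close>.\<close>

definition padic_box :: "nat \<Rightarrow> ('n \<Rightarrow> nat \<Rightarrow> int) \<Rightarrow> ('n \<Rightarrow> nat) \<Rightarrow> ('n \<Rightarrow> nat \<Rightarrow> int) set" where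
  "padic_box p y m = {z \<in> padic_space p. \<forall>i. z i (m i) = y i (m i)}"

definition padic_boxes :: "nat \<Rightarrow> ('n \<Rightarrow> nat \<Rightarrow> int) set set" where
  "padic_boxes p = {padic_box p y m | y m. y \<in> padic_space p}"

definition is_padic_haar :: "nat \<Rightarrow> ('n::finite \<Rightarrow> nat \<Rightarrow> int) measure \<Rightarrow> bool" where
  "is_padic_haar p \<mu> \<longleftrightarrow>
     space \<mu> = padic_space p \<and>
     sets \<mu> = sigma_sets (padic_space p) (padic_boxes p) \<and>
     (\<forall>a\<in>padic_space p. \<forall>A\<in>sets \<mu>. padic_translate p a ` A \<in> sets \<mu> \<and>
        emeasure \<mu> (padic_translate p a ` A) = emeasure \<mu> A) \<and>
     (\<forall>m. emeasure \<mu> (padic_box p (\<lambda>_ _. 0) m) = ennreal ((1 / real p) ^ (\<Sum>i\<in>UNIV. m i)))"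

lemma padic_int_mod:
  assumes "a \<in> padic_int p" "l \<le> k"
  shows "a k mod int p ^ l = a l"
  using assms(2)
proof (induction k rule: dec_induct)
  case base
  show ?case using assms(1) by (simp add: padic_int_def)
next
  case (step n)
  have "a (Suc n) mod int p ^ l = a (Suc n) mod int p ^ n mod int p ^ l"
    using step.hyps by (simp add: mod_mod_cancel le_imp_power_dvd)
  also have "a (Suc n) mod int p ^ n = a n"
    using assms(1) by (simp add: padic_int_def)
  finally show ?case using step.IH by simp
qed

lemma padic_int_eq_le:
  assumes "a \<in> padic_int p" "b \<in> padic_int p" "a k = b k" "l \<le> k"
  shows "a l = b l"
  using padic_int_mod[OF assms(1,4)] padic_int_mod[OF assms(2,4)] assms(3) by simp

lemma padic_int_modI:
  assumes p: "p > 0" and "\<And>k. f (Suc k) mod int p ^ k = f k mod int p ^ k"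
  shows "(\<lambda>k. f k mod int p ^ k) \<in> padic_int p"
  using assms by (auto simp: padic_int_def mod_mod_cancel le_imp_power_dvd)

lemma padic_add_in:
  assumes "p > 0" "a \<in> padic_int p" "b \<in> padic_int p"
  shows "padic_add p a b \<in> padic_int p"
  unfolding padic_add_def
proof (rule padic_int_modI[OF assms(1)])
  fix k
  show "(a (Suc k) + b (Suc k)) mod int p ^ k = (a k + b k) mod int p ^ k"
    using assms(2,3) by (subst mod_add_eq[symmetric]) (simp add: padic_int_def)
qed

definition padic_neg :: "nat \<Rightarrow> (nat \<Rightarrow> int) \<Rightarrow> nat \<Rightarrow> int" where
  "padic_neg p a = (\<lambda>k. (- a k) mod int p ^ k)"

lemma padic_neg_in:
  assumes "p > 0" "a \<in> padic_int p"
  shows "padic_neg p a \<in> padic_int p"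
  unfolding padic_neg_def
proof (rule padic_int_modI[OF assms(1)])
  fix k
  show "(- a (Suc k)) mod int p ^ k = (- a k) mod int p ^ k"
    using assms(2) by (subst mod_minus_eq[symmetric]) (simp add: padic_int_def)
qed

lemma padic_add_neg:
  assumes "b \<in> padic_int p"
  shows "padic_add p (padic_neg p a) (padic_add p a b) = b"
    and "padic_add p a (padic_add p (padic_neg p a) b) = b"
  using assms by (auto simp: padic_add_def padic_neg_def fun_eq_iff mod_simps padic_int_def)

definition padic_digit :: "(nat \<Rightarrow> int) \<Rightarrow> nat \<Rightarrow> nat \<Rightarrow> int" where
  "padic_digit a p l = a (Suc l) div int p ^ l"

lemma padic_digit_bounds:
  assumes "p > 0" "a \<in> padic_int p"
  shows "padic_digit a p l \<in> {0..<int p}"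
proof -
  have "0 \<le> a (Suc l)" "a (Suc l) < int p * int p ^ l"
    using assms(2) by (auto simp: padic_int_def simp flip: power_Suc)
  moreover have "a (Suc l) div int p ^ l * int p ^ l \<le> a (Suc l)"
  proof -
    have "0 < int p ^ l" using assms(1) by simp
    from pos_mod_sign[OF this, of "a (Suc l)"] div_mult_mod_eq[of "a (Suc l)" "int p ^ l"]
    show ?thesis by linarith
  qed
  ultimately have "a (Suc l) div int p ^ l * int p ^ l < int p * int p ^ l" by linarith
  hence "a (Suc l) div int p ^ l < int p" by (rule mult_right_less_imp_less) simp
  thus ?thesis
    using assms(1) \<open>0 \<le> a (Suc l)\<close> by (simp add: padic_digit_def pos_imp_zdiv_nonneg_iff)
qed

lemma padic_digit_sum:
  assumes "a \<in> padic_int p"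
  shows "a k = (\<Sum>l<k. padic_digit a p l * int p ^ l)"
proof (induction k)
  case 0
  show ?case using assms by (auto simp: padic_int_def dest: spec[of _ 0])
next
  case (Suc k)
  have "a (Suc k) = a (Suc k) div int p ^ k * int p ^ k + a (Suc k) mod int p ^ k"
    by (rule div_mult_mod_eq[symmetric])
  also have "a (Suc k) mod int p ^ k = a k" using assms by (simp add: padic_int_def)
  finally show ?case using Suc by (simp add: padic_digit_def)
qed

lemma digit_sum_bounds:
  assumes "\<And>l. d l \<in> {0..<int p}"
  shows "(\<Sum>l<k. d l * int p ^ l) \<in> {0..<int p ^ k}"
proof (induction k)
  case (Suc k)
  have "d k * int p ^ k \<le> (int p - 1) * int p ^ k" "0 \<le> d k * int p ^ k"
    using assms[of k] by (auto intro!: mult_right_mono)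
  with Suc show ?case by (auto simp: algebra_simps)
qed auto

lemma digit_sum_in:
  assumes "\<And>l. d l \<in> {0..<int p}"
  shows "(\<lambda>k. \<Sum>l<k. d l * int p ^ l) \<in> padic_int p"
  using digit_sum_bounds[of d p, OF assms] by (auto simp: padic_int_def)

lemma digit_sum_eq_iff:
  assumes "\<And>l. d l \<in> {0..<int p}" "\<And>l. d' l \<in> {0..<int p}"
  shows "(\<Sum>l<k. d l * int p ^ l) = (\<Sum>l<k. d' l * int p ^ l) \<longleftrightarrow> (\<forall>l<k. d l = d' l)"
proof
  assume eq: "(\<Sum>l<k. d l * int p ^ l) = (\<Sum>l<k. d' l * int p ^ l)"
  have p: "p > 0" using assms(1)[of 0] by (cases p) auto
  show "\<forall>l<k. d l = d' l"
  proof (intro allI impI)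
    fix l assume l: "l < k"
    have *: "(\<Sum>l<n. d l * int p ^ l) = (\<Sum>l<n. d' l * int p ^ l)" if "n \<le> k" for n
      using padic_int_eq_le[OF digit_sum_in[of d p] digit_sum_in[of d' p] eq that] assms by blast
    show "d l = d' l" using p *[of l] *[of "Suc l"] l by simp
  qed
qed (auto intro: sum.cong)

lemma padic_box_eq:
  assumes "w \<in> padic_box p y m"
  shows "padic_box p w m = padic_box p y m"
  using assms by (auto simp: padic_box_def)

lemma padic_box_Int:
  assumes "w \<in> padic_box p y m" "w \<in> padic_box p y' m'"
  shows "padic_box p y m \<inter> padic_box p y' m' = padic_box p w (\<lambda>i. max (m i) (m' i))"
proof -
  have "(z i (max (m i) (m' i)) = w i (max (m i) (m' i))) \<longleftrightarrow>
         z i (m i) = w i (m i) \<and> z i (m' i) = w i (m' i)"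
    if "z \<in> padic_space p" for z i
  proof -
    have "z i \<in> padic_int p" "w i \<in> padic_int p"
      using that assms by (auto simp: padic_box_def padic_space_def)
    from padic_int_eq_le[OF this] show ?thesis
      by (metis max.cobounded1 max.cobounded2 max_def)
  qed
  moreover have "padic_box p y m \<inter> padic_box p y' m' = padic_box p w m \<inter> padic_box p w m'"
    using assms by (simp add: padic_box_eq)
  ultimately show ?thesis by (auto simp: padic_box_def)
qed

lemma padic_translate_in:
  "p > 0 \<Longrightarrow> a \<in> padic_space p \<Longrightarrow> y \<in> padic_space p \<Longrightarrow> padic_translate p a y \<in> padic_space p"
  by (simp add: padic_translate_def padic_space_def padic_add_in)

lemma padic_box_translate:
  assumes "p > 0" "a \<in> padic_space p" "y \<in> padic_space p"
  shows "padic_translate p a -` padic_box p y m \<inter> padic_space p =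
           padic_box p (padic_translate p (\<lambda>i. padic_neg p (a i)) y) m" (is "?L = ?R")
proof -
  have *: "(a i (m i) + z i (m i)) mod int p ^ m i = y i (m i) \<longleftrightarrow>
        z i (m i) = ((- a i (m i)) mod int p ^ m i + y i (m i)) mod int p ^ m i"
    if "z \<in> padic_space p" for z i
  proof -
    let ?q = "int p ^ m i" and ?a = "a i (m i)" and ?z = "z i (m i)" and ?y = "y i (m i)"
    have zy: "?z mod ?q = ?z" "?y mod ?q = ?y"
      using that assms by (auto simp: padic_space_def padic_int_def)
    have "((- ?a) mod ?q + (?a + ?z) mod ?q) mod ?q = ?z mod ?q"
      by (simp add: mod_add_eq)
    moreover have "(?a + ((- ?a) mod ?q + ?y) mod ?q) mod ?q = ?y mod ?q"
      by (simp add: mod_simps)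
    ultimately show ?thesis
      unfolding zy by auto
  qed
  show ?thesis
    using padic_translate_in[OF assms(1,2)] *
    by (auto simp: padic_box_def padic_translate_def padic_add_def padic_neg_def)
qed

lemma is_padic_haar_exists:
  assumes p: "p > 0"
  shows "\<exists>\<mu>::('n::finite \<Rightarrow> nat \<Rightarrow> int) measure. is_padic_haar p \<mu>"
proof -
  define U where "U = uniform_count_measure {0..<int p}"
  define W where "W = Pi\<^sub>M (UNIV :: ('n \<times> nat) set) (\<lambda>_. U)"
  define S where "S = sigma (padic_space p :: ('n \<Rightarrow> nat \<Rightarrow> int) set) (padic_boxes p)"
  define \<phi> where "\<phi> = (\<lambda>(d::'n \<times> nat \<Rightarrow> int) i k. \<Sum>l<k. d (i, l) * int p ^ l)"
  define \<mu> where "\<mu> = distr W S \<phi>"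
  have U: "prob_space U"
    unfolding U_def using p by (intro prob_space_uniform_count_measure) auto
  interpret product_prob_space "\<lambda>_. U" "UNIV :: ('n \<times> nat) set"
    by (intro product_prob_spaceI U)
  have boxes: "padic_boxes p \<subseteq> Pow (padic_space p :: ('n \<Rightarrow> nat \<Rightarrow> int) set)"
    by (auto simp: padic_boxes_def padic_box_def)
  have S: "space S = padic_space p" "sets S = sigma_sets (padic_space p) (padic_boxes p)"
    using boxes by (simp_all add: S_def)
  have \<mu>S: "space \<mu> = padic_space p" "sets \<mu> = sigma_sets (padic_space p) (padic_boxes p)"
    by (simp_all add: \<mu>_def S)
  have W_space: "space W = {d. \<forall>x. d x \<in> {0..<int p}}"
    by (auto simp: W_def U_def space_PiM space_uniform_count_measure PiE_def Pi_def)
  have \<phi>_in: "\<phi> d \<in> padic_space p" if "d \<in> space W" for d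
    using that by (auto simp: \<phi>_def padic_space_def W_space intro!: digit_sum_in)
  define J where "J m = (SIGMA i:UNIV. {..<m i})" for m :: "'n \<Rightarrow> nat"
  define X where "X y = (\<lambda>(i::'n, l). {padic_digit (y i) p l})" for y
  have vim: "\<phi> -` padic_box p y m \<inter> space W = prod_emb UNIV (\<lambda>_. U) (J m) (Pi\<^sub>E (J m) (X y))"
    if y: "y \<in> padic_space p" for y m
  proof -
    have "\<phi> d i (m i) = y i (m i) \<longleftrightarrow> (\<forall>l<m i. d (i, l) = padic_digit (y i) p l)"
      if "d \<in> space W" for d i
    proof -
      have yi: "y i \<in> padic_int p" using y by (simp add: padic_space_def)
      show ?thesis
        unfolding \<phi>_def padic_digit_sum[OF yi, of "m i"]
        by (rule digit_sum_eq_iff) (use that padic_digit_bounds[OF p yi] in \<open>auto simp: W_space\<close>)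
    qed
    thus ?thesis
      using \<phi>_in by (auto simp: padic_box_def prod_emb_def J_def X_def W_def PiE_iff space_PiM)
  qed
  have X: "X y x \<in> sets U" if "y \<in> padic_space p" for y x
    using that padic_digit_bounds[OF p]
    by (cases x) (auto simp: X_def U_def sets_uniform_count_measure padic_space_def)
  have \<phi>: "\<phi> \<in> measurable W S"
    unfolding S_def
  proof (rule measurable_measure_of[OF boxes])
    show "\<phi> -` B \<inter> space W \<in> sets W" if BB: "B \<in> padic_boxes p" for B
    proof -
      obtain y m where B: "B = padic_box p y m" and y: "y \<in> padic_space p"
        using BB by (auto simp: padic_boxes_def)
      show ?thesis
        unfolding B vim[OF y] unfolding W_def
        by (rule sets_PiM_I) (use X[OF y] in \<open>auto simp: J_def\<close>)
    qed
  qed (use \<phi>_in in auto)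
  have box: "padic_box p y m \<in> sets S" if "y \<in> padic_space p" for y m
    using that unfolding S padic_boxes_def by blast
  have \<mu>_box: "emeasure \<mu> (padic_box p y m) = ennreal ((1 / real p) ^ (\<Sum>i\<in>UNIV. m i))"
    if y: "y \<in> padic_space p" for y m
  proof -
    have "emeasure \<mu> (padic_box p y m) = emeasure W (\<phi> -` padic_box p y m \<inter> space W)"
      unfolding \<mu>_def using \<phi> box[OF y] by (rule emeasure_distr)
    also have "\<dots> = (\<Prod>x\<in>J m. emeasure U (X y x))"
      unfolding vim[OF y] unfolding W_def by (rule emeasure_PiM_emb) (use X[OF y] in \<open>auto simp: J_def\<close>)
    also have "\<dots> = (\<Prod>x\<in>J m. ennreal (1 / real p))"
    proof (rule prod.cong[OF refl])
      fix x assume "x \<in> J m"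
      have "X y x \<subseteq> {0..<int p}" 
        using padic_digit_bounds[OF p] y by (cases x) (auto simp: X_def padic_space_def)
      moreover have "card (X y x) = 1" by (cases x) (simp add: X_def)
      ultimately show "emeasure U (X y x) = ennreal (1 / real p)"
        unfolding U_def by (subst emeasure_uniform_count_measure) auto
    qed
    also have "\<dots> = ennreal ((1 / real p) ^ card (J m))"
      by (simp add: ennreal_power)
    also have "card (J m) = (\<Sum>i\<in>UNIV. m i)"
      by (simp add: J_def)
    finally show ?thesis .
  qed
  have stable: "Int_stable (insert {} (padic_boxes p :: ('n \<Rightarrow> nat \<Rightarrow> int) set set))"
  proof -
    have "padic_box p y m \<inter> padic_box p y' m' \<in> insert {} (padic_boxes p)"
      for y y' :: "'n \<Rightarrow> nat \<Rightarrow> int" and m m'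
    proof (cases "padic_box p y m \<inter> padic_box p y' m' = {}")
      case False
      then obtain w where w: "w \<in> padic_box p y m" "w \<in> padic_box p y' m'" by blast
      moreover from w have "w \<in> padic_space p" by (simp add: padic_box_def)
      ultimately show ?thesis
        unfolding padic_box_Int[OF w] padic_boxes_def by blast
    qed simp
    thus ?thesis
      unfolding Int_stable_def padic_boxes_def by blast
  qed
  have sig: "sigma_sets (padic_space p) (insert {} (padic_boxes p)) =
             sigma_sets (padic_space p) (padic_boxes p :: ('n \<Rightarrow> nat \<Rightarrow> int) set set)"
    by (intro sigma_sets_eqI) (auto intro: sigma_sets.Empty)
  have zero: "(\<lambda>_ _. 0) \<in> (padic_space p :: ('n \<Rightarrow> nat \<Rightarrow> int) set)"
    using p by (simp add: padic_space_def padic_int_def)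
  have space_box: "padic_space p = padic_box p (\<lambda>_ _. 0) (\<lambda>_::'n. 0)"
  proof -
    have "z i 0 = 0" if "z \<in> padic_space p" for z :: "'n \<Rightarrow> nat \<Rightarrow> int" and i
    proof -
      have "0 \<le> z i 0 \<and> z i 0 < int p ^ 0"
        using that unfolding padic_space_def padic_int_def by blast
      thus ?thesis by simp
    qed
    thus ?thesis by (auto simp: padic_box_def)
  qed
  have translate_measurable: "padic_translate p a \<in> measurable \<mu> \<mu>"
    if a: "a \<in> padic_space p" for a :: "'n \<Rightarrow> nat \<Rightarrow> int"
  proof (rule measurable_sigma_sets[OF \<mu>S(2) boxes])
    have na: "(\<lambda>i. padic_neg p (a i)) \<in> padic_space p"
      using a p by (simp add: padic_space_def padic_neg_in)
    show "padic_translate p a -` B \<inter> space \<mu> \<in> sets \<mu>" if B: "B \<in> padic_boxes p" for B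
      using B box padic_translate_in[OF p na]
      by (auto simp: padic_boxes_def \<mu>S(1) padic_box_translate[OF p a] S \<mu>S(2))
  qed (use padic_translate_in[OF p a] in \<open>auto simp: \<mu>S\<close>)
  have translate_distr: "distr \<mu> \<mu> (padic_translate p a) = \<mu>"
    if a: "a \<in> padic_space p" for a :: "'n \<Rightarrow> nat \<Rightarrow> int"
  proof (rule measure_eqI_generator_eq[OF stable, where \<Omega> = "padic_space p" and A = "\<lambda>_. padic_space p"])
    have na: "(\<lambda>i. padic_neg p (a i)) \<in> padic_space p"
      using a p by (simp add: padic_space_def padic_neg_in)
    fix B :: "('n \<Rightarrow> nat \<Rightarrow> int) set"
    assume "B \<in> insert {} (padic_boxes p)"
    then consider "B = {}" | y m where "B = padic_box p y m" "y \<in> padic_space p"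
      by (auto simp: padic_boxes_def)
    thus "emeasure (distr \<mu> \<mu> (padic_translate p a)) B = emeasure \<mu> B"
    proof cases
      case 2
      thus ?thesis
        using translate_measurable[OF a] box padic_translate_in[OF p na]
        by (simp add: emeasure_distr S \<mu>S padic_box_translate[OF p a] \<mu>_box)
    qed simp
  next
    show "range (\<lambda>_::nat. padic_space p :: ('n \<Rightarrow> nat \<Rightarrow> int) set) \<subseteq> insert {} (padic_boxes p)"
      using space_box zero unfolding padic_boxes_def by blast
    have "padic_translate p a -` padic_space p \<inter> space \<mu> = padic_space p"
      using padic_translate_in[OF p a] by (auto simp: \<mu>S)
    thus "emeasure (distr \<mu> \<mu> (padic_translate p a)) (padic_space p) \<noteq> \<infinity>"
      using translate_measurable[OF a] \<mu>_box[OF zero, of "\<lambda>_. 0"] sets.top[of \<mu>]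
      by (simp add: emeasure_distr \<mu>S(1) flip: space_box)
  qed (use boxes in \<open>auto simp: \<mu>S sig\<close>)
  have "is_padic_haar p \<mu>"
    unfolding is_padic_haar_def
  proof (intro conjI ballI allI)
    fix a :: "'n \<Rightarrow> nat \<Rightarrow> int" and A assume a: "a \<in> padic_space p" and A: "A \<in> sets \<mu>"
    define n where "n = (\<lambda>i. padic_neg p (a i))"
    have n: "n \<in> padic_space p"
      using a p by (simp add: n_def padic_space_def padic_neg_in)
    have inv: "padic_translate p n (padic_translate p a y) = y"
         "padic_translate p a (padic_translate p n y) = y" if "y \<in> padic_space p" for y
      using that padic_add_neg by (auto simp: padic_translate_def n_def padic_space_def)
    have "A \<subseteq> padic_space p" using sets.sets_into_space[OF A] \<mu>S by simp
    hence *: "padic_translate p a ` A = padic_translate p n -` A \<inter> space \<mu>"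
      using inv padic_translate_in[OF p a] unfolding \<mu>S by (auto simp: image_iff; metis subsetD)
    show "padic_translate p a ` A \<in> sets \<mu>"
      unfolding * using translate_measurable[OF n] A by (rule measurable_sets)
    show "emeasure \<mu> (padic_translate p a ` A) = emeasure \<mu> A"
      unfolding * using emeasure_distr[OF translate_measurable[OF n] A] translate_distr[OF n] by simp
  qed (use \<mu>S \<mu>_box[OF zero] in auto)
  thus ?thesis by blast
qed

definition padic_haar :: "nat \<Rightarrow> ('n::finite \<Rightarrow> nat \<Rightarrow> int) measure" where
  "padic_haar p = (SOME \<mu>. is_padic_haar p \<mu>)"

lemma is_padic_haar_padic_haar:
  "p > 0 \<Longrightarrow> is_padic_haar p (padic_haar p :: ('n::finite \<Rightarrow> nat \<Rightarrow> int) measure)"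
  unfolding padic_haar_def using is_padic_haar_exists by (rule someI_ex)

text \<open>The value \<open>0\<close> at \<open>\<infinity>\<close> is that of \<open>(1/p)\<^bsup>s \<cdot> \<infinity>\<^esup>\<close> for \<open>Re s > 0\<close>, the only range in which
  \<open>igusa_zeta\<close> is meaningful.\<close>

definition igusa_integrand :: "nat \<Rightarrow> complex \<Rightarrow> enat \<Rightarrow> complex" where
  "igusa_integrand p s v = (case v of enat k \<Rightarrow> (1 / of_nat p) powr (s * of_nat k) | \<infinity> \<Rightarrow> 0)"

definition igusa_zeta :: "nat \<Rightarrow> ('n::finite, int) mpoly set \<Rightarrow> complex \<Rightarrow> complex" where
  "igusa_zeta p I s = (LINT y|padic_haar p. igusa_integrand p s (padic_ord_ideal p I y))"

section \<open>The Bernstein-Sato polynomial of an ideal\<close>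

text \<open>Where the subtraction of exponents truncates, the coefficient is zero.\<close>

definition mpoly_deriv :: "'n \<Rightarrow> ('n, 'a::comm_ring_1) mpoly \<Rightarrow> ('n, 'a) mpoly" where
  "mpoly_deriv j f = (\<Sum>m\<in>Poly_Mapping.keys f.
     Poly_Mapping.single (m - Poly_Mapping.single j 1)
       (of_nat (Poly_Mapping.lookup m j) * Poly_Mapping.lookup f m))"


lemma mpoly_deriv_superset:
  assumes "finite A" "Poly_Mapping.keys f \<subseteq> A"
  shows "mpoly_deriv j f = (\<Sum>m\<in>A. Poly_Mapping.single (m - Poly_Mapping.single j 1)
           (of_nat (Poly_Mapping.lookup m j) * Poly_Mapping.lookup f m))"
  unfolding mpoly_deriv_def
  by (rule sum.mono_neutral_left) (use assms in \<open>auto simp: in_keys_iff\<close>)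

lemma mpoly_deriv_add: "mpoly_deriv j (f + g) = mpoly_deriv j f + mpoly_deriv j g"
proof -
  let ?A = "Poly_Mapping.keys f \<union> Poly_Mapping.keys g"
  have "finite ?A" by simp
  moreover have "Poly_Mapping.keys (f + g) \<subseteq> ?A" by (rule Poly_Mapping.keys_add)
  ultimately show ?thesis
    by (simp add: mpoly_deriv_superset[where A = ?A] lookup_add single_add algebra_simps sum.distrib)
qed

lemma mpoly_deriv_single:
  "mpoly_deriv j (Poly_Mapping.single m c) =
     Poly_Mapping.single (m - Poly_Mapping.single j 1) (of_nat (Poly_Mapping.lookup m j) * c)"
  by (subst mpoly_deriv_superset[where A = "{m}"]) auto

lemma mpoly_deriv_mult_single:
  "mpoly_deriv j (Poly_Mapping.single m c * Poly_Mapping.single m' c') =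
     mpoly_deriv j (Poly_Mapping.single m c) * Poly_Mapping.single m' c' +
     Poly_Mapping.single m c * mpoly_deriv j (Poly_Mapping.single m' c')"
proof -
  have 1: "m - Poly_Mapping.single j 1 + m' = m + m' - Poly_Mapping.single j 1"
    if "Poly_Mapping.lookup m j \<noteq> 0" for m m' :: "'a \<Rightarrow>\<^sub>0 nat"
    by (rule poly_mapping_eqI) (use that in \<open>auto simp: lookup_add lookup_minus lookup_single when_def\<close>)
  have 2: "m + (m' - Poly_Mapping.single j 1) = m + m' - Poly_Mapping.single j 1"
    if "Poly_Mapping.lookup m' j \<noteq> 0"
    using 1[OF that, of m] by (simp add: add.commute)
  show ?thesis
    by (cases "Poly_Mapping.lookup m j = 0"; cases "Poly_Mapping.lookup m' j = 0")
       (use 1[of m m'] 2 in \<open>auto simp: mpoly_deriv_single mult_single lookup_add algebra_simps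
          simp flip: single_add\<close>)
qed

lemma mpoly_deriv_zero: "mpoly_deriv j 0 = 0"
  by (simp add: mpoly_deriv_def)

lemma mpoly_induct:
  assumes "P 0" "\<And>f m c. P f \<Longrightarrow> P (f + Poly_Mapping.single m c)"
  shows "P (f :: ('n, 'a::comm_ring_1) mpoly)"
proof (induction f rule: update_induct)
  case const
  show ?case by (rule assms)
next
  case (update f a b)
  have "Poly_Mapping.update a b f = f + Poly_Mapping.single a b"
    by (rule poly_mapping_eqI)
       (use update in \<open>auto simp: Poly_Mapping.lookup_update lookup_add lookup_single in_keys_iff when_def\<close>)
  with update assms show ?case by simp
qed

lemma mpoly_deriv_mult:
  "mpoly_deriv j (f * g) = mpoly_deriv j f * g + f * mpoly_deriv j g"
proof (induction f rule: mpoly_induct)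
  case 1
  show ?case by (simp add: mpoly_deriv_zero)
next
  case (2 f m c)
  have "mpoly_deriv j (Poly_Mapping.single m c * g) =
          mpoly_deriv j (Poly_Mapping.single m c) * g + Poly_Mapping.single m c * mpoly_deriv j g"
    by (induction g rule: mpoly_induct)
       (auto simp: mpoly_deriv_zero mpoly_deriv_add mpoly_deriv_mult_single algebra_simps)
  with 2 show ?case
    by (simp add: mpoly_deriv_add algebra_simps)
qed

type_synonym 'n ratfun = "('n, complex) mpoly fract"

text \<open>The quotient rule; independence of the chosen fraction is shown in \<open>ratfun_deriv_Fract\<close>.\<close>

definition ratfun_deriv :: "'n::{finite,linorder} \<Rightarrow> 'n ratfun \<Rightarrow> 'n ratfun" where
  "ratfun_deriv j q = (THE r. \<forall>a b. b \<noteq> 0 \<longrightarrow> q = Fract a b \<longrightarrow>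
     r = Fract (mpoly_deriv j a * b - a * mpoly_deriv j b) (b * b))"

lemma ratfun_deriv_Fract:
  assumes "b \<noteq> 0"
  shows "ratfun_deriv j (Fract a b) =
           Fract (mpoly_deriv j a * b - a * mpoly_deriv j b) (b * b)"
proof -
  let ?D = "mpoly_deriv j"
  have wd: "Fract (?D a * b - a * ?D b) (b * b) = Fract (?D c * d - c * ?D d) (d * d)"
    if d: "d \<noteq> 0" and "Fract a b = Fract c d" for c d
  proof -
    have eq: "a * d = c * b"
      using that assms by (simp add: eq_fract)
    have "?D a * d + a * ?D d = ?D c * b + c * ?D b"
      using arg_cong[OF eq, of ?D] by (simp add: mpoly_deriv_mult)
    hence 1: "?D a * d = ?D c * b + c * ?D b - a * ?D d" by (simp add: algebra_simps)
    have "(?D a * b - a * ?D b) * (d * d) = (?D a * d) * b * d - (a * d) * (?D b * d)"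
      by (simp add: algebra_simps)
    also have "\<dots> = (?D c * b + c * ?D b - a * ?D d) * b * d - (c * b) * (?D b * d)"
      unfolding 1 eq ..
    also have "\<dots> = ?D c * d * (b * b) - (a * d) * (b * ?D d)"
      by (simp add: algebra_simps)
    also have "\<dots> = (?D c * d - c * ?D d) * (b * b)"
      unfolding eq by (simp add: algebra_simps)
    finally show ?thesis
      using assms d by (simp add: eq_fract)
  qed
  show ?thesis
    unfolding ratfun_deriv_def by (rule the_equality) (use wd assms in blast)+
qed

text \<open>
  An element \<open>g \<cdot> \<Prod>\<^sub>i f\<^sub>i\<^bsup>s\<^sub>i\<^esup>\<close> of the free module is represented by its coefficient \<open>g\<close>, taken in
  \<open>\<complex>(x)[s\<^sub>0, s\<^sub>1, \<dots>]\<close>, which contains the rings \<open>\<complex>[x][\<Prod>\<^sub>i f\<^sub>i\<^sup>-\<^sup>1, s]\<close> for all \<open>f\<close>. The submodule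
  generated by given elements does not depend on the ambient module. For a list \<open>fs\<close> of
  generators only the variables \<open>s\<^sub>i\<close> with \<open>i < length fs\<close> are used.
\<close>

type_synonym 'n fs_module = "(nat \<Rightarrow>\<^sub>0 nat) \<Rightarrow>\<^sub>0 'n ratfun"

definition fs_coeff :: "'n::{finite,linorder} ratfun \<Rightarrow> 'n fs_module" where
  "fs_coeff q = Poly_Mapping.single 0 q"

definition fs_poly :: "('n::{finite,linorder}, complex) mpoly \<Rightarrow> 'n fs_module" where
  "fs_poly f = fs_coeff (Fract f 1)"

definition fs_const :: "complex \<Rightarrow> 'n::{finite,linorder} fs_module" where
  "fs_const c = fs_poly (Poly_Mapping.single 0 c)"

definition fs_x :: "'n::{finite,linorder} \<Rightarrow> 'n fs_module" where
  "fs_x j = fs_poly (Poly_Mapping.single (Poly_Mapping.single j 1) 1)"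

definition fs_s :: "nat \<Rightarrow> 'n::{finite,linorder} fs_module" where
  "fs_s i = Poly_Mapping.single (Poly_Mapping.single i 1) 1"

text \<open>
  \<open>\<partial>\<^sub>j (g \<cdot> \<Prod>\<^sub>i f\<^sub>i\<^bsup>s\<^sub>i\<^esup>) = (\<partial>\<^sub>j g + g \<cdot> \<Sum>\<^sub>i s\<^sub>i (\<partial>\<^sub>j f\<^sub>i) / f\<^sub>i) \<cdot> \<Prod>\<^sub>i f\<^sub>i\<^bsup>s\<^sub>i\<^esup>\<close>
\<close>

definition fs_partial ::
    "('n::{finite,linorder}, complex) mpoly list \<Rightarrow> 'n \<Rightarrow> 'n fs_module \<Rightarrow> 'n fs_module" where
  "fs_partial fs j g = Poly_Mapping.map (ratfun_deriv j) g +
     g * (\<Sum>i<length fs. fs_s i * fs_coeff (Fract (mpoly_deriv j (fs ! i)) (fs ! i)))"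

text \<open>The operators by which the elements of \<open>D[s\<^sub>1, \<dots>, s\<^sub>r]\<close> act.\<close>

inductive_set weyl_s_ops ::
    "('n::{finite,linorder}, complex) mpoly list \<Rightarrow> ('n fs_module \<Rightarrow> 'n fs_module) set"
  for fs where
    const: "(\<lambda>g. fs_const c * g) \<in> weyl_s_ops fs"
  | x: "(\<lambda>g. fs_x j * g) \<in> weyl_s_ops fs"
  | partial: "fs_partial fs j \<in> weyl_s_ops fs"
  | s: "i < length fs \<Longrightarrow> (\<lambda>g. fs_s i * g) \<in> weyl_s_ops fs"
  | add: "P \<in> weyl_s_ops fs \<Longrightarrow> Q \<in> weyl_s_ops fs \<Longrightarrow> (\<lambda>g. P g + Q g) \<in> weyl_s_ops fs"
  | mult: "P \<in> weyl_s_ops fs \<Longrightarrow> Q \<in> weyl_s_ops fs \<Longrightarrow> P \<circ> Q \<in> weyl_s_ops fs"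

definition is_weyl_s_submodule ::
    "('n::{finite,linorder}, complex) mpoly list \<Rightarrow> 'n fs_module set \<Rightarrow> bool" where
  "is_weyl_s_submodule fs N \<longleftrightarrow>
     0 \<in> N \<and> (\<forall>g\<in>N. \<forall>h\<in>N. g + h \<in> N) \<and> (\<forall>P\<in>weyl_s_ops fs. \<forall>g\<in>N. P g \<in> N)"

text \<open>\<open>s\<^sub>i (s\<^sub>i - 1) \<cdots> (s\<^sub>i - m + 1) / m!\<close>\<close>

definition fs_binomial :: "nat \<Rightarrow> nat \<Rightarrow> 'n::{finite,linorder} fs_module" where
  "fs_binomial i m = fs_const (1 / fact m) * (\<Prod>k<m. fs_s i - of_nat k)"

text \<open>The coefficient of \<open>\<Prod>\<^sub>i f\<^sub>i\<^bsup>s\<^sub>i\<^esup>\<close> in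
  \<open>\<Prod>\<^bsub>c\<^sub>i < 0\<^esub> (s\<^sub>i choose -c\<^sub>i) \<cdot> \<Prod>\<^sub>i f\<^sub>i\<^bsup>s\<^sub>i + c\<^sub>i\<^esup>\<close>.\<close>

definition bs_element ::
    "('n::{finite,linorder}, complex) mpoly list \<Rightarrow> (nat \<Rightarrow> int) \<Rightarrow> 'n fs_module" where
  "bs_element fs c =
     (\<Prod>i\<in>{i. i < length fs \<and> c i < 0}. fs_binomial i (nat (- c i))) *
     fs_coeff (\<Prod>i<length fs. Fract (fs ! i) 1 powi c i)"

definition bs_submodule ::
    "('n::{finite,linorder}, complex) mpoly list \<Rightarrow> 'n fs_module set" where
  "bs_submodule fs =
     is_weyl_s_submodule fs hull {bs_element fs c | c. (\<Sum>i<length fs. c i) = 1}"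

definition bs_equation :: "('n::{finite,linorder}, complex) mpoly list \<Rightarrow> complex poly \<Rightarrow> bool" where
  "bs_equation fs b \<longleftrightarrow>
     poly (map_poly fs_const b) (\<Sum>i<length fs. fs_s i) \<in> bs_submodule fs"

definition ideal_extension ::
    "('n::{finite,linorder}, int) mpoly set \<Rightarrow> ('n, complex) mpoly set" where
  "ideal_extension I = ideal_gen (Poly_Mapping.map of_int ` I)"

text \<open>
  \<open>b\<close> is the Bernstein-Sato polynomial of \<open>I\<close>, computed from some finite system of nonzero
  generators; by the theorem of Budur, Mustata and Saito it does not depend on this system.
\<close>

definition is_bernstein_sato_poly ::
    "('n::{finite,linorder}, int) mpoly set \<Rightarrow> complex poly \<Rightarrow> bool" where
  "is_bernstein_sato_poly I b \<longleftrightarrow>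
     (\<exists>fs. 0 \<notin> set fs \<and> ideal_gen (set fs) = ideal_extension I \<and>
        lead_coeff b = 1 \<and> bs_equation fs b \<and>
        (\<forall>b'. lead_coeff b' = 1 \<and> bs_equation fs b' \<longrightarrow> Polynomial.degree b \<le> Polynomial.degree b'))"

end

theory Submission
  imports Defs
begin

text \<open>
  Let \<open>\<phi>(v) = min {u \<cdot> v | x\<^sup>u \<in> I}\<close>. Sorting the points of \<open>\<int>\<^sub>p\<^sup>n\<close> by the orders of their coordinates,
  the zeta function is a constant multiple of \<open>\<Sum>\<^sub>v p\<^bsup>-(s \<phi>(v) + |v|)\<^esup>\<close> over \<open>v \<in> \<nat>\<^sup>n\<close>. The function \<open>\<phi>\<close> is
  linear on finitely many rational cones; their extremal rays \<open>r\<close> give the only possible denominators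
  \<open>1 - p\<^bsup>-(s \<phi>(r) + |r|)\<^esup>\<close>. So a pole has real part \<open>-|r| / \<phi>(r)\<close> for some \<open>r\<close> with \<open>\<phi>(r) > 0\<close>, and
  extremality puts \<open>(1, \<dots>, 1)\<close> in the span of the exponents \<open>a\<close> with \<open>x\<^sup>a \<in> I\<close> and \<open>a \<cdot> r = \<phi>(r)\<close>.

  For such an \<open>r\<close> write \<open>\<Sum>\<^sub>a z\<^sub>a a = -(1, \<dots>, 1)\<close>, so that \<open>\<Sum>\<^sub>a z\<^sub>a = -|r| / \<phi>(r)\<close>. For a
  monomial system of generators, specialising \<open>s\<^sub>a\<close> to \<open>z\<^sub>a\<close> and taking the residue of
  \<open>g \<Prod>\<^sub>a x\<^bsup>z\<^sub>a a\<^esup> dx\<close> is a linear functional that kills derivatives, and, by comparing weights with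
  respect to \<open>r\<close>, also the whole submodule defining \<open>b\<^sub>I\<close>; on \<open>b(\<Sum>\<^sub>a s\<^sub>a)\<close> its value is
  \<open>b(\<Sum>\<^sub>a z\<^sub>a)\<close>. For an arbitrary system \<open>f\<close> one evaluates \<open>s\<close> at natural numbers \<open>m\<close>, which turns
  \<open>\<Prod>\<^sub>i f\<^sub>i\<^bsup>s\<^sub>i\<^esup>\<close> into the generating function \<open>exp (\<Sum>\<^sub>i \<tau>\<^sub>i f\<^sub>i)\<close>. If \<open>x\<^sup>a = \<Sum>\<^sub>i c\<^bsub>a,i\<^esub> f\<^sub>i\<close>, the substitution
  \<open>\<tau>\<^sub>i = \<Sum>\<^sub>a \<sigma>\<^sub>a c\<^bsub>a,i\<^esub>\<close> turns this into \<open>exp (\<Sum>\<^sub>a \<sigma>\<^sub>a x\<^sup>a)\<close>, and the value at the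
  rational point \<open>z\<close> is recovered by polynomial interpolation.
\<close>

text \<open>The members of the system behind \<open>b\<close> need not be monomials, so the powers
  \<open>f_i^s_i\<close> have no residue at the rational point z. At natural parameters they are
  honest polynomials, and the operators can be read off generating functions: s_i acts as tau_i
  d/dtau_i, raising s_i by one is d/dtau_i, and a negative shift with its binomial factor is, up to
  a constant, multiplication by a power of tau_i. The way back to z runs along words of content u +
  l d, where u, d are integral and z = u - d / q. A derivative in x_j contributes an exponent and
  tau_i the multiplicity of a letter; both are affine in l. So all coefficients stay polynomial in
  l, and l = -1 / q can be substituted. Weights are counted in units of \<phi>(r). The exponents c
  of a generator of the submodule sum to 1, so the submodule is one unit too heavy for a nonzero
  coefficient at (-1, ..., -1). On the zeta side the cones need not be simplicial and
  representations by rays are not unique; singling one out per vector takes the place of a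
  triangulation.\<close>

abbreviation (input) "lookup \<equiv> Poly_Mapping.lookup"
abbreviation (input) "keys \<equiv> Poly_Mapping.keys"
abbreviation (input) single :: "'a \<Rightarrow> 'b \<Rightarrow> 'a \<Rightarrow>\<^sub>0 'b::zero" where
  "single \<equiv> Poly_Mapping.single"

section \<open>Rational functions and evaluation of the parameters\<close>

lemma ratfun_deriv_add:
  "ratfun_deriv j (x + y) = ratfun_deriv j x + ratfun_deriv j y"
proof (cases x)
  case x: (Fract a b)
  show ?thesis
  proof (cases y)
    case y: (Fract c d)
    show ?thesis using x y
      by (simp add: ratfun_deriv_Fract eq_fract mpoly_deriv_mult mpoly_deriv_add algebra_simps)
  qed
qed

lemma ratfun_deriv_mult:
  "ratfun_deriv j (x * y) = ratfun_deriv j x * y + x * ratfun_deriv j y"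
proof (cases x)
  case x: (Fract a b)
  show ?thesis
  proof (cases y)
    case y: (Fract c d)
    show ?thesis using x y
      by (simp add: ratfun_deriv_Fract eq_fract mpoly_deriv_mult mpoly_deriv_add algebra_simps)
  qed
qed

lemma mpoly_deriv_one: "mpoly_deriv j 1 = 0"
proof -
  have "mpoly_deriv j (single 0 1) = 0"
    unfolding mpoly_deriv_single by simp
  thus ?thesis by (simp only: single_one)
qed

lemma ratfun_deriv_poly: "ratfun_deriv j (Fract f 1) = Fract (mpoly_deriv j f) 1"
  by (simp add: ratfun_deriv_Fract mpoly_deriv_one)

lemma ratfun_deriv_0 [simp]: "ratfun_deriv j 0 = 0"
  by (metis ratfun_deriv_add add.right_neutral add_left_cancel)

lemma ratfun_deriv_sum: "ratfun_deriv j (\<Sum>x\<in>X. h x) = (\<Sum>x\<in>X. ratfun_deriv j (h x))"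
  by (induction X rule: infinite_finite_induct) (simp_all add: ratfun_deriv_add)

lemma ratfun_deriv_1 [simp]: "ratfun_deriv j 1 = 0"
  by (metis ratfun_deriv_mult mult.right_neutral mult.left_neutral add.right_neutral add_left_cancel)

lemma ratfun_deriv_of_nat [simp]: "ratfun_deriv j (of_nat k) = 0"
  by (induction k) (simp_all add: ratfun_deriv_add)

lemma ratfun_deriv_power: "ratfun_deriv j (x ^ k) = of_nat k * x ^ (k - 1) * ratfun_deriv j x"
proof (induction k)
  case (Suc k)
  have "ratfun_deriv j (x ^ Suc k) = ratfun_deriv j x * x ^ k + x * (of_nat k * x ^ (k - 1) * ratfun_deriv j x)"
    using Suc by (simp add: ratfun_deriv_mult)
  also have "\<dots> = of_nat (Suc k) * x ^ (Suc k - 1) * ratfun_deriv j x"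
    by (cases k) (simp_all add: algebra_simps)
  finally show ?case .
qed simp

text \<open>The logarithmic derivative of a product of powers; with natural exponents it reproduces
  the formal rule behind \<open>fs_partial\<close>.\<close>

lemma ratfun_deriv_prod_power:
  assumes "finite X" "\<And>i. i \<in> X \<Longrightarrow> h i \<noteq> 0"
  shows "ratfun_deriv j (\<Prod>i\<in>X. h i ^ k i) =
    (\<Prod>i\<in>X. h i ^ k i) * (\<Sum>i\<in>X. of_nat (k i) * (ratfun_deriv j (h i) / h i))"
  using assms
proof (induction X)
  case (insert a X)
  have "of_nat (k a) * (h a ^ (k a - 1) * ratfun_deriv j (h a)) =
          of_nat (k a) * (h a ^ k a * (ratfun_deriv j (h a) / h a))"
    using insert.prems by (cases "k a") (auto simp: field_simps)
  with insert show ?case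
    by (simp add: ratfun_deriv_mult ratfun_deriv_power algebra_simps)
qed simp

section \<open>Evaluation of the parameters s at natural numbers\<close>

definition monomial_eval :: "(nat \<Rightarrow> nat) \<Rightarrow> (nat \<Rightarrow>\<^sub>0 nat) \<Rightarrow> nat" where
  "monomial_eval m \<gamma> = (\<Prod>i\<in>keys \<gamma>. m i ^ lookup \<gamma> i)"

lemma monomial_eval_superset:
  "finite X \<Longrightarrow> keys \<gamma> \<subseteq> X \<Longrightarrow> monomial_eval m \<gamma> = (\<Prod>i\<in>X. m i ^ lookup \<gamma> i)"
  unfolding monomial_eval_def by (rule prod.mono_neutral_left) (auto simp: in_keys_iff)

lemma monomial_eval_add: "monomial_eval m (\<gamma> + \<delta>) = monomial_eval m \<gamma> * monomial_eval m \<delta>"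
proof -
  let ?X = "keys \<gamma> \<union> keys \<delta>"
  have "finite ?X" "keys (\<gamma> + \<delta>) \<subseteq> ?X" by (simp_all add: Poly_Mapping.keys_add)
  thus ?thesis
    by (simp add: monomial_eval_superset[where X = ?X] lookup_add power_add prod.distrib)
qed

lemma monomial_eval_0 [simp]: "monomial_eval m 0 = 1"
  by (simp add: monomial_eval_def)

definition fs_eval :: "(nat \<Rightarrow> nat) \<Rightarrow> 'n::{finite,linorder} fs_module \<Rightarrow> 'n ratfun" where
  "fs_eval m g = (\<Sum>\<gamma>\<in>keys g. lookup g \<gamma> * of_nat (monomial_eval m \<gamma>))"

lemma fs_eval_superset:
  "finite X \<Longrightarrow> keys g \<subseteq> X \<Longrightarrow>
     fs_eval m g = (\<Sum>\<gamma>\<in>X. lookup g \<gamma> * of_nat (monomial_eval m \<gamma>))"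
  unfolding fs_eval_def by (rule sum.mono_neutral_left) (auto simp: in_keys_iff)

lemma fs_eval_0 [simp]: "fs_eval m 0 = 0"
  by (simp add: fs_eval_def)

lemma fs_eval_add: "fs_eval m (g + h) = fs_eval m g + fs_eval m h"
proof -
  let ?X = "keys g \<union> keys h"
  have "finite ?X" "keys (g + h) \<subseteq> ?X" by (simp_all add: Poly_Mapping.keys_add)
  thus ?thesis
    by (simp add: fs_eval_superset[where X = ?X] lookup_add algebra_simps sum.distrib)
qed

lemma fs_eval_single [simp]: "fs_eval m (single \<gamma> c) = c * of_nat (monomial_eval m \<gamma>)"
  by (subst fs_eval_superset[where X = "{\<gamma>}"]) auto

lemma fs_eval_mult: "fs_eval m (g * h) = fs_eval m g * fs_eval m h"
proof (induction g rule: mpoly_induct)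
  case (2 g \<gamma> c)
  have "fs_eval m (single \<gamma> c * h) = fs_eval m (single \<gamma> c) * fs_eval m h"
    by (induction h rule: mpoly_induct)
       (simp_all add: fs_eval_add distrib_left mult_single monomial_eval_add)
  with 2 show ?case by (simp add: fs_eval_add distrib_right)
qed simp

lemma fs_eval_1 [simp]: "fs_eval m 1 = 1"
  using fs_eval_single[of m 0 1] by simp

lemma fs_eval_of_nat [simp]: "fs_eval m (of_nat k) = of_nat k"
  by (induction k) (simp_all add: fs_eval_add)

lemma fs_eval_diff: "fs_eval m (g - h) = fs_eval m g - fs_eval m h"
  using fs_eval_add[of m "g - h" h] by simp

lemma fs_eval_sum: "fs_eval m (\<Sum>x\<in>X. g x) = (\<Sum>x\<in>X. fs_eval m (g x))"
  by (induction X rule: infinite_finite_induct) (simp_all add: fs_eval_add)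

lemma fs_eval_prod: "fs_eval m (\<Prod>x\<in>X. g x) = (\<Prod>x\<in>X. fs_eval m (g x))"
  by (induction X rule: infinite_finite_induct) (simp_all add: fs_eval_mult)

lemma fs_eval_coeff [simp]: "fs_eval m (fs_coeff c) = c"
  by (simp add: fs_coeff_def)

lemma fs_eval_s [simp]: "fs_eval m (fs_s i) = of_nat (m i)"
  by (simp add: fs_s_def monomial_eval_def)

lemma fs_eval_map_deriv: "fs_eval m (Poly_Mapping.map (ratfun_deriv j) g) = ratfun_deriv j (fs_eval m g)"
proof -
  have "keys (Poly_Mapping.map (ratfun_deriv j) g) \<subseteq> keys g"
    by (auto simp: in_keys_iff Poly_Mapping.map.rep_eq when_def)
  thus ?thesis
    by (subst fs_eval_superset[where X = "keys g"])
       (auto simp: fs_eval_def ratfun_deriv_sum ratfun_deriv_mult Poly_Mapping.map.rep_eq when_def in_keys_iff intro!: sum.cong)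
qed

text \<open>Integer exponents, with coefficient \<open>0\<close> at those outside \<open>\<nat>\<^sup>n\<close>: then the effect of derivatives and
  of shifts of the exponent needs no case distinction.\<close>

definition laurent_coeff :: "('n::{finite,linorder}, complex) mpoly \<Rightarrow> ('n \<Rightarrow> int) \<Rightarrow> complex" where
  "laurent_coeff f e = (\<Sum>m\<in>keys f. if \<forall>j. int (lookup m j) = e j then lookup f m else 0)"

lemma laurent_coeff_superset:
  "finite X \<Longrightarrow> keys f \<subseteq> X \<Longrightarrow>
     laurent_coeff f e = (\<Sum>m\<in>X. if \<forall>j. int (lookup m j) = e j then lookup f m else 0)"
  unfolding laurent_coeff_def by (rule sum.mono_neutral_left) (auto simp: in_keys_iff)

lemma laurent_coeff_0 [simp]: "laurent_coeff 0 e = 0"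
  by (simp add: laurent_coeff_def)

lemma laurent_coeff_add: "laurent_coeff (f + g) e = laurent_coeff f e + laurent_coeff g e"
proof -
  let ?X = "keys f \<union> keys g"
  have "finite ?X" "keys (f + g) \<subseteq> ?X" by (simp_all add: Poly_Mapping.keys_add)
  thus ?thesis
    by (simp add: laurent_coeff_superset[where X = ?X] lookup_add sum.distrib[symmetric] if_distrib cong: if_cong)
qed

lemma laurent_coeff_single:
  "laurent_coeff (single m c) e = (if \<forall>j. int (lookup m j) = e j then c else 0)"
  by (subst laurent_coeff_superset[where X = "{m}"]) auto

lemma laurent_coeff_sum: "laurent_coeff (\<Sum>x\<in>X. f x) e = (\<Sum>x\<in>X. laurent_coeff (f x) e)"
  by (induction X rule: infinite_finite_induct) (simp_all add: laurent_coeff_add)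

lemma laurent_coeff_single_mult:
  "laurent_coeff (single m c * f) e = c * laurent_coeff f (\<lambda>j. e j - int (lookup m j))"
proof (induction f rule: mpoly_induct)
  case (2 f m' c')
  have "(\<forall>j. int (lookup (m + m') j) = e j) \<longleftrightarrow>
        (\<forall>j. int (lookup m' j) = e j - int (lookup m j))"
    by (simp add: lookup_add algebra_simps eq_diff_eq)
  with 2 show ?case by (simp add: distrib_left laurent_coeff_add mult_single laurent_coeff_single)
qed simp

text \<open>At \<open>e j = - 1\<close> the factor is 0: a derivative in x_j has no residue. When
  x_j is absent from a monomial, this is also the only exponent that could match on the right-hand
  side.\<close>

lemma laurent_coeff_deriv: "laurent_coeff (mpoly_deriv j f) e = of_int (e j + 1) * laurent_coeff f (e(j := e j + 1))"
proof (induction f rule: mpoly_induct)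
  case 1
  show ?case by (simp add: mpoly_deriv_zero)
next
  case (2 f m c)
  have "laurent_coeff (mpoly_deriv j (single m c)) e =
        of_int (e j + 1) * laurent_coeff (single m c) (e(j := e j + 1))"
  proof (cases "lookup m j = 0")
    case True
    have z: "e j + 1 = 0" if "\<forall>i. int (lookup m i) = (e(j := e j + 1)) i"
      using spec[OF that, of j] True by simp
    hence "of_int (e j + 1) * laurent_coeff (single m c) (e(j := e j + 1)) = 0"
    proof (cases "e j + 1 = 0")
      case False
      with z have "\<not> (\<forall>i. int (lookup m i) = (e(j := e j + 1)) i)" by blast
      thus ?thesis unfolding laurent_coeff_single by (simp only: if_False mult_zero_right)
    qed (simp only: of_int_0 mult_zero_left)
    moreover have "mpoly_deriv j (single m c) = 0"
      using True by (simp add: mpoly_deriv_single)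
    ultimately show ?thesis by simp
  next
    case False
    have "(\<forall>i. int (lookup (m - single j 1) i) = e i) \<longleftrightarrow>
          (\<forall>i. int (lookup m i) = (e(j := e j + 1)) i)"
    proof (intro iff_allI)
      fix i
      show "(int (lookup (m - single j 1) i) = e i) =
          (int (lookup m i) = (e(j := e j + 1)) i)"
        using False by (auto simp: lookup_minus lookup_single when_def)
    qed
    moreover have "of_nat (lookup m j) = (of_int (e j + 1) :: complex)"
      if "\<forall>i. int (lookup m i) = (e(j := e j + 1)) i"
    proof -
      have "int (lookup m j) = e j + 1" using that by (auto dest: spec[of _ j])
      thus ?thesis by (metis of_int_of_nat_eq)
    qed
    ultimately show ?thesis by (simp add: mpoly_deriv_single laurent_coeff_single)
  qed
  with 2 show ?case by (simp only: mpoly_deriv_add laurent_coeff_add distrib_left)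
qed

section \<open>Interpolation along a line of exponents\<close>

lemma Fract_1_mult: "Fract a 1 * Fract b 1 = Fract (a * b) (1::'a::idom)" by simp

lemma Fract_1_0: "Fract 0 1 = (0::'a::idom fract)" by (simp add: Zero_fract_def)
lemma Fract_1_sum: "(\<Sum>x\<in>X. Fract (f x) 1) = Fract (\<Sum>x\<in>X. f x) (1::'a::idom)"
  by (induction X rule: infinite_finite_induct) (simp_all add: Fract_1_0)

section \<open>Words and the deletion of a letter\<close>

lemma count_list_conv_sum: "count_list w a = (\<Sum>t<length w. if w ! t = a then 1 else 0)"
proof (induction w)
  case (Cons b w)
  show ?case
    using Cons by (simp add: sum.lessThan_Suc_shift del: sum.lessThan_Suc)
qed simp

definition del_nth :: "nat \<Rightarrow> 'a list \<Rightarrow> 'a list" where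
  "del_nth t w = take t w @ drop (Suc t) w"

lemma del_nth_Cons_0 [simp]: "del_nth 0 (a # w) = w"
  by (simp add: del_nth_def)

lemma del_nth_Cons_Suc [simp]: "del_nth (Suc t) (a # w) = a # del_nth t w"
  by (simp add: del_nth_def)

lemma set_del_nth: "set (del_nth t w) \<subseteq> set w"
  using set_take_subset[of t w] set_drop_subset[of "Suc t" w] unfolding del_nth_def by auto

lemma count_list_del_nth:
  "t < length w \<Longrightarrow> count_list (del_nth t w) a = count_list w a - (if w ! t = a then 1 else 0)"
  "t < length w \<Longrightarrow> w ! t = a \<Longrightarrow> 0 < count_list w a"
proof -
  assume t: "t < length w"
  have w: "w = take t w @ w ! t # drop (Suc t) w" by (rule id_take_nth_drop[OF t])
  have "count_list w a = count_list (take t w) a + count_list (w ! t # drop (Suc t) w) a"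
    by (subst w) (rule count_list_append)
  thus "count_list (del_nth t w) a = count_list w a - (if w ! t = a then 1 else 0)"
    "w ! t = a \<Longrightarrow> 0 < count_list w a"
    by (auto simp: del_nth_def)
qed

section \<open>Sequences as exponential generating functions\<close>

type_synonym 'n seq = "(nat \<Rightarrow> nat) \<Rightarrow> 'n ratfun"

text \<open>On the generating function of \<open>G\<close>, with terms \<open>G m\<close> tau^m /
  m!, this is d/dtau_i.\<close>

definition shift :: "nat \<Rightarrow> 'n::{finite,linorder} seq \<Rightarrow> 'n seq" where
  "shift i G = (\<lambda>m. G (m(i := Suc (m i))))"

text \<open>Multiplication of the generating function by tau_i. At \<open>m i = 0\<close> the
  truncated argument is harmless, its factor being 0.\<close>

definition tau :: "nat \<Rightarrow> 'n::{finite,linorder} seq \<Rightarrow> 'n seq" where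
  "tau i G = (\<lambda>m. of_nat (m i) * G (m(i := m i - 1)))"

lemma shift_commute: "shift i (shift k G) = shift k (shift i G)"
  by (cases "i = k") (auto simp: shift_def fun_upd_twist)

text \<open>The commutation relation of d/dtau_k and tau_i.\<close>

lemma shift_tau: "shift k (tau i G) = (\<lambda>m. tau i (shift k G) m + (if i = k then G m else 0))"
proof
  fix m
  show "shift k (tau i G) m = tau i (shift k G) m + (if i = k then G m else 0)"
  proof (cases "i = k")
    case True
    show ?thesis
    proof (cases "m k")
      case 0
      hence "m(k := 0) = m" by auto
      thus ?thesis using True 0 by (simp add: shift_def tau_def)
    next
      case (Suc x)
      hence "m(k := Suc x) = m" by auto
      thus ?thesis using True Suc by (simp add: shift_def tau_def algebra_simps)
    qed
  next
    case False
    thus ?thesis by (simp add: shift_def tau_def fun_upd_twist)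
  qed
qed

lemma shift_add: "shift i (\<lambda>m. G m + H m) = (\<lambda>m. shift i G m + shift i H m)"
  by (simp add: shift_def)

lemma shift_cmult: "shift i (\<lambda>m. c * G m) = (\<lambda>m. c * shift i G m)"
  by (simp add: shift_def)

lemma shift_deriv: "shift i (\<lambda>m. ratfun_deriv j (G m)) = (\<lambda>m. ratfun_deriv j (shift i G m))"
  by (simp add: shift_def)

text \<open>Integral data for a rational point: \<open>u + l * d\<close> has to be the content of
  actual words for every natural \<open>l\<close>. In the application \<open>wt\<close> is the ray
  r, \<open>A\<close> consists of exponents on its face, and \<open>pc\<close> expresses their
  monomials through the given system.\<close>

locale bernstein_data =
  fixes fs :: "('n::{finite,linorder}, complex) mpoly list"
    and A :: "('n \<Rightarrow>\<^sub>0 nat) set" and pc :: "('n \<Rightarrow>\<^sub>0 nat) \<Rightarrow> nat \<Rightarrow> ('n, complex) mpoly"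
    and wt :: "'n \<Rightarrow> nat" and \<phi> :: nat and u d :: "('n \<Rightarrow>\<^sub>0 nat) \<Rightarrow> nat" and q :: nat
  assumes finite_A: "finite A"
    and fs_nz: "0 \<notin> set fs"
    and pc: "\<And>a. a \<in> A \<Longrightarrow> single a 1 = (\<Sum>i<length fs. pc a i * fs ! i)"
    and wt_A: "\<And>a. a \<in> A \<Longrightarrow> (\<Sum>j\<in>UNIV. wt j * lookup a j) = \<phi>"
    and wt_fs: "\<And>i m. i < length fs \<Longrightarrow> m \<in> keys (fs ! i) \<Longrightarrow>
      \<phi> \<le> (\<Sum>j\<in>UNIV. wt j * lookup m j)"
    and weight_pos: "\<phi> > 0" and q_pos: "q > 0"
    and ud: "\<And>j. (\<Sum>a\<in>A. d a * lookup a j) = q * ((\<Sum>a\<in>A. u a * lookup a j) + 1)"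
begin

text \<open>
  Replacing \<open>l\<close> by \<open>- 1 / q\<close> turns the content \<open>u + k + l d\<close> of a word into \<open>z + k\<close>, where
  \<open>z = u - d / q\<close> is the point with \<open>\<Sum>\<^sub>a z\<^sub>a a = -(1, \<dots>, 1)\<close>. So \<open>Q\<close> below extends the coefficient of
  \<open>x\<^bsup>\<Sum>a + \<delta>\<^esup>\<close> to that point. The vanishing condition there says that the exponent
  \<open>-(1, \<dots>, 1) + \<Sum>\<^sub>a k\<^sub>a a + \<delta>\<close> has only negative entries, in which case its weight is too small for a
  coefficient of an element of weight at least \<open>\<nu>\<close>. All entries are required to be negative, rather
  than equal to \<open>-1\<close>, to make the condition stable under multiplication by the variables.
\<close>

abbreviation total_exp :: "('n \<Rightarrow>\<^sub>0 nat) list \<Rightarrow> 'n \<Rightarrow> int" where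
  "total_exp w j \<equiv> (\<Sum>a\<in>A. int (count_list w a) * int (lookup a j))"

abbreviation has_content :: "('n \<Rightarrow>\<^sub>0 nat) list \<Rightarrow> (('n \<Rightarrow>\<^sub>0 nat) \<Rightarrow> int) \<Rightarrow> nat \<Rightarrow> bool" where
  "has_content w k l \<equiv> \<forall>a\<in>A. int (count_list w a) = int (u a) + k a + int l * int (d a)"

definition interpolates ::
    "(('n \<Rightarrow>\<^sub>0 nat) list \<Rightarrow> ('n, complex) mpoly) \<Rightarrow> (('n \<Rightarrow>\<^sub>0 nat) \<Rightarrow> int) \<Rightarrow> ('n \<Rightarrow> int) \<Rightarrow>
       complex poly \<Rightarrow> bool" where
  "interpolates F k \<delta> Q \<longleftrightarrow> (\<forall>l. \<forall>w\<in>lists A.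
     has_content w k l \<longrightarrow>
        laurent_coeff (F w) (\<lambda>j. \<delta> j + total_exp w j)
          = poly Q (of_nat l))"

definition vanishing :: "int \<Rightarrow> (('n \<Rightarrow>\<^sub>0 nat) \<Rightarrow> int) \<Rightarrow> ('n \<Rightarrow> int) \<Rightarrow> bool" where
  "vanishing \<nu> k \<delta> \<longleftrightarrow> \<nu> + (\<Sum>a\<in>A. k a) \<ge> 1 \<and>
     (\<forall>j. \<delta> j + (\<Sum>a\<in>A. k a * int (lookup a j)) \<le> 0)"

definition interpolable :: "int \<Rightarrow> (('n \<Rightarrow>\<^sub>0 nat) list \<Rightarrow> ('n, complex) mpoly) \<Rightarrow> bool" where
  "interpolable \<nu> F \<longleftrightarrow> (\<forall>k \<delta>. \<exists>Q. interpolates F k \<delta> Q \<and>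
     (vanishing \<nu> k \<delta> \<longrightarrow> poly Q (- 1 / of_nat q) = 0))"

lemma interpolable_0: "interpolable \<nu> (\<lambda>w. 0)"
  unfolding interpolable_def by (intro allI exI[of _ 0]) (simp add: interpolates_def)

lemma interpolable_add:
  assumes "interpolable \<nu> F" "interpolable \<nu> F'"
  shows "interpolable \<nu> (\<lambda>w. F w + F' w)"
  unfolding interpolable_def
proof (intro allI)
  fix k :: "('n \<Rightarrow>\<^sub>0 nat) \<Rightarrow> int" and \<delta> :: "'n \<Rightarrow> int"
  from assms obtain Q Q' where Q: "interpolates F k \<delta> Q" "interpolates F' k \<delta> Q'"
    "vanishing \<nu> k \<delta> \<Longrightarrow> poly Q (- 1 / of_nat q) = 0" "vanishing \<nu> k \<delta> \<Longrightarrow> poly Q' (- 1 / of_nat q) = 0"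
    unfolding interpolable_def by meson
  have "interpolates (\<lambda>w. F w + F' w) k \<delta> (Q + Q')"
    using Q(1,2) by (simp add: interpolates_def laurent_coeff_add)
  with Q(3,4) show "\<exists>Q. interpolates (\<lambda>w. F w + F' w) k \<delta> Q \<and>
      (vanishing \<nu> k \<delta> \<longrightarrow> poly Q (- 1 / of_nat q) = 0)"
    by (intro exI[of _ "Q + Q'"]) simp
qed

lemma interpolable_single_mult:
  assumes "interpolable \<nu> F"
  shows "interpolable \<nu> (\<lambda>w. single m c * F w)"
  unfolding interpolable_def
proof (intro allI)
  fix k :: "('n \<Rightarrow>\<^sub>0 nat) \<Rightarrow> int" and \<delta> :: "'n \<Rightarrow> int"
  let ?\<delta> = "\<lambda>j. \<delta> j - int (lookup m j)"
  from assms obtain Q where Q: "interpolates F k ?\<delta> Q"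
    "vanishing \<nu> k ?\<delta> \<Longrightarrow> poly Q (- 1 / of_nat q) = 0"
    unfolding interpolable_def by meson
  have "interpolates (\<lambda>w. single m c * F w) k \<delta> (smult c Q)"
    using Q(1) by (simp add: interpolates_def laurent_coeff_single_mult diff_add_eq)
  moreover have "vanishing \<nu> k ?\<delta>" if "vanishing \<nu> k \<delta>"
    using that unfolding vanishing_def
    by (metis (no_types, lifting) add_le_cancel_right diff_ge_0_iff_ge diff_le_eq le_add_same_cancel1 of_nat_0_le_iff order_trans)
  ultimately show "\<exists>Q. interpolates (\<lambda>w. single m c * F w) k \<delta> Q \<and>
      (vanishing \<nu> k \<delta> \<longrightarrow> poly Q (- 1 / of_nat q) = 0)"
    using Q(2) by (intro exI[of _ "smult c Q"]) auto
qed

lemma interpolable_mult: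
  assumes "interpolable \<nu> F"
  shows "interpolable \<nu> (\<lambda>w. h * F w)"
proof (induction h rule: mpoly_induct)
  case (2 h m c)
  from interpolable_add[OF 2 interpolable_single_mult[OF assms, of m c]] show ?case
    by (simp add: distrib_right)
qed (simp add: interpolable_0)

text \<open>The derivative contributes the exponent of x_j, which is \<open>c0 + c1 * l\<close>
  along the line of words and becomes \<open>\<delta> j + (\<Sum>a\<in>A. k a * a j)\<close> at l =
  -1 / q. If that is 0, the factor kills the value, as for a residue. If it is negative, the
  exponent raised by one in direction j still satisfies \<open>vanishing\<close>.\<close>

lemma interpolable_deriv:
  assumes "interpolable \<nu> F"
  shows "interpolable \<nu> (\<lambda>w. mpoly_deriv j (F w))"
  unfolding interpolable_def
proof (intro allI)
  fix k :: "('n \<Rightarrow>\<^sub>0 nat) \<Rightarrow> int" and \<delta> :: "'n \<Rightarrow> int"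
  let ?\<delta> = "\<delta>(j := \<delta> j + 1)"
  let ?a = "\<lambda>a. int (lookup a j)"
  from assms obtain Q where Q: "interpolates F k ?\<delta> Q"
    "vanishing \<nu> k ?\<delta> \<Longrightarrow> poly Q (- 1 / of_nat q) = 0"
    unfolding interpolable_def by meson
  define c0 where "c0 = \<delta> j + 1 + (\<Sum>a\<in>A. (int (u a) + k a) * ?a a)"
  define c1 where "c1 = (\<Sum>a\<in>A. int (d a) * ?a a)"
  define Q' where "Q' = [:of_int c0, of_int c1:] * Q"
  have "interpolates (\<lambda>w. mpoly_deriv j (F w)) k \<delta> Q'"
    unfolding interpolates_def
  proof (intro allI ballI impI)
    fix l w assume w: "w \<in> lists A" "has_content w k l"
    let ?e = "\<lambda>j. \<delta> j + total_exp w j"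
    have "?e j + 1 = c0 + c1 * int l"
    proof -
      have "(\<Sum>a\<in>A. int (count_list w a) * ?a a) =
          (\<Sum>a\<in>A. (int (u a) + k a) * ?a a + int l * (int (d a) * ?a a))"
        using w(2) by (intro sum.cong) (auto simp: algebra_simps)
      thus ?thesis by (simp add: c0_def c1_def sum.distrib sum_distrib_left[symmetric])
    qed
    moreover have "?e(j := ?e j + 1) = (\<lambda>i. ?\<delta> i + total_exp w i)"
      by (auto simp: fun_eq_iff)
    ultimately have "laurent_coeff (mpoly_deriv j (F w)) ?e = of_int (c0 + c1 * int l) *
        laurent_coeff (F w) (\<lambda>i. ?\<delta> i + total_exp w i)"
      unfolding laurent_coeff_deriv by (simp only:)
    also have "\<dots> = poly Q' (of_nat l)"
      using Q(1) w unfolding interpolates_def Q'_def by (simp add: algebra_simps)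
    finally show "laurent_coeff (mpoly_deriv j (F w)) ?e = poly Q' (of_nat l)" .
  qed
  moreover have "poly Q' (- 1 / of_nat q) = 0" if v: "vanishing \<nu> k \<delta>"
  proof (cases "\<delta> j + (\<Sum>a\<in>A. k a * ?a a) = 0")
    case True
    have "c1 = int q * ((\<Sum>a\<in>A. int (u a) * ?a a) + 1)"
      unfolding c1_def using arg_cong[OF ud[of j], of int] by (simp add: distrib_left)
    moreover have "c0 = (\<Sum>a\<in>A. int (u a) * ?a a) + 1"
      using True by (simp add: c0_def distrib_right sum.distrib)
    ultimately have "c1 = int q * c0" by simp
    hence "of_int c0 + of_int c1 * (- 1 / of_nat q) = (0::complex)"
      using q_pos by (simp add: field_simps)
    thus ?thesis by (simp add: Q'_def field_simps)
  next
    case False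
    moreover have "\<delta> j + (\<Sum>a\<in>A. k a * ?a a) \<le> 0"
      using v unfolding vanishing_def by blast
    ultimately have "\<delta> j + (\<Sum>a\<in>A. k a * ?a a) \<le> -1" by linarith
    with v have "vanishing \<nu> k ?\<delta>" by (simp add: vanishing_def)
    with Q(2) show ?thesis by (simp add: Q'_def)
  qed
  ultimately show "\<exists>Q. interpolates (\<lambda>w. mpoly_deriv j (F w)) k \<delta> Q \<and>
      (vanishing \<nu> k \<delta> \<longrightarrow> poly Q (- 1 / of_nat q) = 0)"
    by blast
qed

text \<open>The letter a can be deleted in \<open>count_list w a\<close> ways, a number affine in
  \<open>l\<close>; this is the linear factor in \<open>Q'\<close>. A deletion lowers the sum of
  \<open>k\<close> by one, for which the assumed order \<open>\<nu> + 1\<close> makes up, and adding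
  a to \<open>\<delta>\<close> keeps the exponent in place.\<close>

lemma interpolable_del:
  assumes "\<And>a. a \<in> A \<Longrightarrow> interpolable (\<nu> + 1) (F a)"
  shows "interpolable \<nu> (\<lambda>w. \<Sum>t<length w. F (w ! t) (del_nth t w))"
  unfolding interpolable_def
proof (intro allI)
  fix k :: "('n \<Rightarrow>\<^sub>0 nat) \<Rightarrow> int" and \<delta> :: "'n \<Rightarrow> int"
  let ?k = "\<lambda>a. k(a := k a - 1)" and ?\<delta> = "\<lambda>a j. \<delta> j + int (lookup a j)"
  have "\<forall>a\<in>A. \<exists>Q. interpolates (F a) (?k a) (?\<delta> a) Q \<and>
      (vanishing (\<nu> + 1) (?k a) (?\<delta> a) \<longrightarrow> poly Q (- 1 / of_nat q) = 0)"
    using assms unfolding interpolable_def by blast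
  from bchoice[OF this] obtain Q where Q: "\<And>a. a \<in> A \<Longrightarrow> interpolates (F a) (?k a) (?\<delta> a) (Q a)"
    "\<And>a. a \<in> A \<Longrightarrow> vanishing (\<nu> + 1) (?k a) (?\<delta> a) \<Longrightarrow> poly (Q a) (- 1 / of_nat q) = 0"
    by blast
  define Q' where "Q' = (\<Sum>a\<in>A. [:of_int (int (u a) + k a), of_nat (d a):] * Q a)"
  have sum_upd: "(\<Sum>b\<in>A. f b - (if b = a then c else 0)) = (\<Sum>b\<in>A. f b) - c" if "a \<in> A"
    for f :: "_ \<Rightarrow> int" and a c
    using that finite_A by (simp add: sum_subtractf)
  have "interpolates (\<lambda>w. \<Sum>t<length w. F (w ! t) (del_nth t w)) k \<delta> Q'"
    unfolding interpolates_def
  proof (intro allI ballI impI)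
    fix l w assume w: "w \<in> lists A" "has_content w k l"
    let ?e = "\<lambda>j. \<delta> j + total_exp w j"
    have *: "laurent_coeff (F (w ! t) (del_nth t w)) ?e = poly (Q (w ! t)) (of_nat l)" if t: "t < length w" for t
    proof -
      define a where "a = w ! t"
      have a: "a \<in> A" using w(1) t by (auto simp: a_def)
      have cnt: "int (count_list (del_nth t w) b) = int (count_list w b) - (if b = a then 1 else 0)" for b
        using count_list_del_nth[OF t, of b] by (auto simp: a_def of_nat_diff)
      have "?e = (\<lambda>j. ?\<delta> a j + (\<Sum>b\<in>A. int (count_list (del_nth t w) b) * int (lookup b j)))"
      proof
        fix j
        have "(\<Sum>b\<in>A. int (count_list (del_nth t w) b) * int (lookup b j)) =
            (\<Sum>b\<in>A. int (count_list w b) * int (lookup b j) - (if b = a then int (lookup a j) else 0))"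
          unfolding cnt by (intro sum.cong) (auto simp: algebra_simps)
        thus "?e j = ?\<delta> a j + (\<Sum>b\<in>A. int (count_list (del_nth t w) b) * int (lookup b j))"
          using sum_upd[OF a] by simp
      qed
      moreover have "del_nth t w \<in> lists A" using set_del_nth[of t w] w(1) by auto
      moreover have "\<forall>b\<in>A. int (count_list (del_nth t w) b) = int (u b) + ?k a b + int l * int (d b)"
        using w(2) unfolding cnt by auto
      ultimately show ?thesis
        using Q(1)[OF a] unfolding interpolates_def a_def by simp
    qed
    have "laurent_coeff (\<Sum>t<length w. F (w ! t) (del_nth t w)) ?e = (\<Sum>t<length w. poly (Q (w ! t)) (of_nat l))"
      using * by (simp add: laurent_coeff_sum)
    also have "\<dots> = (\<Sum>t<length w. \<Sum>a\<in>A. if w ! t = a then poly (Q a) (of_nat l) else 0)"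
      using w(1) finite_A by (intro sum.cong) (auto simp: lists_eq_set subset_iff)
    also have "\<dots> = (\<Sum>a\<in>A. \<Sum>t<length w. if w ! t = a then poly (Q a) (of_nat l) else 0)"
      by (rule sum.swap)
    also have "\<dots> = (\<Sum>a\<in>A. of_nat (count_list w a) * poly (Q a) (of_nat l))"
      unfolding count_list_conv_sum of_nat_sum sum_distrib_right by (intro sum.cong refl) auto
    also have "\<dots> = (\<Sum>a\<in>A. of_int (int (u a) + k a + int l * int (d a)) * poly (Q a) (of_nat l))"
      using w(2) by (intro sum.cong refl) (metis of_int_of_nat_eq)
    also have "\<dots> = poly Q' (of_nat l)"
      by (simp add: Q'_def poly_sum algebra_simps)
    finally show "laurent_coeff (\<Sum>t<length w. F (w ! t) (del_nth t w)) ?e = poly Q' (of_nat l)" .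
  qed
  moreover have "poly Q' (- 1 / of_nat q) = 0" if v: "vanishing \<nu> k \<delta>"
  proof -
    have "vanishing (\<nu> + 1) (?k a) (?\<delta> a)" if a: "a \<in> A" for a
    proof -
      have "(\<Sum>b\<in>A. ?k a b) = (\<Sum>b\<in>A. k b - (if b = a then 1 else 0))"
        by (intro sum.cong) auto
      moreover have "(\<Sum>b\<in>A. ?k a b * int (lookup b j)) =
          (\<Sum>b\<in>A. k b * int (lookup b j) - (if b = a then int (lookup a j) else 0))" for j
        by (intro sum.cong) (auto simp: algebra_simps)
      ultimately show ?thesis using v sum_upd[OF a] unfolding vanishing_def by simp
    qed
    with Q(2) show ?thesis by (simp add: Q'_def poly_sum)
  qed
  ultimately show "\<exists>Q. interpolates (\<lambda>w. \<Sum>t<length w. F (w ! t) (del_nth t w)) k \<delta> Q \<and>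
      (vanishing \<nu> k \<delta> \<longrightarrow> poly Q (- 1 / of_nat q) = 0)"
    by blast
qed


lemma lookup_sum_list:
  assumes "w \<in> lists A"
  shows "int (lookup (sum_list w) j) =
      total_exp w j"
  using assms
proof (induction w)
  case (Cons b w)
  have "(\<Sum>a\<in>A. int (count_list (b # w) a) * int (lookup a j)) =
      (\<Sum>a\<in>A. int (count_list w a) * int (lookup a j) +
         (if a = b then int (lookup b j) else 0))"
    by (intro sum.cong) (auto simp: algebra_simps)
  with Cons finite_A show ?case by (auto simp: sum.distrib lookup_add)
qed simp

text \<open>The coefficient is constant in \<open>l\<close>. If it were nonzero,
  \<open>\<delta>\<close> would be an exponent of \<open>h\<close>, of weight at least
  \<open>\<nu> * \<phi>\<close>. As each a has weight \<open>\<phi>\<close>, the exponent with the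
  \<open>k a\<close> copies of a added would weigh at least \<open>\<phi>\<close>, although
  \<open>vanishing\<close> makes all its entries nonpositive.\<close>

lemma interpolable_const_mult_monomial:
  assumes "\<And>m. m \<in> keys h \<Longrightarrow> \<nu> * int \<phi> \<le> int (\<Sum>j\<in>UNIV. wt j * lookup m j)"
  shows "interpolable \<nu> (\<lambda>w. h * single (sum_list w) 1)"
  unfolding interpolable_def
proof (intro allI)
  fix k :: "('n \<Rightarrow>\<^sub>0 nat) \<Rightarrow> int" and \<delta> :: "'n \<Rightarrow> int"
  have "interpolates (\<lambda>w. h * single (sum_list w) 1) k \<delta> [:laurent_coeff h \<delta>:]"
    by (simp add: interpolates_def mult.commute[of h] laurent_coeff_single_mult lookup_sum_list)
  moreover have "laurent_coeff h \<delta> = 0" if v: "vanishing \<nu> k \<delta>"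
  proof (rule ccontr)
    assume "laurent_coeff h \<delta> \<noteq> 0"
    then obtain m where m: "m \<in> keys h" "\<And>j. int (lookup m j) = \<delta> j"
      unfolding laurent_coeff_def by (auto elim!: sum.not_neutral_contains_not_neutral split: if_splits)
    have "(\<nu> + (\<Sum>a\<in>A. k a)) * int \<phi> \<le> (\<Sum>j\<in>UNIV. int (wt j) * \<delta> j) +
        (\<Sum>a\<in>A. k a * int (\<Sum>j\<in>UNIV. wt j * lookup a j))"
      using assms[OF m(1)] wt_A m(2) by (simp add: distrib_right sum_distrib_right)
    also have "(\<Sum>a\<in>A. k a * int (\<Sum>j\<in>UNIV. wt j * lookup a j)) =
        (\<Sum>j\<in>UNIV. \<Sum>a\<in>A. k a * (int (wt j) * int (lookup a j)))"
      by (subst sum.swap) (simp add: sum_distrib_left)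
    also have "(\<Sum>j\<in>UNIV. int (wt j) * \<delta> j) + \<dots> =
       (\<Sum>j\<in>UNIV. int (wt j) * (\<delta> j + (\<Sum>a\<in>A. k a * int (lookup a j))))"
      by (simp add: distrib_left sum.distrib sum_distrib_left mult_ac)
    also have "\<dots> \<le> 0"
      using v by (intro sum_nonpos) (simp add: vanishing_def mult_nonneg_nonpos)
    finally show False
      using v weight_pos unfolding vanishing_def by (smt (verit) mult_pos_pos of_nat_0_less_iff)
  qed
  ultimately show "\<exists>Q. interpolates (\<lambda>w. h * single (sum_list w) 1) k \<delta> Q \<and>
      (vanishing \<nu> k \<delta> \<longrightarrow> poly Q (- 1 / of_nat q) = 0)"
    by (intro exI[of _ "[:laurent_coeff h \<delta>:]"]) simp
qed

text \<open>If \<open>\<Sum>\<^sub>m G m \<tau>\<^sup>m / m!\<close> is the generating function of \<open>G\<close>, then \<open>word_deriv w G\<close> is the derivative along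
  the word \<open>w\<close>, at \<open>\<sigma> = 0\<close>, of the function of \<open>(\<sigma>\<^sub>a)\<close> that results from the
  substitution \<open>\<tau>\<^sub>i = \<Sum>\<^sub>a \<sigma>\<^sub>a pc a i\<close>.\<close>

fun word_deriv :: "('n \<Rightarrow>\<^sub>0 nat) list \<Rightarrow> 'n seq \<Rightarrow> 'n ratfun" where
  "word_deriv [] G = G (\<lambda>_. 0)"
| "word_deriv (a # w) G = (\<Sum>i<length fs. Fract (pc a i) 1 * word_deriv w (shift i G))"

lemma word_deriv_0: "word_deriv w (\<lambda>m. 0) = 0"
  by (induction w) (simp_all add: shift_def)

lemma word_deriv_add: "word_deriv w (\<lambda>m. G m + H m) = word_deriv w G + word_deriv w H"
  by (induction w arbitrary: G H) (simp_all add: shift_add distrib_left sum.distrib)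

lemma word_deriv_cmult: "word_deriv w (\<lambda>m. c * G m) = c * word_deriv w G"
  by (induction w arbitrary: G) (simp_all add: shift_cmult sum_distrib_left mult_ac)

text \<open>Leibniz rule: after the substitution tau_i is linear in sigma and zero at sigma = 0, so
  exactly one letter of the word falls on it.\<close>

lemma word_deriv_tau:
  assumes "i < length fs"
  shows "word_deriv w (tau i G) = (\<Sum>t<length w. Fract (pc (w ! t) i) 1 * word_deriv (del_nth t w) G)"
proof (induction w arbitrary: G)
  case Nil
  show ?case by (simp add: tau_def)
next
  case (Cons a w)
  have "word_deriv (a # w) (tau i G) = (\<Sum>k<length fs. Fract (pc a k) 1 *
      ((\<Sum>t<length w. Fract (pc (w ! t) i) 1 * word_deriv (del_nth t w) (shift k G)) + (if k = i then word_deriv w G else 0)))"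
    unfolding word_deriv.simps shift_tau word_deriv_add Cons by (intro sum.cong refl) (simp add: word_deriv_0)
  also have "\<dots> = (\<Sum>k<length fs. \<Sum>t<length w. Fract (pc a k) 1 *
      (Fract (pc (w ! t) i) 1 * word_deriv (del_nth t w) (shift k G))) + (\<Sum>k<length fs. if k = i then Fract (pc a i) 1 * word_deriv w G else 0)"
    unfolding sum.distrib[symmetric] by (intro sum.cong refl) (simp add: distrib_left sum_distrib_left)
  also have "(\<Sum>k<length fs. if k = i then Fract (pc a i) 1 * word_deriv w G else 0) = Fract (pc a i) 1 * word_deriv w G"
    using assms by simp
  also have "(\<Sum>k<length fs. \<Sum>t<length w. Fract (pc a k) 1 *
      (Fract (pc (w ! t) i) 1 * word_deriv (del_nth t w) (shift k G))) =
      (\<Sum>t<length w. Fract (pc (w ! t) i) 1 * word_deriv (a # del_nth t w) G)"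
    by (subst sum.swap) (simp add: sum_distrib_left mult_ac)
  finally show ?case by (simp add: sum.lessThan_Suc_shift del: sum.lessThan_Suc)
qed

text \<open>Chain rule: the substitution itself involves x through \<open>pc\<close>. Each
  correction term differentiates one coefficient of \<open>pc\<close>, uses up the corresponding
  letter and leaves a derivative in tau_i on \<open>G\<close>.\<close>

lemma word_deriv_deriv:
  "word_deriv w (\<lambda>m. ratfun_deriv j (G m)) = ratfun_deriv j (word_deriv w G) -
     (\<Sum>t<length w. \<Sum>i<length fs. Fract (mpoly_deriv j (pc (w ! t) i)) 1 * word_deriv (del_nth t w) (shift i G))"
proof (induction w arbitrary: G)
  case Nil
  show ?case by simp
next
  case (Cons a w)
  let ?X = "\<lambda>k. \<Sum>t<length w. \<Sum>i<length fs. Fract (mpoly_deriv j (pc (w ! t) i)) 1 *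
        word_deriv (del_nth t w) (shift i (shift k G))"
  have "word_deriv (a # w) (\<lambda>m. ratfun_deriv j (G m)) =
      (\<Sum>k<length fs. Fract (pc a k) 1 * ratfun_deriv j (word_deriv w (shift k G))) -
      (\<Sum>k<length fs. Fract (pc a k) 1 * ?X k)"
    unfolding word_deriv.simps shift_deriv Cons by (simp add: right_diff_distrib sum_subtractf)
  also have "(\<Sum>k<length fs. Fract (pc a k) 1 * ratfun_deriv j (word_deriv w (shift k G))) =
      ratfun_deriv j (word_deriv (a # w) G) - (\<Sum>k<length fs. Fract (mpoly_deriv j (pc a k)) 1 * word_deriv w (shift k G))"
    by (simp add: ratfun_deriv_sum ratfun_deriv_mult ratfun_deriv_poly sum.distrib)
  also have "(\<Sum>k<length fs. Fract (pc a k) 1 * ?X k) =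
      (\<Sum>t<length w. \<Sum>i<length fs. Fract (mpoly_deriv j (pc (w ! t) i)) 1 * word_deriv (a # del_nth t w) (shift i G))"
  proof -
    have "(\<Sum>k<length fs. Fract (pc a k) 1 * ?X k) = (\<Sum>t<length w. \<Sum>i<length fs. \<Sum>k<length fs.
        Fract (pc a k) 1 * (Fract (mpoly_deriv j (pc (w ! t) i)) 1 * word_deriv (del_nth t w) (shift i (shift k G))))"
      unfolding sum_distrib_left by (subst sum.swap) (intro sum.cong refl sum.swap)
    thus ?thesis by (simp add: sum_distrib_left mult.left_commute shift_commute)
  qed
  finally show ?case by (simp add: sum.lessThan_Suc_shift del: sum.lessThan_Suc)
qed

text \<open>Word derivatives are a priori rational functions. Speaking of their coefficients
  presupposes that on words over \<open>A\<close> they are polynomials, so this is made part of the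
  notion.\<close>

definition interpolable_rf :: "int \<Rightarrow> (('n \<Rightarrow>\<^sub>0 nat) list \<Rightarrow> 'n ratfun) \<Rightarrow> bool" where
  "interpolable_rf \<nu> F \<longleftrightarrow> (\<exists>F'. interpolable \<nu> F' \<and> (\<forall>w\<in>lists A. F w = Fract (F' w) 1))"

lemma interpolable_rfI: "interpolable \<nu> F' \<Longrightarrow> (\<And>w. w \<in> lists A \<Longrightarrow> F w = Fract (F' w) 1) \<Longrightarrow> interpolable_rf \<nu> F"
  unfolding interpolable_rf_def by blast

lemma interpolable_rf_0: "interpolable_rf \<nu> (\<lambda>w. 0)"
  by (rule interpolable_rfI[OF interpolable_0]) (simp add: Fract_1_0)

lemma interpolable_rf_add: "interpolable_rf \<nu> F \<Longrightarrow> interpolable_rf \<nu> F' \<Longrightarrow> interpolable_rf \<nu> (\<lambda>w. F w + F' w)"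
  unfolding interpolable_rf_def by (elim exE conjE, rule exI, rule conjI, rule interpolable_add, assumption+) simp

lemma interpolable_rf_mult: "interpolable_rf \<nu> F \<Longrightarrow> interpolable_rf \<nu> (\<lambda>w. Fract h 1 * F w)"
  unfolding interpolable_rf_def using interpolable_mult[of \<nu> _ h] by fastforce

lemma interpolable_rf_sum: "(\<And>x. x \<in> X \<Longrightarrow> interpolable_rf \<nu> (F x)) \<Longrightarrow> interpolable_rf \<nu> (\<lambda>w. \<Sum>x\<in>X. F x w)"
  by (induction X rule: infinite_finite_induct) (simp_all add: interpolable_rf_0 interpolable_rf_add)

lemma interpolable_rf_deriv: "interpolable_rf \<nu> F \<Longrightarrow> interpolable_rf \<nu> (\<lambda>w. ratfun_deriv j (F w))"
  unfolding interpolable_rf_def using interpolable_deriv[of \<nu> _ j] ratfun_deriv_poly[of j] by metis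

lemma interpolable_rf_del:
  assumes "\<And>a. a \<in> A \<Longrightarrow> interpolable_rf (\<nu> + 1) (F a)"
  shows "interpolable_rf \<nu> (\<lambda>w. \<Sum>t<length w. F (w ! t) (del_nth t w))"
proof -
  from assms obtain F' where F': "\<And>a. a \<in> A \<Longrightarrow> interpolable (\<nu> + 1) (F' a)"
    "\<And>a w. a \<in> A \<Longrightarrow> w \<in> lists A \<Longrightarrow> F a w = Fract (F' a w) 1"
    unfolding interpolable_rf_def by metis
  have "F (w ! t) (del_nth t w) = Fract (F' (w ! t) (del_nth t w)) 1" if "w \<in> lists A" "t < length w" for w t
    using that set_del_nth[of t w] by (intro F'(2)) (auto simp: lists_eq_set)
  hence "(\<Sum>t<length w. F (w ! t) (del_nth t w)) = Fract (\<Sum>t<length w. F' (w ! t) (del_nth t w)) 1"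
    if "w \<in> lists A" for w using that by (simp add: Fract_1_sum flip: Fract_1_sum)
  thus ?thesis using interpolable_del[of \<nu> F', OF F'(1)]
    by (intro interpolable_rfI[of \<nu> "\<lambda>w. \<Sum>t<length w. F' (w ! t) (del_nth t w)"]) auto
qed

end

section \<open>The functional on the submodule\<close>

text \<open>Falling factorial; truncation does no harm, since for \<open>n < k\<close> the factor
  with \<open>j = n\<close> is already 0.\<close>

definition falling :: "nat \<Rightarrow> nat \<Rightarrow> nat" where
  "falling n k = (\<Prod>j<k. n - j)"

lemma falling_0 [simp]: "falling n 0 = 1"
  by (simp add: falling_def)

lemma falling_Suc: "falling n (Suc k) = n * falling (n - 1) k"
  unfolding falling_def by (simp add: prod.lessThan_Suc_shift del: prod.lessThan_Suc)

lemma falling_eq_0: "n < k \<Longrightarrow> falling n k = 0"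
  unfolding falling_def by (rule prod_zero) auto

lemma of_nat_falling: "of_nat (falling n k) = (\<Prod>j<k. of_nat n - of_nat j :: 'a::idom)"
proof (cases "n < k")
  case True
  hence "(\<Prod>j<k. of_nat n - of_nat j :: 'a) = 0" by (intro prod_zero) auto
  thus ?thesis using True by (simp add: falling_eq_0)
qed (auto simp: falling_def of_nat_diff intro!: prod.cong)

definition fract_const :: "complex \<Rightarrow> 'n::{finite,linorder} ratfun" where
  "fract_const c = Fract (single 0 c) 1"

lemma fract_const_add: "fract_const (c + c') = fract_const c + fract_const c'"
  by (simp add: fract_const_def single_add)

lemma fract_const_mult: "fract_const (c * c') = fract_const c * fract_const c'"
  by (simp add: fract_const_def mult_single)

lemma fract_const_0 [simp]: "fract_const 0 = 0"
  by (simp add: fract_const_def Fract_1_0)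

lemma fract_const_1 [simp]: "fract_const 1 = 1"
  by (simp add: fract_const_def One_fract_def)

lemma fract_const_of_nat: "fract_const (of_nat k) = of_nat k"
  by (induction k) (simp_all add: fract_const_add)

lemma fs_eval_const [simp]: "fs_eval m (fs_const c) = fract_const c"
  by (simp add: fs_const_def fs_poly_def fract_const_def)

lemma fs_const_0 [simp]: "fs_const 0 = 0"
  by (simp add: fs_const_def fs_poly_def fs_coeff_def Fract_1_0)

lemma fs_eval_poly:
  assumes "fs_eval m y = fract_const c"
  shows "fs_eval m (poly (map_poly fs_const b) y) = fract_const (poly b c)"
  by (induction b)
     (simp_all add: map_poly_pCons fs_eval_add fs_eval_mult fract_const_add fract_const_mult assms)

context bernstein_data begin

text \<open>Iterated shifts are included because the chain rule in \<open>word_deriv_deriv\<close>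
  deletes a letter, and so requires order \<open>\<nu> + 1\<close> from \<open>shift i G\<close>. On
  powers of the system a shift is multiplication by a member, which indeed raises the weight by one
  unit.\<close>

definition tame :: "int \<Rightarrow> 'n seq \<Rightarrow> bool" where
  "tame \<nu> G \<longleftrightarrow> (\<forall>is. set is \<subseteq> {..<length fs} \<longrightarrow>
     interpolable_rf (\<nu> + int (length is)) (\<lambda>w. word_deriv w (fold shift is G)))"

lemma fold_shift_add: "fold shift is (\<lambda>m. G m + H m) = (\<lambda>m. fold shift is G m + fold shift is H m)"
  by (induction "is" arbitrary: G H) (simp_all add: shift_add)

lemma fold_shift_cmult: "fold shift is (\<lambda>m. c * G m) = (\<lambda>m. c * fold shift is G m)"
  by (induction "is" arbitrary: G) (simp_all add: shift_cmult)

lemma fold_shift_deriv: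
  "fold shift is (\<lambda>m. ratfun_deriv j (G m)) = (\<lambda>m. ratfun_deriv j (fold shift is G m))"
  by (induction "is" arbitrary: G) (simp_all add: shift_deriv)

lemma tame_shift:
  assumes "tame \<nu> G" "i < length fs"
  shows "tame (\<nu> + 1) (shift i G)"
  unfolding tame_def
proof (intro allI impI)
  fix js assume "set js \<subseteq> {..<length fs}"
  hence "interpolable_rf (\<nu> + int (length (i # js))) (\<lambda>w. word_deriv w (fold shift (i # js) G))"
    using assms unfolding tame_def by (metis insert_subset lessThan_iff list.simps(15))
  thus "interpolable_rf (\<nu> + 1 + int (length js)) (\<lambda>w. word_deriv w (fold shift js (shift i G)))"
    by (simp add: algebra_simps)
qed

lemma tame_add: "tame \<nu> G \<Longrightarrow> tame \<nu> H \<Longrightarrow> tame \<nu> (\<lambda>m. G m + H m)"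
  by (simp add: tame_def fold_shift_add word_deriv_add interpolable_rf_add)

lemma tame_mult: "tame \<nu> G \<Longrightarrow> tame \<nu> (\<lambda>m. Fract h 1 * G m)"
  by (simp add: tame_def fold_shift_cmult word_deriv_cmult interpolable_rf_mult)

lemma interpolable_rf_word_deriv:
  assumes "interpolable_rf \<nu> (\<lambda>w. word_deriv w G)" "\<And>i. i < length fs \<Longrightarrow> interpolable_rf (\<nu> + 1) (\<lambda>w. word_deriv w (shift i G))"
  shows "interpolable_rf \<nu> (\<lambda>w. word_deriv w (\<lambda>m. ratfun_deriv j (G m)))"
proof -
  have "interpolable_rf \<nu> (\<lambda>w. \<Sum>t<length w. \<Sum>i<length fs.
      Fract (mpoly_deriv j (pc (w ! t) i)) 1 * word_deriv (del_nth t w) (shift i G))"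
    by (rule interpolable_rf_del[of \<nu> "\<lambda>a w. \<Sum>i<length fs. Fract (mpoly_deriv j (pc a i)) 1 * word_deriv w (shift i G)"])
       (intro interpolable_rf_sum interpolable_rf_mult assms, simp)
  from interpolable_rf_add[OF interpolable_rf_deriv[OF assms(1), of j] interpolable_rf_mult[OF this, of "-1"]]
  have "interpolable_rf \<nu> (\<lambda>w. ratfun_deriv j (word_deriv w G) + Fract (- 1) 1 * (\<Sum>t<length w. \<Sum>i<length fs.
      Fract (mpoly_deriv j (pc (w ! t) i)) 1 * word_deriv (del_nth t w) (shift i G)))" .
  moreover have "Fract (- 1) 1 = (- 1 :: 'n ratfun)" by (simp add: One_fract_def)
  ultimately show ?thesis unfolding word_deriv_deriv by simp
qed

lemma tame_deriv:
  assumes "tame \<nu> G"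
  shows "tame \<nu> (\<lambda>m. ratfun_deriv j (G m))"
  unfolding tame_def fold_shift_deriv
proof (intro allI impI)
  fix js assume js: "set js \<subseteq> {..<length fs}"
  have "shift i (fold shift js G) = fold shift js (shift i G)" for i
    by (induction js arbitrary: G) (simp_all add: shift_commute)
  moreover have "interpolable_rf (\<nu> + 1 + int (length js)) (\<lambda>w. word_deriv w (fold shift js (shift i G)))" if "i < length fs" for i
    using tame_shift[OF assms that] js by (simp add: tame_def)
  ultimately show "interpolable_rf (\<nu> + int (length js)) (\<lambda>w. word_deriv w (\<lambda>m. ratfun_deriv j (fold shift js G m)))"
    using assms js by (intro interpolable_rf_word_deriv) (simp_all add: tame_def algebra_simps)
qed

text \<open>Multiplication by tau_i costs one unit of order, by \<open>word_deriv_tau\<close> and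
  the deletion of a letter. Iterated shifts are moved past tau_i by the commutation relation, whose
  extra term has one shift less and thus fits the count.\<close>

lemma tame_tau:
  assumes "tame (\<nu> + 1) G" and i: "i < length fs"
  shows "tame \<nu> (tau i G)"
proof -
  have "interpolable_rf (\<nu> + int (length is)) (\<lambda>w. word_deriv w (fold shift is (tau i G)))"
    if "set is \<subseteq> {..<length fs}" for "is"
    using assms(1) that
  proof (induction "is" arbitrary: \<nu> G)
    case Nil
    hence "interpolable_rf (\<nu> + 1) (\<lambda>w. word_deriv w G)" using Nil(1)[unfolded tame_def, rule_format, of "[]"] by simp
    from interpolable_rf_del[OF interpolable_rf_mult, OF this, of "\<lambda>a. pc a i"] show ?case
      by (simp add: word_deriv_tau[OF i])
  next
    case (Cons k js)
    have *: "interpolable_rf (\<nu> + 1 + int (length js)) (\<lambda>w. word_deriv w (fold shift js (tau i (shift k G))))"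
      using Cons.prems by (intro Cons.IH tame_shift) auto
    show ?case
    proof (cases "i = k")
      case True
      have "interpolable_rf (\<nu> + 1 + int (length js)) (\<lambda>w. word_deriv w (fold shift js G))"
        using Cons.prems by (simp add: tame_def)
      from interpolable_rf_add[OF * this] True show ?thesis
        by (simp add: shift_tau fold_shift_add word_deriv_add algebra_simps)
    next
      case False
      with * show ?thesis by (simp add: shift_tau algebra_simps)
    qed
  qed
  thus ?thesis by (simp add: tame_def)
qed

text \<open>s_i is the Euler operator tau_i d/dtau_i: the shift gains the unit of order that tau_i
  loses.\<close>

lemma tame_s:
  assumes "tame \<nu> G" "i < length fs"
  shows "tame \<nu> (\<lambda>m. of_nat (m i) * G m)"
proof -
  have "tau i (shift i G) = (\<lambda>m. of_nat (m i) * G m)"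
  proof
    fix m :: "nat \<Rightarrow> nat"
    have "m(i := m i) = m" by auto
    thus "tau i (shift i G) m = of_nat (m i) * G m"
      by (cases "m i") (simp_all add: tau_def shift_def)
  qed
  with tame_tau[OF tame_shift[OF assms] assms(2)] show ?thesis by simp
qed

definition fpow :: "'n seq" where
  "fpow m = (\<Prod>i<length fs. Fract (fs ! i) 1 ^ m i)"

lemma shift_fpow:
  assumes "i < length fs"
  shows "shift i fpow = (\<lambda>m. Fract (fs ! i) 1 * fpow m)"
proof
  fix m
  have "(\<Prod>k<length fs. Fract (fs ! k) 1 ^ (m(i := Suc (m i))) k) =
      (\<Prod>k<length fs. (if k = i then Fract (fs ! i) 1 else 1) * Fract (fs ! k) 1 ^ m k)"
    by (intro prod.cong) auto
  also have "\<dots> = Fract (fs ! i) 1 * fpow m"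
    using assms by (simp add: prod.distrib fpow_def)
  finally show "shift i fpow m = Fract (fs ! i) 1 * fpow m" by (simp add: shift_def fpow_def)
qed

text \<open>For constant \<open>h\<close> this is the passage from exp of the sum of tau_i f_i to
  exp of the sum of sigma_a x^a. Since the substitution is linear, total degree in tau equals total
  degree in sigma, so a function of the sum of the m_i becomes a function of the length of the
  word.\<close>

lemma word_deriv_fpow:
  assumes "w \<in> lists A"
  shows "word_deriv w (\<lambda>m. h (\<Sum>i<length fs. m i) * fpow m) = h (length w) * Fract (single (sum_list w) 1) 1"
  using assms
proof (induction w arbitrary: h)
  case Nil
  show ?case by (simp add: fpow_def flip: One_fract_def)
next
  case (Cons a w)
  have "word_deriv w (shift i (\<lambda>m. h (\<Sum>i<length fs. m i) * fpow m)) =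
      Fract (fs ! i) 1 * (h (Suc (length w)) * Fract (single (sum_list w) 1) 1)" if i: "i < length fs" for i
  proof -
    have "(\<Sum>k<length fs. (m(i := Suc (m i))) k) = Suc (\<Sum>k<length fs. m k)" for m
    proof -
      have "(\<Sum>k<length fs. (m(i := Suc (m i))) k) = (\<Sum>k<length fs. m k + (if k = i then 1 else 0))"
        by (intro sum.cong) auto
      thus ?thesis using i by (simp add: sum.distrib)
    qed
    hence "shift i (\<lambda>m. h (\<Sum>i<length fs. m i) * fpow m) =
        (\<lambda>m. Fract (fs ! i) 1 * (h (Suc (\<Sum>i<length fs. m i)) * fpow m))"
      using shift_fpow[OF i] by (auto simp: shift_def fun_eq_iff simp del: fun_upd_apply)
    with Cons.IH[of "\<lambda>k. h (Suc k)"] Cons.prems show ?thesis by (simp add: word_deriv_cmult)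
  qed
  hence "word_deriv (a # w) (\<lambda>m. h (\<Sum>i<length fs. m i) * fpow m) =
      (\<Sum>i<length fs. Fract (pc a i * fs ! i) 1) * (h (Suc (length w)) * Fract (single (sum_list w) 1) 1)"
    unfolding sum_distrib_right Fract_1_mult[symmetric] mult.assoc word_deriv.simps by (intro sum.cong refl) simp
  also have "(\<Sum>i<length fs. Fract (pc a i * fs ! i) 1) = Fract (single a 1) 1"
  proof -
    have "a \<in> A" using Cons.hyps by simp
    thus ?thesis by (simp only: Fract_1_sum pc)
  qed
  also have "\<dots> * (h (Suc (length w)) * Fract (single (sum_list w) 1) 1) =
      h (length (a # w)) * (Fract (single a 1 * single (sum_list w) 1) 1)"
    unfolding Fract_1_mult[symmetric] by simp
  finally show ?case by (simp add: mult_single)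
qed

section \<open>Weights of the given system and of its products\<close>

definition heavy :: "int \<Rightarrow> ('n, complex) mpoly \<Rightarrow> bool" where
  "heavy \<nu> h \<longleftrightarrow> (\<forall>m\<in>keys h. \<nu> * int \<phi> \<le> int (\<Sum>j\<in>UNIV. wt j * lookup m j))"

lemma heavy_mult:
  assumes "heavy \<nu> f" "heavy \<nu>' g"
  shows "heavy (\<nu> + \<nu>') (f * g)"
  unfolding heavy_def
proof
  fix m assume "m \<in> keys (f * g)"
  then obtain a b where m: "m = a + b" "a \<in> keys f" "b \<in> keys g"
    using Poly_Mapping.keys_mult[of f g] by auto
  from assms m(2,3) have "\<nu> * int \<phi> \<le> int (\<Sum>j\<in>UNIV. wt j * lookup a j)"
    "\<nu>' * int \<phi> \<le> int (\<Sum>j\<in>UNIV. wt j * lookup b j)" by (auto simp: heavy_def)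
  thus "(\<nu> + \<nu>') * int \<phi> \<le> int (\<Sum>j\<in>UNIV. wt j * lookup m j)"
    by (simp add: m(1) lookup_add distrib_left distrib_right sum.distrib)
qed

lemma heavy_fs: "i < length fs \<Longrightarrow> heavy 1 (fs ! i)"
  using wt_fs by (auto simp: heavy_def simp del: of_nat_sum of_nat_mult)

lemma heavy_1: "heavy 0 1"
  by (simp add: heavy_def sum_nonneg)

lemma heavy_power: "heavy 1 f \<Longrightarrow> heavy (int k) (f ^ k)"
  by (induction k) (auto simp: heavy_1 dest: heavy_mult)

lemma heavy_prod:
  "(\<And>i. i \<in> X \<Longrightarrow> heavy (\<nu> i) (h i)) \<Longrightarrow> heavy (\<Sum>i\<in>X. \<nu> i) (\<Prod>i\<in>X. h i)"
  by (induction X rule: infinite_finite_induct) (simp_all add: heavy_1 heavy_mult)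

lemma tame_fpow:
  assumes "heavy \<nu> h"
  shows "tame \<nu> (\<lambda>m. Fract h 1 * fpow m)"
proof -
  have "interpolable_rf (\<nu> + int (length is)) (\<lambda>w. word_deriv w (fold shift is (\<lambda>m. Fract h 1 * fpow m)))"
    if "set is \<subseteq> {..<length fs}" for "is"
    using assms that
  proof (induction "is" arbitrary: \<nu> h)
    case Nil
    show ?case
    proof (rule interpolable_rfI)
      show "interpolable (\<nu> + int (length [])) (\<lambda>w. h * single (sum_list w) 1)"
        using Nil interpolable_const_mult_monomial[of h \<nu>] by (simp add: heavy_def)
      show "word_deriv w (fold shift [] (\<lambda>m. Fract h 1 * fpow m)) = Fract (h * single (sum_list w) 1) 1"
        if "w \<in> lists A" for w
        using word_deriv_fpow[OF that, of "\<lambda>_. Fract h 1"] by simp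
    qed
  next
    case (Cons i js)
    have "shift i (\<lambda>m. Fract h 1 * fpow m) = (\<lambda>m. Fract (h * fs ! i) 1 * fpow m)"
      using Cons.prems(2) shift_fpow[of i]
      unfolding Fract_1_mult[symmetric] mult.assoc shift_cmult by simp
    moreover have "heavy (\<nu> + 1) (h * fs ! i)"
      using Cons.prems by (intro heavy_mult heavy_fs) auto
    ultimately show ?case using Cons.IH[of "\<nu> + 1" "h * fs ! i"] Cons.prems
      by (simp add: algebra_simps)
  qed
  thus ?thesis by (simp add: tame_def)
qed

definition falling_fpow :: "(nat \<Rightarrow> nat) \<Rightarrow> 'n seq" where
  "falling_fpow c m = (\<Prod>i<length fs. of_nat (falling (m i) (c i)) * Fract (fs ! i) 1 ^ (m i - c i))"

text \<open>\<open>falling_fpow c\<close> arises from \<open>fpow\<close> by multiplication with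
  tau_i, \<open>c i\<close> times for each i. Each factor costs one unit of order, and the surplus
  weight of \<open>h\<close> pays for it.\<close>

lemma tame_falling:
  assumes "heavy (\<nu> + int (\<Sum>i<length fs. c i)) h"
  shows "tame \<nu> (\<lambda>m. Fract h 1 * falling_fpow c m)"
  using assms
proof (induction "\<Sum>i<length fs. c i" arbitrary: \<nu> c)
  case 0
  hence "falling_fpow c = fpow" by (simp add: falling_fpow_def fpow_def fun_eq_iff)
  with 0 tame_fpow[of \<nu> h] show ?case by simp
next
  case (Suc n)
  from Suc.hyps(2) obtain i where i: "i < length fs" "c i > 0"
    by (metis lessThan_iff not_gr0 sum.neutral nat.distinct(1))
  define c' where "c' = c(i := c i - 1)"
  have "(\<Sum>k<length fs. c k) = (\<Sum>k<length fs. c' k + (if k = i then 1 else 0))"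
    using i by (intro sum.cong) (auto simp: c'_def)
  also have "\<dots> = (\<Sum>k<length fs. c' k) + 1" using i by (simp add: sum.distrib)
  finally have c': "(\<Sum>k<length fs. c k) = (\<Sum>k<length fs. c' k) + 1" .
  have "tame (\<nu> + 1) (\<lambda>m. Fract h 1 * falling_fpow c' m)"
    using Suc.prems c' Suc.hyps(2) by (intro Suc.hyps(1)) (simp_all add: algebra_simps)
  hence "tame \<nu> (tau i (\<lambda>m. Fract h 1 * falling_fpow c' m))"
    using i by (intro tame_tau)
  moreover have "tau i (\<lambda>m. Fract h 1 * falling_fpow c' m) = (\<lambda>m. Fract h 1 * falling_fpow c m)"
  proof
    fix m
    have "falling_fpow c m = (\<Prod>k<length fs. (if k = i then of_nat (m i) else 1) *
       (of_nat (falling ((m(i := m i - 1)) k) (c' k)) * Fract (fs ! k) 1 ^ ((m(i := m i - 1)) k - c' k)))"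
      unfolding falling_fpow_def
    proof (intro prod.cong refl)
      fix k
      show "of_nat (falling (m k) (c k)) * Fract (fs ! k) 1 ^ (m k - c k) = (if k = i then of_nat (m i) else 1) *
         (of_nat (falling ((m(i := m i - 1)) k) (c' k)) * Fract (fs ! k) 1 ^ ((m(i := m i - 1)) k - c' k))"
      proof (cases "k = i")
        case True
        obtain n where "c i = Suc n" using i by (cases "c i") auto
        with True show ?thesis by (simp add: c'_def falling_Suc)
      qed (simp add: c'_def)
    qed
    also have "\<dots> = of_nat (m i) * falling_fpow c' (m(i := m i - 1))"
      unfolding prod.distrib using i by (simp add: falling_fpow_def prod.distrib)
    finally show "tau i (\<lambda>m. Fract h 1 * falling_fpow c' m) m = Fract h 1 * falling_fpow c m"
      by (simp add: tau_def)
  qed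
  ultimately show ?case by simp
qed

lemma tame_imp_interpolable: "tame \<nu> G \<Longrightarrow> interpolable_rf \<nu> (\<lambda>w. word_deriv w G)"
  using tame_def[THEN iffD1, rule_format, of \<nu> G "[]"] by simp

section \<open>Values of module elements at natural parameters\<close>

definition coeff_seq :: "'n fs_module \<Rightarrow> 'n seq" where
  "coeff_seq g m = fs_eval m g * fpow m"

lemma fs_nth_nz: "i < length fs \<Longrightarrow> fs ! i \<noteq> 0"
  using fs_nz by (metis nth_mem)

lemma Fract_fs_nz: "i < length fs \<Longrightarrow> Fract (fs ! i) 1 \<noteq> 0"
  using fs_nth_nz[of i] by (simp add: Zero_fract_def eq_fract)

text \<open>At natural parameters the formal action is honest differentiation, because the product
  of the f_i^m_i is then a rational function with the prescribed logarithmic derivative.\<close>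

lemma coeff_seq_partial: "coeff_seq (fs_partial fs j g) m = ratfun_deriv j (coeff_seq g m)"
proof -
  have "Fract (mpoly_deriv j (fs ! i)) (fs ! i) = ratfun_deriv j (Fract (fs ! i) 1) / Fract (fs ! i) 1"
    if "i < length fs" for i
    using fs_nth_nz[OF that] by (simp add: ratfun_deriv_poly)
  hence "fs_eval m (\<Sum>i<length fs. fs_s i * fs_coeff (Fract (mpoly_deriv j (fs ! i)) (fs ! i))) =
      (\<Sum>i<length fs. of_nat (m i) * (ratfun_deriv j (Fract (fs ! i) 1) / Fract (fs ! i) 1))"
    unfolding fs_eval_sum fs_eval_mult fs_eval_s fs_eval_coeff by (intro sum.cong) simp_all
  moreover have "ratfun_deriv j (fpow m) = fpow m *
      (\<Sum>i<length fs. of_nat (m i) * (ratfun_deriv j (Fract (fs ! i) 1) / Fract (fs ! i) 1))"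
    unfolding fpow_def by (rule ratfun_deriv_prod_power) (simp_all add: Fract_fs_nz)
  ultimately show ?thesis
    by (simp add: coeff_seq_def fs_partial_def fs_eval_add fs_eval_mult fs_eval_map_deriv
        ratfun_deriv_mult algebra_simps)
qed

lemma tame_weyl_s_op:
  assumes "P \<in> weyl_s_ops fs"
  shows "tame \<nu> (coeff_seq g) \<Longrightarrow> tame \<nu> (coeff_seq (P g))"
  using assms
proof (induction P arbitrary: g rule: weyl_s_ops.induct)
  case (const c)
  from tame_mult[OF this, of "single 0 c"] show ?case
    by (simp add: coeff_seq_def fs_eval_mult fract_const_def mult.assoc cong: if_cong)
next
  case (x j)
  from tame_mult[OF this, of "single (single j 1) 1"] show ?case
    by (simp add: coeff_seq_def fs_eval_mult fs_x_def fs_poly_def mult.assoc)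
next
  case (partial j)
  have "coeff_seq (fs_partial fs j g) = (\<lambda>m. ratfun_deriv j (coeff_seq g m))"
    by (rule ext) (rule coeff_seq_partial)
  with tame_deriv[OF partial] show ?case by simp
next
  case (s i)
  from tame_s[OF s(2,1)] show ?case
    by (simp add: coeff_seq_def fs_eval_mult mult.assoc)
next
  case (add P Q)
  have "coeff_seq (P g + Q g) = (\<lambda>m. coeff_seq (P g) m + coeff_seq (Q g) m)"
    by (rule ext) (simp add: coeff_seq_def fs_eval_add distrib_right)
  with add show ?case by (simp add: tame_add)
next
  case (mult P Q)
  thus ?case by simp
qed

lemma fs_eval_binomial: "fs_eval m (fs_binomial i k) = fract_const (1 / fact k) * of_nat (falling (m i) k)"
  by (simp add: fs_binomial_def fs_eval_mult fs_eval_prod fs_eval_diff of_nat_falling)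

text \<open>The binomial factor of a negative \<open>c i\<close> keeps the values polynomial: it
  vanishes for \<open>m i < - c i\<close>, exactly where f_i would occur with a negative
  exponent.\<close>

lemma coeff_seq_bs_element:
  "coeff_seq (bs_element fs c) m =
     Fract ((\<Prod>i\<in>{i. i < length fs \<and> c i < 0}. single 0 (1 / fact (nat (- c i)))) *
       (\<Prod>i<length fs. fs ! i ^ nat (c i))) 1 * falling_fpow (\<lambda>i. nat (- c i)) m"
proof -
  let ?N = "{i. i < length fs \<and> c i < 0}"
  let ?f = "\<lambda>i. Fract (fs ! i) 1 :: 'n ratfun"
  have neg: "(\<Prod>i\<in>?N. h i) = (\<Prod>i<length fs. if c i < 0 then h i else 1)" for h :: "nat \<Rightarrow> 'n ratfun"
  proof -
    have "?N = {..<length fs} \<inter> {i. c i < 0}" by auto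
    thus ?thesis by (simp add: prod.inter_restrict)
  qed
  have prod: "Fract (\<Prod>i\<in>X. h i) 1 = (\<Prod>i\<in>X. Fract (h i) 1)" for X and h :: "nat \<Rightarrow> ('n, complex) mpoly"
    by (induction X rule: infinite_finite_induct) (simp_all flip: One_fract_def Fract_1_mult del: mult_fract)
  have pow: "Fract (h ^ k) 1 = Fract h 1 ^ k" for h :: "('n, complex) mpoly" and k
    by (induction k) (simp_all flip: One_fract_def Fract_1_mult del: mult_fract)
  have "coeff_seq (bs_element fs c) m =
      (\<Prod>i<length fs. (if c i < 0 then fract_const (1 / fact (nat (- c i))) * of_nat (falling (m i) (nat (- c i))) else 1) *
         ?f i powi c i * ?f i ^ m i)"
    unfolding coeff_seq_def bs_element_def fs_eval_mult fs_eval_prod fs_eval_binomial neg fs_eval_coeff fpow_def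
    by (simp add: prod.distrib)
  also have "\<dots> = (\<Prod>i<length fs. (if c i < 0 then fract_const (1 / fact (nat (- c i))) else 1) *
         ?f i ^ nat (c i) * (of_nat (falling (m i) (nat (- c i))) * ?f i ^ (m i - nat (- c i))))"
  proof (intro prod.cong refl)
    fix i assume "i \<in> {..<length fs}"
    hence f: "?f i \<noteq> 0" using Fract_fs_nz by simp
    show "(if c i < 0 then fract_const (1 / fact (nat (- c i))) * of_nat (falling (m i) (nat (- c i))) else 1) *
         ?f i powi c i * ?f i ^ m i = (if c i < 0 then fract_const (1 / fact (nat (- c i))) else 1) *
         ?f i ^ nat (c i) * (of_nat (falling (m i) (nat (- c i))) * ?f i ^ (m i - nat (- c i)))"
    proof (cases "c i < 0")
      case True
      define k where "k = nat (- c i)"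
      have c: "c i = - int k" using True by (simp add: k_def)
      have "of_nat (falling (m i) k) * (?f i powi c i * ?f i ^ m i) = of_nat (falling (m i) k) * ?f i ^ (m i - k)"
      proof (cases "m i < k")
        case False
        hence "?f i ^ m i = ?f i ^ k * ?f i ^ (m i - k)" by (simp flip: power_add)
        moreover have "?f i powi c i * ?f i ^ k = 1"
          using f by (simp only: c power_int_minus power_int_of_nat left_inverse power_not_zero not_False_eq_True)
        ultimately show ?thesis by (simp only: mult.assoc[symmetric] mult_1_right)
      qed (simp add: falling_eq_0)
      thus ?thesis using True by (simp only: if_True k_def[symmetric] c mult.assoc) (simp del: mult_fract)
    next
      case False
      hence "?f i powi c i = ?f i ^ nat (c i)" by (simp add: power_int_def)
      with False show ?thesis by (simp only: if_False nat_eq_iff2) (simp del: mult_fract)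
    qed
  qed
  also have "\<dots> = (\<Prod>i\<in>?N. fract_const (1 / fact (nat (- c i)))) * (\<Prod>i<length fs. ?f i ^ nat (c i)) *
      falling_fpow (\<lambda>i. nat (- c i)) m"
    unfolding neg falling_fpow_def prod.distrib[symmetric] ..
  finally show ?thesis
    unfolding Fract_1_mult[symmetric] prod pow fract_const_def .
qed

text \<open>Each unit of the positive part of \<open>c\<close> contributes a member of the system
  and hence one unit of weight; each unit of the negative part contributes a factor tau_i, which
  costs one. The balance is the sum of \<open>c\<close>.\<close>

lemma tame_bs_element:
  assumes "(\<Sum>i<length fs. c i) = 1"
  shows "tame 1 (coeff_seq (bs_element fs c))"
proof -
  let ?C = "\<Prod>i\<in>{i. i < length fs \<and> c i < 0}. single 0 (1 / fact (nat (- c i)))"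
  let ?F = "\<Prod>i<length fs. fs ! i ^ nat (c i)"
  have "1 + int (\<Sum>i<length fs. nat (- c i)) = (\<Sum>i<length fs. c i + int (nat (- c i)))"
    using assms by (simp add: sum.distrib)
  also have "\<dots> = (\<Sum>i<length fs. int (nat (c i)))"
    by (intro sum.cong) auto
  finally have eq: "1 + int (\<Sum>i<length fs. nat (- c i)) = (\<Sum>i<length fs. int (nat (c i)))" .
  have "heavy (1 + int (\<Sum>i<length fs. nat (- c i))) ?F"
    unfolding eq by (intro heavy_prod heavy_power heavy_fs) simp
  from tame_mult[OF tame_falling[OF this], of ?C]
  have "tame 1 (\<lambda>m. Fract (?C * ?F) 1 * falling_fpow (\<lambda>i. nat (- c i)) m)"
    unfolding Fract_1_mult[symmetric] mult.assoc .
  moreover have "coeff_seq (bs_element fs c) = (\<lambda>m. Fract (?C * ?F) 1 * falling_fpow (\<lambda>i. nat (- c i)) m)"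
    by (rule ext) (rule coeff_seq_bs_element)
  ultimately show ?thesis by simp
qed

lemma tame_bs_submodule:
  assumes "g \<in> bs_submodule fs"
  shows "tame 1 (coeff_seq g)"
proof -
  have add: "coeff_seq (g + h) = (\<lambda>m. coeff_seq g m + coeff_seq h m)" for g h
    by (rule ext) (simp add: coeff_seq_def fs_eval_add distrib_right)
  have "coeff_seq 0 = (\<lambda>m. 0)" by (simp add: coeff_seq_def fun_eq_iff)
  moreover have "tame 1 (\<lambda>m. 0)"
  proof -
    have "fold shift is (\<lambda>m. 0) = (\<lambda>m. 0 :: 'n ratfun)" for "is" by (induction "is") (simp_all add: shift_def)
    thus ?thesis by (simp add: tame_def word_deriv_0 interpolable_rf_0)
  qed
  ultimately have "is_weyl_s_submodule fs {g. tame 1 (coeff_seq g)}"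
    unfolding is_weyl_s_submodule_def by (simp add: add tame_add tame_weyl_s_op)
  moreover have "{bs_element fs c | c. (\<Sum>i<length fs. c i) = 1} \<subseteq> {g. tame 1 (coeff_seq g)}"
    using tame_bs_element by auto
  ultimately have "bs_submodule fs \<subseteq> {g. tame 1 (coeff_seq g)}"
    unfolding bs_submodule_def by (intro hull_minimal)
  with assms show ?thesis by blast
qed

text \<open>Along words of content u + l d the coefficient is \<open>b\<close> at the length of the
  word, which is affine in \<open>l\<close>. Setting l = -1 / q turns this length into the sum of
  the z_a.\<close>

theorem bs_equation_root:
  assumes "bs_equation fs b"
  shows "poly b (of_nat (\<Sum>a\<in>A. u a) - of_nat (\<Sum>a\<in>A. d a) / of_nat q) = 0"
proof -
  let ?g = "poly (map_poly fs_const b) (\<Sum>i<length fs. fs_s i) :: 'n fs_module"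
  let ?U = "\<Sum>a\<in>A. u a" and ?D = "\<Sum>a\<in>A. d a"
  have ev: "fs_eval m (\<Sum>i<length fs. fs_s i) = fract_const (of_nat (\<Sum>i<length fs. m i))" for m
    unfolding fs_eval_sum fract_const_of_nat by simp
  have "coeff_seq ?g = (\<lambda>m. fract_const (poly b (of_nat (\<Sum>i<length fs. m i))) * fpow m)"
    by (rule ext) (simp only: coeff_seq_def fs_eval_poly[OF ev])
  moreover have "tame 1 (coeff_seq ?g)"
    using assms unfolding bs_equation_def by (rule tame_bs_submodule)
  ultimately have "tame 1 (\<lambda>m. fract_const (poly b (of_nat (\<Sum>i<length fs. m i))) * fpow m)" by simp
  hence "interpolable_rf 1 (\<lambda>w. word_deriv w (\<lambda>m. fract_const (poly b (of_nat (\<Sum>i<length fs. m i))) * fpow m))"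
    by (rule tame_imp_interpolable)
  then obtain F where F: "interpolable 1 F"
    "\<forall>w\<in>lists A. word_deriv w (\<lambda>m. fract_const (poly b (of_nat (\<Sum>i<length fs. m i))) * fpow m) = Fract (F w) 1"
    unfolding interpolable_rf_def by blast
  have F_eq: "F w = single (sum_list w) (poly b (of_nat (length w)))" if w: "w \<in> lists A" for w
    using bspec[OF F(2) w] unfolding word_deriv_fpow[OF w, of "\<lambda>k. fract_const (poly b (of_nat k))"]
    by (simp add: fract_const_def mult_single eq_fract)
  from F(1) obtain Q where Q: "interpolates F (\<lambda>_. 0) (\<lambda>_. 0) Q"
    "vanishing 1 (\<lambda>_. 0) (\<lambda>_. 0) \<longrightarrow> poly Q (- 1 / of_nat q) = 0"
    unfolding interpolable_def by blast
  have len: "length w = (\<Sum>a\<in>A. count_list w a)" if "w \<in> lists A" for w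
    using that finite_A by (subst sum_count_set) (auto simp: lists_eq_set)
  have "poly Q (of_nat l) = poly (pcompose b [:of_nat ?U, of_nat ?D:]) (of_nat l)" for l
  proof -
    \<comment> \<open>\<open>interpolates\<close> says something about \<open>l\<close> only if a
      word of that content exists. One exists for every \<open>l\<close>, so the two polynomials
      agree at infinitely many points.\<close>
    obtain w where w: "w \<in> lists A" "\<And>a. a \<in> A \<Longrightarrow> count_list w a = u a + l * d a"
    proof -
      obtain as where as: "set as = A" "distinct as" using finite_A finite_distinct_list by blast
      define w where "w = concat (map (\<lambda>a. replicate (u a + l * d a) a) as)"
      have "count_list (replicate n x) a = (if a = x then n else 0)" for n and a x :: "'n \<Rightarrow>\<^sub>0 nat"
        by (induction n) auto
      hence "count_list w a = (if a \<in> set as then u a + l * d a else 0)" for a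
        using as(2) unfolding w_def by (induction as) auto
      moreover have "w \<in> lists A" using as by (auto simp: w_def)
      ultimately show ?thesis using that as by simp
    qed
    have "laurent_coeff (F w) (\<lambda>j. 0 + total_exp w j) = poly Q (of_nat l)"
      using Q(1) w unfolding interpolates_def by simp
    moreover have "laurent_coeff (F w) (\<lambda>j. 0 + total_exp w j) = poly b (of_nat (length w))"
      unfolding F_eq[OF w(1)] laurent_coeff_single using lookup_sum_list[OF w(1)] by simp
    moreover have "length w = ?U + l * ?D"
      unfolding len[OF w(1)] using w(2) by (simp add: sum.distrib sum_distrib_left)
    ultimately show ?thesis by (simp add: poly_pcompose algebra_simps)
  qed
  hence "range of_nat \<subseteq> {x. poly (Q - pcompose b [:of_nat ?U, of_nat ?D:]) x = 0}" by auto
  hence "infinite {x. poly (Q - pcompose b [:of_nat ?U, of_nat ?D:]) x = 0}"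
    by (metis finite_subset infinite_UNIV_char_0 finite_imageD inj_of_nat)
  hence "Q = pcompose b [:of_nat ?U, of_nat ?D:]"
    using poly_roots_finite by (metis eq_iff_diff_eq_0)
  \<comment> \<open>With \<open>k\<close> and \<open>\<delta>\<close> zero, the exponent at l = -1 /
    q is (-1, ..., -1), and order 1 just meets the bound in \<open>vanishing\<close>.\<close>
  moreover have "vanishing 1 (\<lambda>_. 0) (\<lambda>_. 0)" by (simp add: vanishing_def)
  ultimately have "poly b (of_nat ?U + (- 1 / of_nat q) * of_nat ?D) = 0"
    using Q(2) by (simp add: poly_pcompose)
  thus ?thesis by simp
qed

end

section \<open>Rational cones\<close>

definition dot :: "('n::finite \<Rightarrow> 'a::comm_semiring_0) \<Rightarrow> ('n \<Rightarrow> 'a) \<Rightarrow> 'a" where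
  "dot x y = (\<Sum>j\<in>UNIV. x j * y j)"

lemma dot_add: "dot x (\<lambda>j. y j + z j) = dot x y + dot x z"
  by (simp add: dot_def distrib_left sum.distrib)

lemma dot_diff:
  fixes x y z :: "'n::finite \<Rightarrow> 'a::comm_ring"
  shows "dot x (\<lambda>j. y j - z j) = dot x y - dot x z"
  by (simp add: dot_def right_diff_distrib sum_subtractf)

lemma dot_scale: "dot x (\<lambda>j. c * y j) = c * dot x y"
  by (simp add: dot_def sum_distrib_left mult_ac)

lemma dot_commute: "dot x y = dot y x"
  by (simp add: dot_def mult.commute)

lemma dot_diff_left:
  fixes x y z :: "'n::finite \<Rightarrow> 'a::comm_ring"
  shows "dot (\<lambda>j. y j - z j) x = dot y x - dot z x"
  by (simp add: dot_def left_diff_distrib sum_subtractf)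

lemma dot_sum: "dot x (\<lambda>j. \<Sum>r\<in>R. c r * r j) = (\<Sum>r\<in>R. c r * dot x r)"
  unfolding dot_def sum_distrib_left by (subst sum.swap) (simp add: mult.left_commute)

text \<open>Fredholm alternative, by eliminating t. If d separates e from T, the multiple
  \<open>a\<close> of t is chosen to make e - a t orthogonal to d. A functional d' separating that
  vector from T is then corrected by a multiple of d so as to annihilate t, which leaves its value
  on e - a t unchanged.\<close>

lemma linear_alternative:
  fixes e :: "'n::finite \<Rightarrow> 'a::field"
  assumes "finite T"
  shows "(\<exists>c. \<forall>j. e j = (\<Sum>t\<in>T. c t * t j)) \<or> (\<exists>d. (\<forall>t\<in>T. dot t d = 0) \<and> dot e d \<noteq> 0)"
  using assms
proof (induction T arbitrary: e)
  case empty
  show ?case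
  proof (cases "\<forall>j. e j = 0")
    case False
    then obtain j where j: "e j \<noteq> 0" by blast
    have "dot e (\<lambda>i. if i = j then 1 else 0) = e j" by (simp add: dot_def if_distrib cong: if_cong)
    with j show ?thesis by (metis empty_iff)
  qed simp
next
  case (insert t T)
  have span: "\<exists>c. \<forall>j. e j = (\<Sum>s\<in>insert t T. c s * s j)"
    if c: "\<forall>j. e j - a * t j = (\<Sum>s\<in>T. c s * s j)" for a c
  proof (rule exI[of _ "c(t := a)"], rule allI)
    fix j
    have "(\<Sum>s\<in>insert t T. (c(t := a)) s * s j) = a * t j + (\<Sum>s\<in>T. (c(t := a)) s * s j)"
      using insert.hyps by simp
    also have "(\<Sum>s\<in>T. (c(t := a)) s * s j) = (\<Sum>s\<in>T. c s * s j)"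
      using insert.hyps by (intro sum.cong) auto
    finally show "e j = (\<Sum>s\<in>insert t T. (c(t := a)) s * s j)" using spec[OF c, of j] by (metis add.commute diff_add_cancel)
  qed
  from insert.IH[of e] show ?case
  proof
    assume "\<exists>c. \<forall>j. e j = (\<Sum>t\<in>T. c t * t j)"
    then obtain c where "\<forall>j. e j - 0 * t j = (\<Sum>t\<in>T. c t * t j)" by auto
    from span[OF this] show ?thesis by (rule disjI1)
  next
    assume "\<exists>d. (\<forall>t\<in>T. dot t d = 0) \<and> dot e d \<noteq> 0"
    then obtain d where d: "\<forall>t\<in>T. dot t d = 0" "dot e d \<noteq> 0" by blast
    show ?thesis
    proof (cases "dot t d = 0")
      case True
      with d show ?thesis by blast
    next
      case False
      define a where "a = dot e d / dot t d"
      from insert.IH[of "\<lambda>j. e j - a * t j"] show ?thesis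
      proof
        assume "\<exists>c. \<forall>j. e j - a * t j = (\<Sum>t\<in>T. c t * t j)"
        thus ?thesis using span by blast
      next
        assume "\<exists>d. (\<forall>t\<in>T. dot t d = 0) \<and> dot (\<lambda>j. e j - a * t j) d \<noteq> 0"
        then obtain d' where d': "\<forall>t\<in>T. dot t d' = 0" "dot (\<lambda>j. e j - a * t j) d' \<noteq> 0" by blast
        define b where "b = dot t d' / dot t d"
        let ?d = "\<lambda>j. d' j - b * d j"
        have "dot (\<lambda>j. e j - a * t j) d' = dot e d' - a * dot t d'"
          by (simp add: dot_diff_left) (simp add: dot_def sum_distrib_left mult_ac)
        moreover have "dot e ?d = dot e d' - b * dot e d" by (simp add: dot_diff dot_scale)
        moreover have "a * dot t d' = b * dot e d" by (simp add: a_def b_def)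
        ultimately have "dot e ?d \<noteq> 0" using d'(2) by simp
        moreover have "dot s ?d = 0" if "s \<in> insert t T" for s
        proof -
          have "dot s ?d = dot s d' - b * dot s d" by (simp only: dot_diff dot_scale)
          thus ?thesis using that d(1) d'(1) False by (auto simp: b_def)
        qed
        ultimately show ?thesis by blast
      qed
    qed
  qed
qed

definition unit_vec :: "'n \<Rightarrow> 'n \<Rightarrow> rat" where
  "unit_vec j = (\<lambda>i. if i = j then 1 else 0)"

lemma dot_unit_vec [simp]: "dot (unit_vec j) v = v j"
  by (simp add: dot_def unit_vec_def mult_delta_left)

text \<open>The unit vectors among the constraints place the cone in the nonnegative orthant. So it
  contains no line, and its section by coordinate sum 1 is bounded.\<close>

locale pointed_cone =
  fixes L :: "('n::finite \<Rightarrow> rat) set"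
  assumes finite_L: "finite L" and unit_L: "\<And>j. unit_vec j \<in> L"
begin

definition cone :: "('n \<Rightarrow> rat) set" where
  "cone = {v. \<forall>l\<in>L. dot l v \<ge> 0}"

definition tight :: "('n \<Rightarrow> rat) \<Rightarrow> ('n \<Rightarrow> rat) set" where
  "tight v = {l \<in> L. dot l v = 0}"

text \<open>A vertex of the section by coordinate sum 1, in rank form: the tight constraints leave
  no direction inside the section.\<close>

definition extremal :: "('n \<Rightarrow> rat) \<Rightarrow> bool" where
  "extremal v \<longleftrightarrow> v \<in> cone \<and> sum v UNIV = 1 \<and>
     (\<forall>d. sum d UNIV = 0 \<longrightarrow> (\<forall>l\<in>tight v. dot l d = 0) \<longrightarrow> d = (\<lambda>_. 0))"

text \<open>A vertex is determined by its set of tight constraints, since the difference of two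
  vertices with the same set is an admissible direction.\<close>

lemma finite_extremal: "finite {v. extremal v}"
proof (rule finite_imageD)
  have "tight ` {v. extremal v} \<subseteq> Pow L" by (auto simp: tight_def)
  thus "finite (tight ` {v. extremal v})" using finite_L by (meson finite_Pow_iff finite_subset)
  show "inj_on tight {v. extremal v}"
  proof (rule inj_onI)
    fix v v' assume v: "v \<in> {v. extremal v}" "v' \<in> {v. extremal v}" "tight v = tight v'"
    have "(\<lambda>j. v j - v' j) = (\<lambda>_. 0)"
    proof -
      have "sum (\<lambda>j. v j - v' j) UNIV = 0" using v by (simp add: extremal_def sum_subtractf)
      moreover have "\<forall>l\<in>tight v. dot l (\<lambda>j. v j - v' j) = 0"
        using v(3) unfolding dot_diff by (auto simp: tight_def set_eq_iff)
      ultimately show ?thesis using v(1) by (simp add: extremal_def)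
    qed
    thus "v = v'" by (simp add: fun_eq_iff)
  qed
qed

text \<open>Moving in a direction \<open>d\<close> with \<open>\<Sum> d = 0\<close> eventually leaves the orthant.\<close>

lemma move_to_boundary:
  assumes "v \<in> cone" "sum d UNIV = 0" "d \<noteq> (\<lambda>_. 0)" "\<forall>l\<in>tight v. dot l d = 0"
  obtains t where "t > 0" "(\<lambda>j. v j + t * d j) \<in> cone" "tight v \<subset> tight (\<lambda>j. v j + t * d j)"
proof -
  define N where "N = {l \<in> L. dot l d < 0}"
  have "\<exists>j. d j < 0"
  proof (rule ccontr)
    assume "\<not> (\<exists>j. d j < 0)"
    hence "\<forall>j. d j \<ge> 0" by (simp add: not_less)
    with assms(2) have "\<forall>j. d j = 0" by (simp add: sum_nonneg_eq_0_iff)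
    with assms(3) show False by auto
  qed
  then obtain j where "d j < 0" by blast
  hence N: "N \<noteq> {}" "finite N" using unit_L finite_L by (auto simp: N_def intro!: exI[of _ "unit_vec j"])
  have pos: "dot l v > 0" if "l \<in> N" for l
  proof -
    have "dot l v \<noteq> 0" using that assms(4) by (auto simp: N_def tight_def)
    thus ?thesis using assms(1) that by (force simp: cone_def N_def)
  qed
  \<comment> \<open>Ratio test: the first time at which a decreasing constraint becomes
    tight.\<close>
  define t where "t = Min ((\<lambda>l. dot l v / (- dot l d)) ` N)"
  have "t \<in> (\<lambda>l. dot l v / (- dot l d)) ` N" unfolding t_def using N by (intro Min_in) auto
  then obtain l0 where l0: "l0 \<in> N" "t = dot l0 v / (- dot l0 d)" by blast
  have t: "t > 0" using l0 pos[OF l0(1)] by (auto simp: N_def divide_pos_neg)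
  have le: "t \<le> dot l v / (- dot l d)" if "l \<in> N" for l
    unfolding t_def using N that by (intro Min_le) auto
  have val: "dot l (\<lambda>j. v j + t * d j) = dot l v + t * dot l d" for l
    by (simp add: dot_add dot_scale)
  have "dot l v + t * dot l d \<ge> 0" if l: "l \<in> L" for l
  proof (cases "l \<in> N")
    case True
    hence "- dot l d > 0" by (simp add: N_def)
    with le[OF True] have "t * (- dot l d) \<le> dot l v" by (simp only: pos_le_divide_eq)
    thus ?thesis by simp
  next
    case False
    with l assms(1) t show ?thesis by (auto simp: N_def cone_def)
  qed
  hence "(\<lambda>j. v j + t * d j) \<in> cone" by (simp add: cone_def val)
  moreover have "tight v \<subseteq> tight (\<lambda>j. v j + t * d j)"
    using assms(4) by (auto simp: tight_def val)
  moreover have z: "dot l0 v + t * dot l0 d = 0" using l0 by (auto simp: N_def)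
  have "l0 \<in> tight (\<lambda>j. v j + t * d j)" "l0 \<notin> tight v"
    using l0(1) pos[OF l0(1)] z by (auto simp: tight_def val N_def)
  ultimately show ?thesis using that t by blast
qed

abbreviation ext_comb :: "(('n \<Rightarrow> rat) \<Rightarrow> rat) \<Rightarrow> 'n \<Rightarrow> rat" where
  "ext_comb c j \<equiv> (\<Sum>r\<in>{r. extremal r}. c r * r j)"

text \<open>A point of the section that is not a vertex lies between two points reached by moving
  along d and along -d. Both have more tight constraints, so the number of slack ones serves for
  induction.\<close>

lemma extremal_generate_aux:
  assumes "v \<in> cone" "sum v UNIV = 1"
  shows "\<exists>c. (\<forall>r. c r \<ge> 0) \<and> (\<forall>j. v j = ext_comb c j)"
  using assms
proof (induction "card (L - tight v)" arbitrary: v rule: less_induct)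
  case less
  show ?case
  proof (cases "extremal v")
    case True
    hence "v j = (\<Sum>r\<in>{r. extremal r}. (if r = v then 1 else 0) * r j)" for j
      using finite_extremal by (simp add: if_distrib[of "\<lambda>x. x * _"] cong: if_cong)
    thus ?thesis by (intro exI[of _ "\<lambda>r. if r = v then 1 else 0"]) simp
  next
    case False
    with less.prems obtain d where d: "sum d UNIV = 0" "\<forall>l\<in>tight v. dot l d = 0" "d \<noteq> (\<lambda>_. 0)"
      unfolding extremal_def by blast
    have card: "card (L - tight w) < card (L - tight v)" if "tight v \<subset> tight w" for w
    proof (rule psubset_card_mono)
      have "tight w \<subseteq> L" by (auto simp: tight_def)
      with that show "L - tight w \<subset> L - tight v" by blast
    qed (use finite_L in simp)
    have gen: "\<exists>c. (\<forall>r. c r \<ge> 0) \<and> (\<forall>j. v j + t * d' j = ext_comb c j)"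
      if "(\<lambda>j. v j + t * d' j) \<in> cone" "tight v \<subset> tight (\<lambda>j. v j + t * d' j)" "sum d' UNIV = 0" for t d'
      using less.hyps[OF card[OF that(2)] that(1)] that(3) less.prems(2)
      by (simp add: sum.distrib flip: sum_distrib_left)
    obtain t where t: "t > 0" "(\<lambda>j. v j + t * d j) \<in> cone" "tight v \<subset> tight (\<lambda>j. v j + t * d j)"
      using move_to_boundary[OF less.prems(1) d(1,3,2)] by blast
    from gen[OF t(2,3) d(1)] obtain c where
      c: "\<forall>r. c r \<ge> 0" "\<forall>j. v j + t * d j = ext_comb c j" by blast
    have d': "sum (\<lambda>j. - d j) UNIV = 0" "(\<lambda>j. - d j) \<noteq> (\<lambda>_. 0)" "\<forall>l\<in>tight v. dot l (\<lambda>j. - d j) = 0"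
      using d dot_scale[of _ "-1" d] by (auto simp: sum_negf fun_eq_iff)
    obtain t' where t': "t' > 0" "(\<lambda>j. v j + t' * - d j) \<in> cone" "tight v \<subset> tight (\<lambda>j. v j + t' * - d j)"
      using move_to_boundary[OF less.prems(1) d'] by blast
    from gen[OF t'(2,3) d'(1)] obtain c' where
      c': "\<forall>r. c' r \<ge> 0" "\<forall>j. v j + t' * - d j = ext_comb c' j" by blast
    \<comment> \<open>Weights t' and t make the two displacements t d and - t' d cancel.\<close>
    let ?c = "\<lambda>r. (t' * c r + t * c' r) / (t + t')"
    have "v j = ext_comb ?c j" for j
    proof -
      have "ext_comb ?c j =
          (t' * ext_comb c j + t * ext_comb c' j) / (t + t')"
        by (simp add: sum_distrib_left sum_divide_distrib sum.distrib[symmetric] field_simps)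
      also have "\<dots> = (t' * (v j + t * d j) + t * (v j + t' * - d j)) / (t + t')"
        using spec[OF c(2), of j] spec[OF c'(2), of j] by simp
      also have "\<dots> = v j" using t(1) t'(1) by (simp add: field_simps)
      finally show ?thesis by simp
    qed
    moreover have "?c r \<ge> 0" for r
      using c(1) c'(1) t(1) t'(1) by (simp add: add_nonneg_nonneg)
    ultimately show ?thesis by (intro exI[of _ ?c]) blast
  qed
qed

lemma extremal_generate:
  assumes "v \<in> cone"
  obtains c where "\<And>r. c r \<ge> 0" "\<And>j. v j = ext_comb c j"
proof (cases "sum v UNIV = 0")
  case True
  have "v j \<ge> 0" for j using assms unit_L[of j] by (force simp: cone_def)
  with True have "v j = 0" for j by (simp add: sum_nonneg_eq_0_iff)
  thus ?thesis using that[of "\<lambda>_. 0"] by simp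
next
  case False
  define s where "s = sum v UNIV"
  have "v j \<ge> 0" for j using assms unit_L[of j] by (force simp: cone_def)
  hence s: "s > 0" using False sum_nonneg[of UNIV v] by (auto simp: s_def order_less_le)
  have "(\<lambda>j. (1/s) * v j) \<in> cone" using assms s unfolding cone_def mem_Collect_eq dot_scale by simp
  moreover have "(\<Sum>j\<in>UNIV. (1/s) * v j) = 1" using s by (simp add: s_def flip: sum_divide_distrib)
  ultimately obtain c where c: "\<forall>r. c r \<ge> 0" "\<forall>j. (1/s) * v j = ext_comb c j"
    using extremal_generate_aux by blast
  show ?thesis
  proof (rule that[of "\<lambda>r. s * c r"])
    show "v j = (\<Sum>r\<in>{r. extremal r}. s * c r * r j)" for j
    proof -
      have "v j = s * ((1/s) * v j)" using s by simp
      also have "(1/s) * v j = ext_comb c j" using c(2) by blast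
      finally show ?thesis by (simp only: sum_distrib_left mult.assoc)
    qed
  qed (use c s in simp)
qed

end

section \<open>Down-closed sets of exponents\<close>

text \<open>A monotone subsequence exists; if it decreases, it is constant once its minimum is
  reached.\<close>

lemma nat_seq_incseq_subseq:
  fixes s :: "nat \<Rightarrow> nat"
  obtains g where "strict_mono g" "incseq (\<lambda>n. s (g n))"
proof -
  obtain g where g: "strict_mono g" "monoseq (\<lambda>n. s (g n))" using seq_monosub by blast
  show ?thesis
  proof (cases "incseq (\<lambda>n. s (g n))")
    case False
    with g have dec: "decseq (\<lambda>n. s (g n))" by (simp add: monoseq_iff)
    define m where "m = (LEAST x. x \<in> range (\<lambda>n. s (g n)))"
    have "m \<in> range (\<lambda>n. s (g n))" unfolding m_def by (rule LeastI_ex) auto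
    then obtain N where N: "m = s (g N)" by blast
    have "s (g (n + N)) = m" for n
      using decseqD[OF dec, of N "n + N"] Least_le[of "\<lambda>x. x \<in> range (\<lambda>n. s (g n))" "s (g (n + N))"]
      by (simp add: N[symmetric] m_def[symmetric])
    moreover have "strict_mono (\<lambda>n. g (n + N))" using g(1) by (simp add: strict_mono_def)
    ultimately show ?thesis using that[of "\<lambda>n. g (n + N)"] by (simp add: incseq_def)
  qed (use g that in blast)
qed

lemma dickson_seq:
  fixes f :: "nat \<Rightarrow> 'a \<Rightarrow> nat"
  assumes "finite R"
  shows "\<exists>g. strict_mono g \<and> (\<forall>r\<in>R. incseq (\<lambda>n. f (g n) r))"
  using assms
proof (induction R)
  case empty
  show ?case by (auto intro: exI[of _ id] simp: strict_mono_def)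
next
  case (insert r R)
  then obtain g where g: "strict_mono g" "\<forall>r\<in>R. incseq (\<lambda>n. f (g n) r)" by blast
  obtain h where h: "strict_mono h" "incseq (\<lambda>n. f (g (h n)) r)"
    by (rule nat_seq_incseq_subseq[of "\<lambda>n. f (g n) r"])
  have "incseq (\<lambda>n. f (g (h n)) r')" if "r' \<in> R" for r'
    using g(2) that strict_mono_mono[OF h(1)] by (auto simp: incseq_def mono_def)
  with h g show ?case
    by (intro exI[of _ "\<lambda>n. g (h n)"]) (auto simp: strict_mono_def)
qed

text \<open>Dickson's lemma. The minimal elements form an antichain, and \<open>dickson_seq\<close>
  would find two comparable members in an infinite one.\<close>

lemma dickson_finite_basis:
  fixes \<Gamma> :: "('n::finite \<Rightarrow> nat) set"
  obtains G where "finite G" "G \<subseteq> \<Gamma>" "\<And>u. u \<in> \<Gamma> \<Longrightarrow> \<exists>g\<in>G. g \<le> u"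
proof
  define G where "G = {u \<in> \<Gamma>. \<forall>v\<in>\<Gamma>. v \<le> u \<longrightarrow> v = u}"
  show "finite G"
  proof (rule ccontr)
    assume "infinite G"
    then obtain f :: "nat \<Rightarrow> 'n \<Rightarrow> nat" where f: "inj f" "range f \<subseteq> G"
      using infinite_countable_subset by blast
    obtain g where g: "strict_mono g" "\<forall>r\<in>UNIV. incseq (\<lambda>n. f (g n) r)"
      using dickson_seq[of UNIV f] by auto
    have "f (g 0) \<le> f (g 1)" using g(2) by (auto simp: le_fun_def incseq_def)
    moreover have "f (g 0) \<in> G" "f (g 1) \<in> G" using f(2) by auto
    ultimately have "f (g 0) = f (g 1)" by (simp add: G_def)
    with f(1) have "g 0 = g 1" by (simp add: inj_eq)
    with strict_monoD[OF g(1), of 0 1] show False by simp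
  qed
  show "G \<subseteq> \<Gamma>" by (auto simp: G_def)
  show "\<exists>g\<in>G. g \<le> u" if "u \<in> \<Gamma>" for u
    using that
  proof (induction "sum u UNIV" arbitrary: u rule: less_induct)
    case less
    show ?case
    proof (cases "u \<in> G")
      case False
      then obtain v where v: "v \<in> \<Gamma>" "v \<le> u" "v \<noteq> u" using less.prems by (auto simp: G_def)
      have "sum v UNIV < sum u UNIV"
      proof (rule sum_strict_mono_ex1)
        show "\<forall>x\<in>UNIV. v x \<le> u x" using v(2) by (simp add: le_fun_def)
        show "\<exists>a\<in>UNIV. v a < u a" using v(2,3) by (metis antisym le_fun_def not_le_imp_less UNIV_I)
      qed simp
      from less.hyps[OF this v(1)] v(2) show ?thesis by (meson order_trans)
    qed auto
  qed
qed

definition down_closed :: "('a \<Rightarrow> nat) set \<Rightarrow> bool" where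
  "down_closed D \<longleftrightarrow> (\<forall>k\<in>D. \<forall>k'\<le>k. k' \<in> D)"

lemma down_closedD: "down_closed D \<Longrightarrow> k \<in> D \<Longrightarrow> k' \<le> k \<Longrightarrow> k' \<in> D"
  by (simp add: down_closed_def)

text \<open>The ascending chain condition for monomial ideals, read on complements. Otherwise
  Dickson gives x \<le> y with x removed earlier and y still present later, against
  down-closedness.\<close>

lemma down_closed_stabilises:
  fixes D :: "nat \<Rightarrow> ('a \<Rightarrow> nat) set"
  assumes R: "finite R" "\<And>i. D i \<subseteq> {k. \<forall>r. r \<notin> R \<longrightarrow> k r = 0}"
    and D: "\<And>i. down_closed (D i)" "\<And>i j. i \<le> j \<Longrightarrow> D j \<subseteq> D i"
  shows "\<exists>N. \<forall>i\<ge>N. D i = D N"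
proof (rule ccontr)
  assume "\<not> ?thesis"
  hence "\<forall>N. \<exists>i\<ge>N. \<exists>x. x \<in> D N \<and> x \<notin> D i" using D(2) by blast
  then obtain nx x where nx: "\<And>N. nx N \<ge> N" "\<And>N. x N \<in> D N" "\<And>N. x N \<notin> D (nx N)" by metis
  \<comment> \<open>Iterating \<open>nx\<close> leads to stages at which the element chosen before
    has already left.\<close>
  define s where "s = rec_nat 0 (\<lambda>_. nx)"
  have s: "s (Suc n) = nx (s n)" for n by (simp add: s_def)
  have "incseq s" using nx(1) s by (intro incseq_SucI) simp
  obtain g where g: "strict_mono g" "\<forall>r\<in>R. incseq (\<lambda>n. x (s (g n)) r)"
    using dickson_seq[OF R(1), of "\<lambda>n. x (s n)"] by blast
  have "x (s (g 0)) \<le> x (s (g 1))"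
  proof (rule le_funI)
    fix r show "x (s (g 0)) r \<le> x (s (g 1)) r"
    proof (cases "r \<in> R")
      case True
      with g(2) show ?thesis by (simp add: incseq_def)
    next
      case False
      moreover have "x (s (g 0)) \<in> {k. \<forall>r. r \<notin> R \<longrightarrow> k r = 0}" using R(2) nx(2) by (rule subsetD)
      ultimately show ?thesis by simp
    qed
  qed
  with D(1) nx(2) have "x (s (g 0)) \<in> D (s (g 1))" unfolding down_closed_def by blast
  moreover have "Suc (g 0) \<le> g 1" using strict_monoD[OF g(1), of 0 1] by simp
  hence "nx (s (g 0)) \<le> s (g 1)" using incseqD[OF \<open>incseq s\<close>] s by metis
  ultimately have "x (s (g 0)) \<in> D (nx (s (g 0)))" using D(2) by blast
  with nx(3) show False by blast
qed

section \<open>Generating functions of down-closed sets\<close>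

lemma bij_betw_insert_coordinate:
  assumes "r \<notin> R" "D \<subseteq> {k. \<forall>r'. r' \<notin> insert r R \<longrightarrow> k r' = (0::nat)}"
  shows "bij_betw (\<lambda>(i, k). k(r := i)) (SIGMA i:UNIV. {k. k r = 0 \<and> k(r := i) \<in> D}) D"
proof (rule bij_betwI[where g = "\<lambda>k. (k r, k(r := 0))"])
  show "(\<lambda>(i, k). k(r := i)) \<in> (SIGMA i:UNIV. {k. k r = 0 \<and> k(r := i) \<in> D}) \<rightarrow> D" by auto
  show "(\<lambda>k. (k r, k(r := 0))) \<in> D \<rightarrow> (SIGMA i:UNIV. {k. k r = 0 \<and> k(r := i) \<in> D})" by auto
qed (auto simp: fun_eq_iff)

lemma prod_insert_coordinate:
  assumes "finite R" "r \<notin> R"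
  shows "(\<Prod>r'\<in>insert r R. x r' ^ (k(r := i)) r') = x r ^ i * (\<Prod>r'\<in>R. x r' ^ k r' :: 'b::comm_monoid_mult)"
  using assms by (auto intro!: arg_cong2[of _ _ _ _ "(*)"] prod.cong)

lemma prod_power_summable:
  fixes x :: "'a \<Rightarrow> real"
  assumes "finite R" "\<And>r. r \<in> R \<Longrightarrow> 0 \<le> x r \<and> x r < 1"
  shows "(\<lambda>k. \<Prod>r\<in>R. x r ^ k r) summable_on {k. \<forall>r. r \<notin> R \<longrightarrow> k r = 0}"
  using assms
proof (induction R)
  case empty
  have "{k. \<forall>r. k r = (0::nat)} = {\<lambda>_::'a. 0}" by auto
  thus ?case by simp
next
  case (insert r R)
  let ?D = "{k. \<forall>r'. r' \<notin> insert r R \<longrightarrow> k r' = (0::nat)}"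
  let ?E = "{k. \<forall>r'. r' \<notin> R \<longrightarrow> k r' = (0::nat)}"
  have slice: "{k. k r = 0 \<and> k(r := i) \<in> ?D} = ?E" for i
    using insert.hyps by auto metis
  obtain S where S: "((\<lambda>k. \<Prod>r\<in>R. x r ^ k r) has_sum S) ?E"
    using insert unfolding summable_on_def by auto
  have "(\<lambda>(i, k). \<Prod>r'\<in>insert r R. x r' ^ (k(r := i)) r') summable_on (SIGMA i:UNIV. ?E)"
  proof (rule summable_on_SigmaI)
    fix i :: nat
    show "((\<lambda>k. (\<lambda>(i, k). \<Prod>r'\<in>insert r R. x r' ^ (k(r := i)) r') (i, k)) has_sum x r ^ i * S) ?E"
      unfolding prod.case prod_insert_coordinate[OF insert.hyps] by (rule has_sum_cmult_right[OF S])
    show "(\<lambda>i. x r ^ i * S) summable_on UNIV"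
      using insert.prems[of r]
      by (intro summable_on_cmult_left summable_nonneg_imp_summable_on) (auto intro: summable_geometric)
  qed (use insert.prems in \<open>auto intro!: prod_nonneg mult_nonneg_nonneg\<close>)
  hence "(\<lambda>ik. \<Prod>r'\<in>insert r R. x r' ^ ((\<lambda>(i, k). k(r := i)) ik) r') summable_on
      (SIGMA i:UNIV. {k. k r = 0 \<and> k(r := i) \<in> ?D})"
    unfolding slice by (simp add: case_prod_unfold)
  thus ?case
    using summable_on_reindex_bij_betw[OF bij_betw_insert_coordinate[OF insert.hyps(2), of ?D],
        of "\<lambda>k. \<Prod>r'\<in>insert r R. x r' ^ k r'"] by blast
qed

text \<open>In essence the Hilbert series of a quotient by a monomial ideal. The slices at a fixed
  value of \<open>k r\<close> shrink as that value grows, so they are constant from some N on, and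
  the tail is a geometric series.\<close>

theorem down_closed_generating_function:
  fixes X :: "'a \<Rightarrow> complex \<Rightarrow> complex"
  assumes "finite R" "down_closed D" "D \<subseteq> {k. \<forall>r. r \<notin> R \<longrightarrow> k r = 0}"
    and "\<And>r. r \<in> R \<Longrightarrow> X r holomorphic_on UNIV"
  shows "\<exists>P. P holomorphic_on UNIV \<and> (\<forall>s. (\<forall>r\<in>R. norm (X r s) < 1) \<longrightarrow>
    ((\<lambda>k. \<Prod>r\<in>R. X r s ^ k r) has_sum (P s / (\<Prod>r\<in>R. 1 - X r s))) D)"
  using assms
proof (induction R arbitrary: D)
  case empty
  hence "D \<subseteq> {\<lambda>_. 0}" by auto
  hence "finite D" "card D \<le> 1" using card_mono[of "{\<lambda>_. 0}" D] by (auto intro: finite_subset)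
  thus ?case
    by (intro exI[of _ "\<lambda>_. of_nat (card D)"]) (auto intro!: has_sum_finiteI)
next
  case (insert r R)
  define E where "E i = {k. k r = 0 \<and> k(r := i) \<in> D}" for i
  have E_down: "down_closed (E i)" for i
    unfolding down_closed_def
  proof (intro ballI allI impI)
    fix k k' assume k: "k \<in> E i" "k' \<le> k"
    hence "k'(r := i) \<le> k(r := i)" by (simp add: le_fun_def)
    with k insert.prems(1) have "k'(r := i) \<in> D" unfolding E_def down_closed_def by blast
    moreover have "k' r = 0" using k by (auto simp: E_def le_fun_def dest: spec[of _ r])
    ultimately show "k' \<in> E i" by (simp add: E_def)
  qed
  have E_sub: "E i \<subseteq> {k. \<forall>r. r \<notin> R \<longrightarrow> k r = 0}" for i
  proof
    fix k assume k: "k \<in> E i"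
    hence "(k(r := i)) r' = 0" if "r' \<notin> insert r R" for r' using insert.prems(2) that by (auto simp: E_def)
    hence "k r' = 0" if "r' \<notin> R" for r' using that k by (cases "r' = r") (auto simp: E_def)
    thus "k \<in> {k. \<forall>r. r \<notin> R \<longrightarrow> k r = 0}" by simp
  qed
  have "E j \<subseteq> E i" if "i \<le> j" for i j
  proof
    fix k assume k: "k \<in> E j"
    have "k(r := i) \<le> k(r := j)" using that by (simp add: le_fun_def)
    moreover have "k(r := j) \<in> D" "k r = 0" using k by (auto simp: E_def)
    ultimately show "k \<in> E i" using down_closedD[OF insert.prems(1)] by (simp add: E_def)
  qed
  hence "\<exists>N. \<forall>i\<ge>N. E i = E N"
    by (intro down_closed_stabilises[OF insert.hyps(1) E_sub E_down])
  then obtain N where N: "\<And>i. i \<ge> N \<Longrightarrow> E i = E N" by blast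
  have "\<forall>i. \<exists>P. P holomorphic_on UNIV \<and> (\<forall>s. (\<forall>r\<in>R. norm (X r s) < 1) \<longrightarrow>
    ((\<lambda>k. \<Prod>r\<in>R. X r s ^ k r) has_sum (P s / (\<Prod>r\<in>R. 1 - X r s))) (E i))"
    using insert.IH[OF E_down E_sub] insert.prems(3) by simp
  from choice[OF this] obtain P where P: "\<And>i. P i holomorphic_on UNIV"
    "\<And>i s. (\<forall>r\<in>R. norm (X r s) < 1) \<Longrightarrow>
      ((\<lambda>k. \<Prod>r\<in>R. X r s ^ k r) has_sum (P i s / (\<Prod>r\<in>R. 1 - X r s))) (E i)" by blast
  \<comment> \<open>The slices below N plus the tail, brought over the additional denominator 1 -
    X_r.\<close>
  define Q where "Q s = (1 - X r s) * (\<Sum>i<N. X r s ^ i * P i s) + X r s ^ N * P N s" for s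
  have "Q holomorphic_on UNIV"
    unfolding Q_def using insert.prems(3) P(1) by (intro holomorphic_intros) auto
  moreover have "((\<lambda>k. \<Prod>r\<in>insert r R. X r s ^ k r) has_sum (Q s / (\<Prod>r\<in>insert r R. 1 - X r s))) D"
    if s: "\<forall>r\<in>insert r R. norm (X r s) < 1" for s
  proof -
    define den where "den = (\<Prod>r\<in>R. 1 - X r s)"
    define P' where "P' i = (if i < N then P i s else P N s)" for i
    have sumE: "((\<lambda>k. \<Prod>r\<in>R. X r s ^ k r) has_sum (P' i / den)) (E i)" for i
      unfolding den_def P'_def using P(2)[of s "if i < N then i else N"] s N[of i] by (auto simp: not_less)
    have Xr: "norm (X r s) < 1" "1 - X r s \<noteq> 0" using s by auto
    have "(\<lambda>i. X r s ^ (i + N) * (P N s / den)) sums (1 / (1 - X r s) * (X r s ^ N * (P N s / den)))"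
      using sums_mult2[OF geometric_sums[OF Xr(1)], of "X r s ^ N * (P N s / den)"]
      by (simp add: power_add mult_ac)
    hence "(\<lambda>i. X r s ^ (i + N) * (P' (i + N) / den)) sums (1 / (1 - X r s) * (X r s ^ N * (P N s / den)))"
      by (simp add: P'_def)
    hence "(\<lambda>i. X r s ^ i * (P' i / den)) sums
        (1 / (1 - X r s) * (X r s ^ N * (P N s / den)) + (\<Sum>i<N. X r s ^ i * (P' i / den)))"
      by (subst (asm) sums_iff_shift) simp
    also have "(\<Sum>i<N. X r s ^ i * (P' i / den)) = (\<Sum>i<N. X r s ^ i * P i s) / den"
      by (simp add: P'_def sum_divide_distrib)
    also have "1 / (1 - X r s) * (X r s ^ N * (P N s / den)) + (\<Sum>i<N. X r s ^ i * P i s) / den =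
        Q s / ((1 - X r s) * den)"
      using Xr(2) by (cases "den = 0") (auto simp: Q_def field_simps)
    finally have sums: "(\<lambda>i. X r s ^ i * (P' i / den)) sums (Q s / ((1 - X r s) * den))" .
    have "summable (\<lambda>i. norm (X r s) ^ (i + N) * norm (P N s / den))"
    proof (rule summable_mult2)
      show "summable (\<lambda>i. norm (X r s) ^ (i + N))"
        using summable_ignore_initial_segment[OF summable_geometric, of "norm (X r s)" N] Xr(1) by simp
    qed
    hence "summable (\<lambda>i. norm (X r s ^ (i + N) * (P' (i + N) / den)))"
      by (simp add: P'_def norm_mult norm_power norm_divide)
    hence "summable (\<lambda>i. norm (X r s ^ i * (P' i / den)))"
      by (subst (asm) summable_iff_shift)
    from norm_summable_imp_has_sum[OF this sums]
    have outer: "((\<lambda>i. X r s ^ i * (P' i / den)) has_sum (Q s / ((1 - X r s) * den))) UNIV" .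
    have bij: "bij_betw (\<lambda>(i, k). k(r := i)) (SIGMA i:UNIV. E i) D"
      unfolding E_def by (rule bij_betw_insert_coordinate) (use insert in auto)
    have "(\<lambda>k. norm (\<Prod>r\<in>insert r R. X r s ^ k r)) summable_on {k. \<forall>r'. r' \<notin> insert r R \<longrightarrow> k r' = 0}"
      using prod_power_summable[of "insert r R" "\<lambda>r. norm (X r s)"] insert.hyps(1) s
      by (simp add: prod_norm[symmetric] norm_power norm_mult del: prod.insert)
    hence "(\<lambda>k. norm (\<Prod>r\<in>insert r R. X r s ^ k r)) summable_on D"
      using insert.prems(2) by (rule summable_on_subset_banach)
    hence "(\<lambda>k. \<Prod>r\<in>insert r R. X r s ^ k r) summable_on D"
      by (rule abs_summable_summable)
    hence "(\<lambda>ik. \<Prod>r'\<in>insert r R. X r' s ^ ((\<lambda>(i, k). k(r := i)) ik) r') summable_on (SIGMA i:UNIV. E i)"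
      using summable_on_reindex_bij_betw[OF bij, of "\<lambda>k. \<Prod>r'\<in>insert r R. X r' s ^ k r'"] by blast
    hence "((\<lambda>ik. \<Prod>r'\<in>insert r R. X r' s ^ ((\<lambda>(i, k). k(r := i)) ik) r') has_sum
        (Q s / ((1 - X r s) * den))) (SIGMA i:UNIV. E i)"
    proof (rule has_sum_SigmaI[rotated 2, OF _ _ outer], goal_cases)
      case (1 i)
      show ?case unfolding prod.case prod_insert_coordinate[OF insert.hyps(1,2)]
        by (rule has_sum_cmult_right[OF sumE])
    qed
    hence "((\<lambda>k. \<Prod>r'\<in>insert r R. X r' s ^ k r') has_sum (Q s / ((1 - X r s) * den))) D"
      using has_sum_reindex_bij_betw[OF bij, of "\<lambda>k. \<Prod>r'\<in>insert r R. X r' s ^ k r'"] by blast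
    thus ?thesis using insert.hyps by (simp add: den_def)
  qed
  ultimately show ?case by blast
qed

section \<open>Rays of the normal fan\<close>

text \<open>The function \<phi> of the overview, computed on a finite set of exponents.\<close>

definition min_dot :: "('n::finite \<Rightarrow> nat) set \<Rightarrow> ('n \<Rightarrow> nat) \<Rightarrow> nat" where
  "min_dot G v = Min ((\<lambda>u. dot u v) ` G)"

lemma min_dot_le: "finite G \<Longrightarrow> u \<in> G \<Longrightarrow> min_dot G v \<le> dot u v"
  by (simp add: min_dot_def)

lemma min_dot_attained:
  assumes "finite G" "G \<noteq> {}"
  obtains u where "u \<in> G" "min_dot G v = dot u v"
proof -
  have "min_dot G v \<in> (\<lambda>u. dot u v) ` G" unfolding min_dot_def using assms by (intro Min_in) auto
  thus ?thesis using that by blast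
qed

lemma min_dot_eqI: "finite G \<Longrightarrow> u \<in> G \<Longrightarrow> (\<And>u'. u' \<in> G \<Longrightarrow> dot u v \<le> dot u' v) \<Longrightarrow> min_dot G v = dot u v"
  unfolding min_dot_def by (intro Min_eqI) auto

lemma min_dot_superadditive:
  assumes "finite G" "G \<noteq> {}"
  shows "min_dot G v + min_dot G w \<le> min_dot G (\<lambda>j. v j + w j)"
proof -
  obtain u where u: "u \<in> G" "min_dot G (\<lambda>j. v j + w j) = dot u (\<lambda>j. v j + w j)"
    using min_dot_attained[OF assms] by blast
  thus ?thesis using min_dot_le[OF assms(1) u(1)] by (simp add: dot_add add_mono)
qed

lemma min_dot_superadditive_sum:
  assumes "finite G" "G \<noteq> {}"
  shows "(\<Sum>r\<in>R. k r * min_dot G r) \<le> min_dot G (\<lambda>j. \<Sum>r\<in>R. k r * r j)"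
proof -
  obtain u where u: "u \<in> G" "min_dot G (\<lambda>j. \<Sum>r\<in>R. k r * r j) = dot u (\<lambda>j. \<Sum>r\<in>R. k r * r j)"
    using min_dot_attained[OF assms] by blast
  thus ?thesis using min_dot_le[OF assms(1) u(1)] by (auto simp: dot_sum intro!: sum_mono)
qed

definition rat_vec :: "('n \<Rightarrow> nat) \<Rightarrow> 'n \<Rightarrow> rat" where
  "rat_vec v = (\<lambda>j. of_nat (v j))"

lemma dot_rat_vec: "dot (rat_vec u) (rat_vec v) = of_nat (dot u v)"
  by (simp add: dot_def rat_vec_def)

lemma inj_rat_vec: "inj rat_vec"
  by (auto simp: inj_def rat_vec_def fun_eq_iff)

text \<open>Linear forms cutting out the nonnegative vectors at which \<open>u0\<close> attains the
  minimum, a cone on which \<open>min_dot G\<close> is linear.\<close>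

definition chamber :: "('n::finite \<Rightarrow> nat) set \<Rightarrow> ('n \<Rightarrow> nat) \<Rightarrow> ('n \<Rightarrow> rat) set" where
  "chamber G u0 = range unit_vec \<union> (\<lambda>u j. rat_vec u j - rat_vec u0 j) ` G"

text \<open>These span the face of the Newton polyhedron cut out by \<open>r\<close>. An unbounded direction \<open>e\<^sub>j\<close> of the face
  is represented by \<open>u + e\<^sub>j\<close>, which also is the exponent of an element of the ideal.\<close>

definition face_exponents :: "('n::finite \<Rightarrow> nat) set \<Rightarrow> ('n \<Rightarrow> nat) \<Rightarrow> ('n \<Rightarrow> nat) set" where
  "face_exponents G r = {u \<in> G. dot u r = min_dot G r} \<union>
     {u(j := Suc (u j)) | u j. u \<in> G \<and> dot u r = min_dot G r \<and> r j = 0}"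

definition ones_in_span :: "('n::finite \<Rightarrow> nat) set \<Rightarrow> bool" where
  "ones_in_span A \<longleftrightarrow> (\<exists>z::('n \<Rightarrow> nat) \<Rightarrow> rat. \<forall>j. (\<Sum>a\<in>A. z a * of_nat (a j)) = 1)"

lemma finite_face_exponents: "finite G \<Longrightarrow> finite (face_exponents G (r :: 'n::finite \<Rightarrow> nat))"
proof -
  assume G: "finite G"
  have "face_exponents G r \<subseteq> G \<union> (\<lambda>(u, j). u(j := Suc (u j))) ` (G \<times> UNIV)"
    by (auto simp: face_exponents_def)
  thus ?thesis by (rule finite_subset) (use G in simp)
qed

lemma dot_fun_upd_Suc: "dot (u(j := Suc (u j))) r = dot u r + (r j :: nat)"
proof -
  have "dot (u(j := Suc (u j))) r = (\<Sum>i\<in>UNIV. u i * r i + (if i = j then r j else 0))"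
    unfolding dot_def by (intro sum.cong) auto
  thus ?thesis by (simp add: sum.distrib dot_def)
qed

lemma face_exponents_dot: "a \<in> face_exponents G r \<Longrightarrow> dot a r = min_dot G r"
  by (auto simp: face_exponents_def dot_fun_upd_Suc)

lemma face_exponents_ge: "a \<in> face_exponents G r \<Longrightarrow> \<exists>u\<in>G. u \<le> a"
proof -
  assume "a \<in> face_exponents G r"
  then consider "a \<in> G" | u j where "u \<in> G" "a = u(j := Suc (u j))" by (auto simp: face_exponents_def)
  thus ?thesis
  proof cases
    case 2
    thus ?thesis by (intro bexI[of _ u]) (simp_all add: le_fun_def)
  qed auto
qed

lemma pointed_cone_chamber: "finite G \<Longrightarrow> pointed_cone (chamber G u0)"
  by unfold_locales (auto simp: chamber_def)

lemma cone_chamber_iff: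
  assumes "finite G"
  shows "v \<in> pointed_cone.cone (chamber G u0) \<longleftrightarrow>
    (\<forall>j. v j \<ge> 0) \<and> (\<forall>u\<in>G. dot (rat_vec u0) v \<le> dot (rat_vec u) v)"
proof -
  interpret pointed_cone "chamber G u0" by (rule pointed_cone_chamber[OF assms])
  show ?thesis unfolding cone_def by (simp add: chamber_def ball_Un dot_diff_left)
qed

lemma rat_common_denominator:
  fixes x :: "'a \<Rightarrow> rat"
  assumes "finite X" "\<And>j. j \<in> X \<Longrightarrow> x j \<ge> 0"
  obtains N :: nat and r :: "'a \<Rightarrow> nat" where "N > 0" "\<And>j. j \<in> X \<Longrightarrow> of_nat (r j) = of_nat N * x j"
proof -
  have "\<forall>j\<in>X. \<exists>ab. (snd ab :: nat) > 0 \<and> x j = of_nat (fst ab) / of_nat (snd ab)"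
  proof
    fix j assume j: "j \<in> X"
    obtain a b where ab: "quotient_of (x j) = (a, b)" by fastforce
    have b: "b > 0" using ab by (rule quotient_of_denom_pos)
    have x: "x j = of_int a / of_int b" using ab by (rule quotient_of_div)
    with assms(2)[OF j] b have "a \<ge> 0" by (simp add: zero_le_divide_iff)
    with b x show "\<exists>ab. (snd ab :: nat) > 0 \<and> x j = of_nat (fst ab) / of_nat (snd ab)"
      by (intro exI[of _ "(nat a, nat b)"]) simp
  qed
  from bchoice[OF this] obtain f where
    f: "\<And>j. j \<in> X \<Longrightarrow> (snd (f j) :: nat) > 0 \<and> x j = of_nat (fst (f j)) / of_nat (snd (f j))" by blast
  define a b where "a j = fst (f j)" and "b j = snd (f j)" for j
  have ab: "b j > 0" "x j = of_nat (a j) / of_nat (b j)" if "j \<in> X" for j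
    using f[OF that] by (simp_all add: a_def b_def)
  show ?thesis
  proof (rule that[of "prod b X" "\<lambda>j. a j * prod b (X - {j})"])
    show "prod b X > 0" using ab(1) by (simp add: prod_pos)
    fix j assume j: "j \<in> X"
    have "prod b X = b j * prod b (X - {j})" by (rule prod.remove[OF assms(1) j])
    thus "of_nat (a j * prod b (X - {j})) = of_nat (prod b X) * x j"
      using ab[OF j] by simp
  qed
qed

text \<open>At an extremal vector of a chamber the tight constraints leave only one direction free, so a
  vector orthogonal to the face must vanish on the all-ones vector.\<close>

lemma extremal_ones_in_span:
  assumes G: "finite G" "u0 \<in> G" and ext: "pointed_cone.extremal (chamber G u0) \<rho>"
    and r: "N > 0" "\<And>j. of_nat (r j) = of_nat N * \<rho> j" and min_dot: "min_dot G r > 0"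
  shows "ones_in_span (face_exponents G r)"
proof -
  interpret pointed_cone "chamber G u0" by (rule pointed_cone_chamber[OF G(1)])
  have rv: "rat_vec r = (\<lambda>j. of_nat N * \<rho> j)" using r(2) by (auto simp: rat_vec_def)
  have rho: "\<And>j. \<rho> j \<ge> 0" "\<And>u. u \<in> G \<Longrightarrow> dot (rat_vec u0) \<rho> \<le> dot (rat_vec u) \<rho>" "sum \<rho> UNIV = 1"
    using ext cone_chamber_iff[OF G(1)] by (auto simp: extremal_def)
  have dot_r: "of_nat (dot u r) = of_nat N * dot (rat_vec u) \<rho>" for u
    unfolding dot_rat_vec[symmetric] rv dot_scale ..
  have u0_min: "min_dot G r = dot u0 r"
  proof (rule min_dot_eqI[OF G])
    fix u assume "u \<in> G"
    hence "of_nat (dot u0 r) \<le> (of_nat (dot u r) :: rat)"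
      unfolding dot_r using rho(2) r(1) by (simp add: mult_left_mono)
    thus "dot u0 r \<le> dot u r" by simp
  qed
  let ?A = "face_exponents G r"
  have "finite (rat_vec ` ?A)" using G(1) by (simp add: finite_face_exponents)
  from linear_alternative[OF this, of "\<lambda>_. 1"] show ?thesis
  proof
    assume "\<exists>c. \<forall>j. 1 = (\<Sum>t\<in>rat_vec ` ?A. c t * t j)"
    then obtain c where "\<forall>j. 1 = (\<Sum>t\<in>rat_vec ` ?A. c t * t j)" by blast
    moreover have "(\<Sum>t\<in>rat_vec ` ?A. c t * t j) = (\<Sum>a\<in>?A. c (rat_vec a) * of_nat (a j))" for j
      by (subst sum.reindex[OF inj_on_subset[OF inj_rat_vec]]) (simp_all add: rat_vec_def)
    ultimately have "\<forall>j. (\<Sum>a\<in>?A. c (rat_vec a) * of_nat (a j)) = 1" by simp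
    thus ?thesis unfolding ones_in_span_def by (intro exI[of _ "\<lambda>a. c (rat_vec a)"])
  next
    assume "\<exists>d. (\<forall>t\<in>rat_vec ` ?A. dot t d = 0) \<and> dot (\<lambda>_. 1) d \<noteq> 0"
    then obtain d where d: "\<And>a. a \<in> ?A \<Longrightarrow> dot (rat_vec a) d = 0" "sum d UNIV \<noteq> 0"
      by (auto simp: dot_def)
    \<comment> \<open>As \<open>\<rho>\<close> has sum 1, this removes the component along
      \<open>\<rho>\<close> and leaves a direction of sum 0, to which extremality applies.\<close>
    define d' where "d' = (\<lambda>j. d j - sum d UNIV * \<rho> j)"
    have dot_d': "dot l d' = dot l d - sum d UNIV * dot l \<rho>" for l
      unfolding d'_def dot_diff dot_scale ..
    have u0: "dot (rat_vec u0) d = 0" "dot (rat_vec u0) \<rho> > 0"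
    proof -
      show "dot (rat_vec u0) d = 0" by (rule d(1)) (use G u0_min in \<open>auto simp: face_exponents_def\<close>)
      have "of_nat N * dot (rat_vec u0) \<rho> > 0" using min_dot u0_min dot_r[of u0] by (metis of_nat_0_less_iff)
      thus "dot (rat_vec u0) \<rho> > 0" using r(1) by (simp add: zero_less_mult_iff)
    qed
    have "sum d' UNIV = 0"
      using rho(3) by (simp add: d'_def sum_subtractf flip: sum_distrib_left)
    moreover have "dot l d' = 0" if l: "l \<in> tight \<rho>" for l
    proof -
      have l': "l \<in> chamber G u0" "dot l \<rho> = 0" using l by (auto simp: tight_def)
      from l'(1) consider j where "l = unit_vec j" | u where "u \<in> G" "l = (\<lambda>j. rat_vec u j - rat_vec u0 j)"
        by (auto simp: chamber_def)
      hence "dot l d = 0"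
      proof cases
        case 1
        have "\<rho> j = 0" using l'(2) 1 by simp
        hence "r j = 0" using r(2)[of j] by simp
        \<comment> \<open>Comparing this exponent with \<open>u0\<close>, both orthogonal to d,
          gives \<open>d j = 0\<close>: the unbounded direction is accounted for.\<close>
        hence "u0(j := Suc (u0 j)) \<in> ?A" using G u0_min by (auto simp: face_exponents_def)
        hence "dot (rat_vec (u0(j := Suc (u0 j)))) d = 0" by (rule d(1))
        moreover have "rat_vec (u0(j := Suc (u0 j))) = (\<lambda>i. rat_vec u0 i + unit_vec j i)"
          by (auto simp: rat_vec_def unit_vec_def)
        moreover have "dot (\<lambda>i. rat_vec u0 i + unit_vec j i) d = dot (rat_vec u0) d + d j"
          by (subst dot_commute, subst dot_add) (simp add: dot_commute[of d])
        ultimately show ?thesis using u0(1) 1 by simp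
      next
        case 2
        hence "dot (rat_vec u) \<rho> = dot (rat_vec u0) \<rho>" using l'(2) by (simp add: dot_diff_left)
        hence "dot u r = dot u0 r" using dot_r by (metis of_nat_eq_iff)
        hence "u \<in> ?A" using 2 u0_min by (auto simp: face_exponents_def)
        thus ?thesis using d(1) u0(1) 2 by (simp add: dot_diff_left)
      qed
      with l'(2) show ?thesis by (simp add: dot_d')
    qed
    ultimately have "d' = (\<lambda>_. 0)" using ext by (simp add: extremal_def)
    \<comment> \<open>The left side also equals minus the sum of d times
      \<open>dot (rat_vec u0) \<rho>\<close>; both factors are nonzero, the second because
      \<open>min_dot G r\<close> is positive.\<close>
    hence "dot (rat_vec u0) d' = 0" by (simp add: dot_def)
    with u0 d(2) show ?thesis by (simp add: dot_d')
  qed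
qed

text \<open>\<open>R\<close> collects the vertices of all chambers, scaled to natural vectors. Those
  used for one v come from a single chamber, so a common u is minimal at v and on all of
  \<open>X\<close>; additivity of \<open>min_dot\<close> rests on this.\<close>

theorem rays_exist:
  fixes G :: "('n::finite \<Rightarrow> nat) set"
  assumes G: "finite G" "G \<noteq> {}"
  obtains R where "finite R" "\<And>r. r \<in> R \<Longrightarrow> r \<noteq> (\<lambda>_. 0)"
    "\<And>r. r \<in> R \<Longrightarrow> min_dot G r > 0 \<Longrightarrow> ones_in_span (face_exponents G r)"
    "\<And>v. \<exists>u\<in>G. \<exists>X\<subseteq>R. \<exists>c::('n \<Rightarrow> nat) \<Rightarrow> rat. (\<forall>r. c r \<ge> 0) \<and>
       (\<forall>j. of_nat (v j) = (\<Sum>r\<in>X. c r * of_nat (r j))) \<and> (\<forall>r\<in>X. min_dot G r = dot u r) \<and> min_dot G v = dot u v"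
proof -
  define Ext where "Ext u0 = {\<rho>. pointed_cone.extremal (chamber G u0) \<rho>}" for u0
  have nonneg: "\<rho> j \<ge> 0" if "\<rho> \<in> Ext u0" for \<rho> u0 j
    using that cone_chamber_iff[OF G(1), of \<rho> u0] pointed_cone.extremal_def[OF pointed_cone_chamber[OF G(1)]]
    by (auto simp: Ext_def)
  have total: "sum \<rho> UNIV = 1" if "\<rho> \<in> Ext u0" for \<rho> u0
    using that pointed_cone.extremal_def[OF pointed_cone_chamber[OF G(1)]] by (auto simp: Ext_def)
  have "\<forall>\<rho> :: 'n \<Rightarrow> rat. \<exists>Nr. (\<forall>j. \<rho> j \<ge> 0) \<longrightarrow>
      (fst Nr :: nat) > 0 \<and> (\<forall>j. of_nat (snd Nr j) = of_nat (fst Nr) * \<rho> j)"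
  proof
    fix \<rho> :: "'n \<Rightarrow> rat"
    show "\<exists>Nr. (\<forall>j. \<rho> j \<ge> 0) \<longrightarrow> (fst Nr :: nat) > 0 \<and> (\<forall>j. of_nat (snd Nr j) = of_nat (fst Nr) * \<rho> j)"
    proof (cases "\<forall>j. \<rho> j \<ge> 0")
      case True
      then obtain N :: nat and r where "N > 0" "\<And>j. of_nat (r j) = of_nat N * \<rho> j"
        using rat_common_denominator[of UNIV \<rho>] by auto
      thus ?thesis by (intro exI[of _ "(N, r)"]) simp
    qed blast
  qed
  from choice[OF this] obtain Nr :: "('n \<Rightarrow> rat) \<Rightarrow> nat \<times> ('n \<Rightarrow> nat)" where
    Nr: "\<And>\<rho>. (\<forall>j. \<rho> j \<ge> 0) \<Longrightarrow> fst (Nr \<rho>) > 0 \<and> (\<forall>j. of_nat (snd (Nr \<rho>) j) = of_nat (fst (Nr \<rho>)) * \<rho> j)"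
    by blast
  define N where "N \<rho> = fst (Nr \<rho>)" for \<rho>
  define sc where "sc \<rho> = snd (Nr \<rho>)" for \<rho>
  have N: "N \<rho> > 0" and sc: "of_nat (sc \<rho> j) = of_nat (N \<rho>) * \<rho> j" if "\<rho> \<in> Ext u0" for \<rho> u0 j
    using Nr[of \<rho>] nonneg[OF that] by (auto simp: N_def sc_def)
  define R where "R = (\<Union>u0\<in>G. sc ` Ext u0)"
  show ?thesis
  proof (rule that[of R])
    show "finite R"
      unfolding R_def Ext_def using G(1) pointed_cone.finite_extremal[OF pointed_cone_chamber[OF G(1)]] by blast
    show "r \<noteq> (\<lambda>_. 0)" if "r \<in> R" for r
    proof
      assume "r = (\<lambda>_. 0)"
      with that obtain u0 \<rho> where \<rho>: "\<rho> \<in> Ext u0" "sc \<rho> = (\<lambda>_. 0)" by (auto simp: R_def)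
      hence "\<rho> j = 0" for j using sc[OF \<rho>(1), of j] N[OF \<rho>(1)] by simp
      with total[OF \<rho>(1)] show False by simp
    qed
    show "ones_in_span (face_exponents G r)" if "r \<in> R" "min_dot G r > 0" for r
    proof -
      from that(1) obtain u0 \<rho> where \<rho>: "u0 \<in> G" "\<rho> \<in> Ext u0" "r = sc \<rho>" by (auto simp: R_def)
      show ?thesis
        by (rule extremal_ones_in_span[OF G(1) \<rho>(1) _ N[OF \<rho>(2)]])
           (use \<rho> sc that(2) in \<open>auto simp: Ext_def\<close>)
    qed
    fix v :: "'n \<Rightarrow> nat"
    obtain u where u: "u \<in> G" "min_dot G v = dot u v" using min_dot_attained[OF G] by blast
    interpret pointed_cone "chamber G u" by (rule pointed_cone_chamber[OF G(1)])
    have "dot u v \<le> dot u' v" if "u' \<in> G" for u'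
      using min_dot_le[OF G(1) that, of v] u(2) by simp
    hence "rat_vec v \<in> cone"
      unfolding cone_chamber_iff[OF G(1)] dot_rat_vec by (simp add: rat_vec_def)
    then obtain c where c: "\<And>r. c r \<ge> 0" "\<And>j. rat_vec v j = ext_comb c j"
      using extremal_generate by blast
    \<comment> \<open>Vertices have sum 1, so the coordinate sum of \<open>sc \<rho>\<close> gives
      back the scaling factor.\<close>
    have inj: "inj_on sc (Ext u)"
    proof (rule inj_onI)
      fix \<rho> \<rho>' assume \<rho>: "\<rho> \<in> Ext u" "\<rho>' \<in> Ext u" "sc \<rho> = sc \<rho>'"
      have eq: "of_nat (N \<rho>) * \<rho> j = of_nat (N \<rho>') * \<rho>' j" for j
        using sc[OF \<rho>(1), of j] sc[OF \<rho>(2), of j] \<rho>(3) by simp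
      have "of_nat (N \<rho>) * sum \<rho> UNIV = of_nat (N \<rho>') * sum \<rho>' UNIV"
        unfolding sum_distrib_left using eq by simp
      hence "N \<rho> = N \<rho>'" using total \<rho> by simp
      thus "\<rho> = \<rho>'" using eq N[OF \<rho>(1)] by (auto simp: fun_eq_iff)
    qed
    define X where "X = sc ` Ext u"
    define c' where "c' r = (if r \<in> X then c (inv_into (Ext u) sc r) / of_nat (N (inv_into (Ext u) sc r)) else 0)" for r
    have "of_nat (v j) = (\<Sum>r\<in>X. c' r * of_nat (r j))" for j
    proof -
      have "(\<Sum>r\<in>X. c' r * of_nat (r j)) = (\<Sum>\<rho>\<in>Ext u. c \<rho> / of_nat (N \<rho>) * of_nat (sc \<rho> j))"
        unfolding X_def using inj by (subst sum.reindex) (auto simp: c'_def X_def intro!: sum.cong)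
      also have "\<dots> = (\<Sum>\<rho>\<in>Ext u. c \<rho> * \<rho> j)"
      proof (intro sum.cong refl)
        fix \<rho> assume \<rho>: "\<rho> \<in> Ext u"
        show "c \<rho> / of_nat (N \<rho>) * of_nat (sc \<rho> j) = c \<rho> * \<rho> j"
          unfolding sc[OF \<rho>] using N[OF \<rho>] by simp
      qed
      also have "\<dots> = of_nat (v j)" using c(2)[of j] by (simp add: Ext_def rat_vec_def)
      finally show ?thesis by simp
    qed
    moreover have "c' r \<ge> 0" for r using c(1) by (simp add: c'_def)
    moreover have "min_dot G r = dot u r" if "r \<in> X" for r
    proof -
      from that obtain \<rho> where \<rho>: "\<rho> \<in> Ext u" "r = sc \<rho>" by (auto simp: X_def)
      have rv: "rat_vec r = (\<lambda>j. of_nat (N \<rho>) * \<rho> j)" using sc[OF \<rho>(1)] \<rho>(2) by (auto simp: rat_vec_def)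
      have "\<rho> \<in> cone" using \<rho>(1) by (simp add: Ext_def extremal_def)
      hence le: "dot (rat_vec u) \<rho> \<le> dot (rat_vec u') \<rho>" if "u' \<in> G" for u'
        using that by (simp add: cone_chamber_iff[OF G(1)])
      show ?thesis
      proof (rule min_dot_eqI[OF G(1) u(1)])
        fix u' assume "u' \<in> G"
        hence "dot (rat_vec u) (rat_vec r) \<le> dot (rat_vec u') (rat_vec r)"
          unfolding rv dot_scale using le by (simp add: mult_left_mono)
        thus "dot u r \<le> dot u' r" by (simp add: dot_rat_vec)
      qed
    qed
    moreover have "X \<subseteq> R" using u(1) by (auto simp: X_def R_def)
    ultimately show "\<exists>u\<in>G. \<exists>X\<subseteq>R. \<exists>c::('n \<Rightarrow> nat) \<Rightarrow> rat. (\<forall>r. c r \<ge> 0) \<and>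
       (\<forall>j. of_nat (v j) = (\<Sum>r\<in>X. c r * of_nat (r j))) \<and> (\<forall>r\<in>X. min_dot G r = dot u r) \<and> min_dot G v = dot u v"
      using u by blast
  qed
qed

section \<open>Rationality and poles of the zeta function\<close>

definition lex_below :: "nat \<Rightarrow> (nat \<Rightarrow> nat) \<Rightarrow> (nat \<Rightarrow> nat) \<Rightarrow> bool" where
  "lex_below N x y \<longleftrightarrow> (\<forall>i<N. y i = x i) \<or> (\<exists>i<N. x i < y i \<and> (\<forall>j<i. x j = y j))"

lemma lex_below_antisym:
  assumes "lex_below N x y" "lex_below N y x"
  shows "\<forall>i<N. x i = y i"
proof (rule ccontr)
  assume *: "\<not> ?thesis"
  with assms obtain i k where "i < N" "x i < y i" "\<forall>j<i. x j = y j" "k < N" "y k < x k" "\<forall>j<k. y j = x j"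
    unfolding lex_below_def by metis
  thus False by (cases i k rule: linorder_cases) force+
qed

lemma lex_minimum:
  fixes f :: "'a \<Rightarrow> nat \<Rightarrow> nat"
  assumes "S \<noteq> {}"
  shows "\<exists>x\<in>S. \<forall>y\<in>S. lex_below N (f x) (f y)"
proof (induction N)
  case 0
  show ?case using assms by (auto simp: lex_below_def)
next
  case (Suc N)
  then obtain x where x: "x \<in> S" "\<And>y. y \<in> S \<Longrightarrow> lex_below N (f x) (f y)" by blast
  define T where "T = {y \<in> S. \<forall>i<N. f y i = f x i}"
  have "x \<in> T" using x(1) by (simp add: T_def)
  then obtain z where z: "z \<in> T" "\<And>y. y \<in> T \<Longrightarrow> f z N \<le> f y N"
    using ex_has_least_nat[of "\<lambda>z. z \<in> T" x "\<lambda>z. f z N"] by blast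
  have "lex_below (Suc N) (f z) (f y)" if y: "y \<in> S" for y
  proof (cases "y \<in> T")
    case True
    have eq: "\<forall>j<N. f z j = f y j" using True z(1) by (simp add: T_def)
    show ?thesis
    proof (cases "f z N = f y N")
      case True
      with eq show ?thesis by (auto simp: lex_below_def less_Suc_eq)
    next
      case False
      with z(2)[OF True] eq show ?thesis unfolding lex_below_def
        by (intro disjI2 exI[of _ N]) simp
    qed
  next
    case False
    with y x(2)[OF y] obtain i where "i < N" "f x i < f y i" "\<forall>j<i. f x j = f y j"
      by (auto simp: lex_below_def T_def)
    with z(1) show ?thesis unfolding lex_below_def T_def
      by (intro disjI2 exI[of _ i]) simp
  qed
  with z(1) show ?case by (auto simp: T_def)
qed

text \<open>Integer parts of the rational coefficients become \<open>k\<close>. The fractional parts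
  lie below 1 and confine \<open>\<pi>\<close> to a fixed box; being nonnegative, they also keep
  \<open>\<pi>\<close> in the chamber of v, so that \<open>min_dot\<close> adds up.\<close>

theorem bounded_representation:
  fixes G :: "('n::finite \<Rightarrow> nat) set"
  assumes G: "finite G" "G \<noteq> {}"
  obtains R B where "finite R" "finite B" "\<And>r. r \<in> R \<Longrightarrow> r \<noteq> (\<lambda>_. 0)"
    "\<And>r. r \<in> R \<Longrightarrow> min_dot G r > 0 \<Longrightarrow> ones_in_span (face_exponents G r)"
    "\<And>v. \<exists>\<pi>\<in>B. \<exists>k. (\<forall>r. r \<notin> R \<longrightarrow> k r = 0) \<and> v = (\<lambda>j. \<pi> j + (\<Sum>r\<in>R. k r * r j)) \<and>
       min_dot G v = min_dot G \<pi> + (\<Sum>r\<in>R. k r * min_dot G r)"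
proof (rule rays_exist[OF G])
  fix R :: "('n \<Rightarrow> nat) set"
  assume R: "finite R" "\<And>r. r \<in> R \<Longrightarrow> r \<noteq> (\<lambda>_. 0)"
    "\<And>r. r \<in> R \<Longrightarrow> min_dot G r > 0 \<Longrightarrow> ones_in_span (face_exponents G r)"
    "\<And>v. \<exists>u\<in>G. \<exists>X\<subseteq>R. \<exists>c::('n \<Rightarrow> nat) \<Rightarrow> rat. (\<forall>r. c r \<ge> 0) \<and>
       (\<forall>j. of_nat (v j) = (\<Sum>r\<in>X. c r * of_nat (r j))) \<and> (\<forall>r\<in>X. min_dot G r = dot u r) \<and> min_dot G v = dot u v"
  define B where "B = PiE UNIV (\<lambda>j. {..\<Sum>r\<in>R. r j})"
  have "finite B" unfolding B_def by (intro finite_PiE) auto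
  moreover have "\<exists>\<pi>\<in>B. \<exists>k. (\<forall>r. r \<notin> R \<longrightarrow> k r = 0) \<and> v = (\<lambda>j. \<pi> j + (\<Sum>r\<in>R. k r * r j)) \<and>
       min_dot G v = min_dot G \<pi> + (\<Sum>r\<in>R. k r * min_dot G r)" for v
  proof -
    obtain u X and c :: "('n \<Rightarrow> nat) \<Rightarrow> rat" where u: "u \<in> G" "min_dot G v = dot u v" and X: "X \<subseteq> R"
      and c: "\<And>r. c r \<ge> 0" "\<And>j. of_nat (v j) = (\<Sum>r\<in>X. c r * of_nat (r j))"
      and phiX: "\<And>r. r \<in> X \<Longrightarrow> min_dot G r = dot u r"
      using R(4)[of v] by blast
    have finX: "finite X" using X R(1) by (rule finite_subset)
    define k where "k r = (if r \<in> X then nat \<lfloor>c r\<rfloor> else 0)" for r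
    have k: "rat_of_nat (k r) = of_int \<lfloor>c r\<rfloor>" if "r \<in> X" for r
      using c(1)[of r] that by (simp add: k_def)
    have sum_k: "(\<Sum>r\<in>R. k r * h r) = (\<Sum>r\<in>X. k r * h r)" for h :: "_ \<Rightarrow> nat"
      using X R(1) by (intro sum.mono_neutral_right) (auto simp: k_def)
    have sum_le: "(\<Sum>r\<in>R. k r * r j) \<le> v j" for j
    proof -
      have "rat_of_nat (\<Sum>r\<in>X. k r * r j) = (\<Sum>r\<in>X. of_int \<lfloor>c r\<rfloor> * of_nat (r j))"
        using k by (simp add: of_nat_sum)
      also have "\<dots> \<le> of_nat (v j)"
        unfolding c(2) by (intro sum_mono mult_right_mono) auto
      finally show ?thesis unfolding sum_k by (simp only: of_nat_le_iff)
    qed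
    define \<pi> where "\<pi> j = v j - (\<Sum>r\<in>R. k r * r j)" for j
    have v: "v = (\<lambda>j. \<pi> j + (\<Sum>r\<in>R. k r * r j))" using sum_le by (simp add: \<pi>_def fun_eq_iff)
    have frac: "rat_of_nat (\<pi> j) = (\<Sum>r\<in>X. frac (c r) * of_nat (r j))" for j
    proof -
      have "rat_of_nat (\<pi> j) = of_nat (v j) - of_nat (\<Sum>r\<in>R. k r * r j)"
        unfolding \<pi>_def using sum_le by (rule of_nat_diff)
      also have "rat_of_nat (\<Sum>r\<in>R. k r * r j) = (\<Sum>r\<in>X. of_int \<lfloor>c r\<rfloor> * of_nat (r j))"
        unfolding sum_k using k by (simp add: of_nat_sum)
      finally show ?thesis unfolding c(2) frac_def by (simp add: left_diff_distrib sum_subtractf)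
    qed
    have "\<pi> j \<le> (\<Sum>r\<in>R. r j)" for j
    proof -
      have "rat_of_nat (\<pi> j) \<le> (\<Sum>r\<in>X. 1 * of_nat (r j))"
        unfolding frac using frac_lt_1 by (intro sum_mono mult_right_mono) (auto intro: less_imp_le)
      also have "\<dots> \<le> (\<Sum>r\<in>R. of_nat (r j))"
        using X R(1) by (simp add: sum_mono2)
      finally show ?thesis by (simp flip: of_nat_sum)
    qed
    hence "\<pi> \<in> B" by (auto simp: B_def)
    moreover have "min_dot G v = min_dot G \<pi> + (\<Sum>r\<in>R. k r * min_dot G r)"
    proof -
      have dot_pi: "rat_of_nat (dot u' \<pi>) = (\<Sum>r\<in>X. frac (c r) * of_nat (dot u' r))" for u'
      proof -
        have "rat_of_nat (dot u' \<pi>) = dot (rat_vec u') (\<lambda>j. \<Sum>r\<in>X. frac (c r) * of_nat (r j))"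
          unfolding dot_rat_vec[symmetric] by (simp only: rat_vec_def[of \<pi>] frac)
        also have "\<dots> = (\<Sum>r\<in>X. frac (c r) * of_nat (dot u' r))"
          unfolding dot_rat_vec[symmetric] unfolding dot_def rat_vec_def sum_distrib_left
          by (subst sum.swap) (simp add: mult.left_commute)
        finally show ?thesis .
      qed
      have "min_dot G \<pi> = dot u \<pi>"
      proof (rule min_dot_eqI[OF G(1) u(1)])
        fix u' assume u': "u' \<in> G"
        have "rat_of_nat (dot u \<pi>) \<le> of_nat (dot u' \<pi>)"
          unfolding dot_pi
        proof (intro sum_mono mult_left_mono)
          fix r assume "r \<in> X"
          thus "rat_of_nat (dot u r) \<le> of_nat (dot u' r)"
            using phiX min_dot_le[OF G(1) u', of r] by simp
        qed simp
        thus "dot u \<pi> \<le> dot u' \<pi>" by simp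
      qed
      moreover have "dot u v = dot u \<pi> + (\<Sum>r\<in>R. k r * dot u r)"
        by (subst v) (simp only: dot_add dot_sum)
      moreover have "(\<Sum>r\<in>R. k r * dot u r) = (\<Sum>r\<in>R. k r * min_dot G r)"
        by (intro sum.cong refl) (simp add: k_def phiX)
      ultimately show ?thesis using u(2) by simp
    qed
    ultimately show ?thesis using v by (intro bexI[of _ \<pi>] exI[of _ k]) (auto simp: k_def X[THEN subsetD])
  qed
  ultimately show ?thesis using that R(1-3) by blast
qed

text \<open>p to the power -(s \<phi>(v) + |v|), written with \<open>exp\<close> so that it is
  visibly entire in s.\<close>

definition zeta_term :: "nat \<Rightarrow> ('n::finite \<Rightarrow> nat) set \<Rightarrow> complex \<Rightarrow> ('n \<Rightarrow> nat) \<Rightarrow> complex" where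
  "zeta_term p G s v = exp (- of_real (ln (real p)) * (s * of_nat (min_dot G v) + of_nat (sum v UNIV)))"

text \<open>Every exponent vector has a lexicographically least representation; those with a given
  bounded part \<open>\<pi>\<close> form a down-closed set, whose generating function is rational.\<close>

theorem zeta_rational:
  fixes G :: "('n::finite \<Rightarrow> nat) set"
  assumes G: "finite G" "G \<noteq> {}" and p: "p > 1"
  obtains R Q where "finite R" "\<And>r. r \<in> R \<Longrightarrow> r \<noteq> (\<lambda>_. 0)"
    "\<And>r. r \<in> R \<Longrightarrow> min_dot G r > 0 \<Longrightarrow> ones_in_span (face_exponents G r)"
    "Q holomorphic_on UNIV"
    "\<And>s. Re s > 0 \<Longrightarrow> (zeta_term p G s has_sum (Q s / (\<Prod>r\<in>R. 1 - zeta_term p G s r))) UNIV"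
proof (rule bounded_representation[OF G])
  fix R B :: "('n \<Rightarrow> nat) set"
  assume R: "finite R" "finite B" "\<And>r. r \<in> R \<Longrightarrow> r \<noteq> (\<lambda>_. 0)"
    "\<And>r. r \<in> R \<Longrightarrow> min_dot G r > 0 \<Longrightarrow> ones_in_span (face_exponents G r)"
    and ex: "\<And>v. \<exists>\<pi>\<in>B. \<exists>k. (\<forall>r. r \<notin> R \<longrightarrow> k r = 0) \<and> v = (\<lambda>j. \<pi> j + (\<Sum>r\<in>R. k r * r j)) \<and>
       min_dot G v = min_dot G \<pi> + (\<Sum>r\<in>R. k r * min_dot G r)"
  define val where "val = (\<lambda>(\<pi>, k) j. \<pi> j + (\<Sum>r\<in>R. k r * r j) :: nat)"
  define lin where "lin = (\<lambda>(\<pi>, k). min_dot G \<pi> + (\<Sum>r\<in>R. k r * min_dot G r))"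
  define Rep where "Rep v = {x. fst x \<in> B \<and> (\<forall>r. r \<notin> R \<longrightarrow> snd x r = 0) \<and> v = val x \<and> min_dot G v = lin x}" for v
  obtain rs where rs: "set rs = R" "distinct rs" using R(1) finite_distinct_list by blast
  obtain \<iota> :: "('n \<Rightarrow> nat) \<Rightarrow> nat" where \<iota>: "inj_on \<iota> B" using R(2) finite_imp_inj_to_nat_seg by blast
  define N where "N = Suc (length rs)"
  define key where "key = (\<lambda>x i. if i = 0 then \<iota> (fst x) else snd x (rs ! (i - 1)) :: nat)"
  have key_inj: "x = y" if "x \<in> Rep v" "y \<in> Rep v" "\<forall>i<N. key x i = key y i" for x y v
  proof -
    have "\<iota> (fst x) = \<iota> (fst y)" using that(3)[rule_format, of 0] by (simp add: key_def N_def)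
    hence "fst x = fst y" using \<iota> that(1,2) by (auto simp: Rep_def inj_on_def)
    moreover have "snd x r = snd y r" for r
    proof (cases "r \<in> R")
      case True
      then obtain i where "i < length rs" "r = rs ! i" using rs(1) by (metis in_set_conv_nth)
      thus ?thesis using that(3)[rule_format, of "Suc i"] by (simp add: key_def N_def)
    qed (use that in \<open>auto simp: Rep_def\<close>)
    ultimately show ?thesis by (auto simp: prod_eq_iff)
  qed
  define canon where "canon x \<longleftrightarrow> x \<in> Rep (val x) \<and> (\<forall>y\<in>Rep (val x). lex_below N (key x) (key y))" for x
  have canon_ex: "\<exists>x. canon x \<and> val x = v" for v
  proof -
    obtain \<pi> k where "\<pi> \<in> B" "\<forall>r. r \<notin> R \<longrightarrow> k r = 0" "v = (\<lambda>j. \<pi> j + (\<Sum>r\<in>R. k r * r j))"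
       "min_dot G v = min_dot G \<pi> + (\<Sum>r\<in>R. k r * min_dot G r)" using ex[of v] by blast
    hence "(\<pi>, k) \<in> Rep v" by (simp add: Rep_def val_def lin_def)
    hence "Rep v \<noteq> {}" by blast
    from lex_minimum[OF this, of N key] obtain x where x: "x \<in> Rep v" "\<forall>y\<in>Rep v. lex_below N (key x) (key y)"
      by blast
    moreover from x have "val x = v" by (simp add: Rep_def)
    ultimately show ?thesis by (intro exI[of _ x]) (simp add: canon_def)
  qed
  have canon_unique: "x = y" if "canon x" "canon y" "val x = val y" for x y
    using that key_inj[of x "val x" y] lex_below_antisym[of N "key x" "key y"] unfolding canon_def by metis
  define D where "D \<pi> = {k. canon (\<pi>, k)}" for \<pi>
  have D_sub: "D \<pi> \<subseteq> {k. \<forall>r. r \<notin> R \<longrightarrow> k r = 0}" for \<pi>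
    by (auto simp: D_def canon_def Rep_def)
  have D_down: "down_closed (D \<pi>)" for \<pi>
    unfolding down_closed_def
  proof (intro ballI allI impI)
    fix k k' assume k: "k \<in> D \<pi>" "k' \<le> k"
    define m where "m r = k r - k' r" for r
    have km: "k r = k' r + m r" for r using k(2) by (simp add: m_def le_fun_def)
    have c: "canon (\<pi>, k)" using k(1) by (simp add: D_def)
    have supp: "k' r = 0" "m r = 0" if "r \<notin> R" for r
      using c that km[of r] by (auto simp: canon_def Rep_def)
    have val_add: "val (\<pi>', \<lambda>r. k1 r + m r) = (\<lambda>j. val (\<pi>', k1) j + (\<Sum>r\<in>R. m r * r j))" for \<pi>' k1
      by (auto simp: val_def distrib_right sum.distrib fun_eq_iff)
    have lin_add: "lin (\<pi>', \<lambda>r. k1 r + m r) = lin (\<pi>', k1) + (\<Sum>r\<in>R. m r * min_dot G r)" for \<pi>' k1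
      by (simp add: lin_def distrib_right sum.distrib)
    have k_eq: "k = (\<lambda>r. k' r + m r)" using km by (simp add: fun_eq_iff)
    have super: "min_dot G v + (\<Sum>r\<in>R. m r * min_dot G r) \<le> min_dot G (\<lambda>j. v j + (\<Sum>r\<in>R. m r * r j))" for v
      using min_dot_superadditive[OF G, of v "\<lambda>j. \<Sum>r\<in>R. m r * r j"] min_dot_superadditive_sum[OF G, of m R] by linarith
    have lin_le: "lin (\<pi>, k') \<le> min_dot G (val (\<pi>, k'))"
      using min_dot_superadditive[OF G, of \<pi> "\<lambda>j. \<Sum>r\<in>R. k' r * r j"] min_dot_superadditive_sum[OF G, of k' R]
      by (simp add: lin_def val_def)
    have phik: "min_dot G (val (\<pi>, k)) = lin (\<pi>, k)" using c by (simp add: canon_def Rep_def)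
    \<comment> \<open>Superadditivity gives \<open>lin\<close> as a lower bound at
      \<open>k'\<close>. Adding \<open>m\<close> and comparing with the equality at \<open>k\<close>
      gives it as an upper bound.\<close>
    have phik': "min_dot G (val (\<pi>, k')) = lin (\<pi>, k')"
      using super[of "val (\<pi>, k')"] lin_le phik unfolding k_eq val_add lin_add by linarith
    have "(\<pi>, k') \<in> Rep (val (\<pi>, k'))"
      using phik' supp c by (auto simp: Rep_def canon_def)
    \<comment> \<open>Adding \<open>m\<close> to a representation competing with \<open>k'\<close>
      gives one competing with \<open>k\<close>. Both keys are translated by the same
      \<open>h\<close>, which does not affect the lexicographic comparison.\<close>
    moreover have "lex_below N (key (\<pi>, k')) (key y)" if y: "y \<in> Rep (val (\<pi>, k'))" for y
    proof -
      define y' where "y' = (fst y, \<lambda>r. snd y r + m r)"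
      have vy: "val y = val (\<pi>, k')" "min_dot G (val (\<pi>, k')) = lin y" using y by (auto simp: Rep_def)
      have "val y' = val (\<pi>, k)" using vy(1) unfolding y'_def val_add k_eq by simp
      moreover have "min_dot G (val (\<pi>, k)) = lin y'"
        using vy(2) phik phik' unfolding y'_def lin_add k_eq by simp
      ultimately have "y' \<in> Rep (val (\<pi>, k))" using y supp by (auto simp: Rep_def y'_def)
      hence le: "lex_below N (key (\<pi>, k)) (key y')" using c by (simp add: canon_def)
      define h where "h i = (if i = 0 then 0 else m (rs ! (i - 1)))" for i
      have "key (\<pi>, k) i = key (\<pi>, k') i + h i" "key y' i = key y i + h i" for i
        by (auto simp: key_def h_def km y'_def)
      with le show ?thesis unfolding lex_below_def by simp
    qed
    ultimately show "k' \<in> D \<pi>" by (simp add: D_def canon_def)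
  qed
  have bij: "bij_betw val (SIGMA \<pi>:B. D \<pi>) UNIV"
    unfolding bij_betw_def
  proof
    show "inj_on val (SIGMA \<pi>:B. D \<pi>)" using canon_unique by (auto simp: inj_on_def D_def)
    have "v \<in> val ` (SIGMA \<pi>:B. D \<pi>)" for v
    proof -
      obtain x where x: "canon x" "val x = v" using canon_ex by blast
      hence "x \<in> (SIGMA \<pi>:B. D \<pi>)" by (cases x) (auto simp: D_def canon_def Rep_def)
      with x(2) show ?thesis by blast
    qed
    thus "val ` (SIGMA \<pi>:B. D \<pi>) = UNIV" by blast
  qed
  have hol: "(\<lambda>s. zeta_term p G s v) holomorphic_on UNIV" for v
    unfolding zeta_term_def by (intro holomorphic_intros)
  have "\<forall>\<pi>. \<exists>P. P holomorphic_on UNIV \<and> (\<forall>s. (\<forall>r\<in>R. norm (zeta_term p G s r) < 1) \<longrightarrow>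
    ((\<lambda>k. \<Prod>r\<in>R. zeta_term p G s r ^ k r) has_sum (P s / (\<Prod>r\<in>R. 1 - zeta_term p G s r))) (D \<pi>))"
    using down_closed_generating_function[OF R(1) D_down D_sub, of "\<lambda>r s. zeta_term p G s r"] hol by blast
  from choice[OF this] obtain P where P: "\<And>\<pi>. P \<pi> holomorphic_on UNIV"
    "\<And>\<pi> s. (\<forall>r\<in>R. norm (zeta_term p G s r) < 1) \<Longrightarrow>
      ((\<lambda>k. \<Prod>r\<in>R. zeta_term p G s r ^ k r) has_sum (P \<pi> s / (\<Prod>r\<in>R. 1 - zeta_term p G s r))) (D \<pi>)"
    by blast
  define Q where "Q s = (\<Sum>\<pi>\<in>B. zeta_term p G s \<pi> * P \<pi> s)" for s
  show ?thesis
  proof (rule that[OF R(1,3,4)])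
    show "Q holomorphic_on UNIV" unfolding Q_def by (intro holomorphic_intros hol P(1))
    fix s :: complex assume s: "Re s > 0"
    let ?den = "\<Prod>r\<in>R. 1 - zeta_term p G s r"
    let ?part = "\<lambda>\<pi>. zeta_term p G s \<pi> * (P \<pi> s / ?den)"
    have "norm (zeta_term p G s r) < 1" if "r \<in> R" for r
    proof -
      have "sum r UNIV > 0" using R(3)[OF that] by (auto simp: fun_eq_iff intro!: sum_pos2[of UNIV])
      hence "Re s * real (min_dot G r) + real (sum r UNIV) > 0"
        using s by (intro add_nonneg_pos) (simp_all del: of_nat_sum)
      moreover have "ln (real p) > 0" using p by simp
      ultimately show ?thesis by (simp add: zeta_term_def mult_pos_pos)
    qed
    hence norm: "\<forall>r\<in>R. norm (zeta_term p G s r) < 1" by blast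
    have term_eq: "zeta_term p G s (val (\<pi>, k)) = zeta_term p G s \<pi> * (\<Prod>r\<in>R. zeta_term p G s r ^ k r)"
      if "k \<in> D \<pi>" for \<pi> k
    proof -
      have "min_dot G (val (\<pi>, k)) = min_dot G \<pi> + (\<Sum>r\<in>R. k r * min_dot G r)"
        using that by (simp add: D_def canon_def Rep_def lin_def)
      moreover have "sum (val (\<pi>, k)) UNIV = sum \<pi> UNIV + (\<Sum>r\<in>R. k r * sum r UNIV)"
        unfolding val_def prod.case sum.distrib sum_distrib_left by (subst sum.swap) simp
      moreover have linear: "(\<Sum>r\<in>R. of_nat (k r) * (- of_real (ln (real p)) * (s * of_nat (a r) + of_nat (b r)))) =
          - of_real (ln (real p)) * (s * of_nat (\<Sum>r\<in>R. k r * a r) + of_nat (\<Sum>r\<in>R. k r * b r))" for a b :: "_ \<Rightarrow> nat"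
        by (induction R rule: infinite_finite_induct) (simp_all add: algebra_simps)
      have "- of_real (ln (real p)) * (s * of_nat (x + x') + of_nat (y + y')) =
          - of_real (ln (real p)) * (s * of_nat x + of_nat y) + - of_real (ln (real p)) * (s * of_nat x' + of_nat y')"
        for x x' y y' by (simp add: algebra_simps)
      ultimately show ?thesis
        unfolding zeta_term_def exp_of_nat_mult[symmetric] exp_sum[OF R(1), symmetric] exp_add[symmetric] linear
        by (simp only:)
    qed
    have "((\<lambda>k. zeta_term p G s (val (\<pi>, k))) has_sum ?part \<pi>) (D \<pi>)" for \<pi>
      using has_sum_cmult_right[OF P(2)[OF norm], of "zeta_term p G s \<pi>"]
      by (subst has_sum_cong[OF term_eq]) auto
    hence "((\<lambda>x. zeta_term p G s (val x)) has_sum sum ?part B) (SIGMA \<pi>:B. D \<pi>)"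
    proof -
      assume *: "\<And>\<pi>. ((\<lambda>k. zeta_term p G s (val (\<pi>, k))) has_sum ?part \<pi>) (D \<pi>)"
      have "((\<lambda>x. zeta_term p G s (val x)) has_sum sum ?part X) (SIGMA \<pi>:X. D \<pi>)"
        if "finite X" for X
        using that
      proof (induction X)
        case (insert \<pi> X)
        have "((\<lambda>x. zeta_term p G s (val x)) has_sum ?part \<pi>) (Pair \<pi> ` D \<pi>)"
          using *[of \<pi>] by (subst has_sum_reindex) (auto simp: inj_on_def o_def)
        from has_sum_Un_disjoint[OF this insert.IH] insert.hyps
        have "((\<lambda>x. zeta_term p G s (val x)) has_sum sum ?part (insert \<pi> X))
           (Pair \<pi> ` D \<pi> \<union> (SIGMA \<pi>:X. D \<pi>))" by auto
        moreover have "Pair \<pi> ` D \<pi> \<union> (SIGMA \<pi>:X. D \<pi>) = (SIGMA \<pi>:insert \<pi> X. D \<pi>)" by auto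
        ultimately show ?case by simp
      qed simp
      thus ?thesis using R(2) by blast
    qed
    hence "(zeta_term p G s has_sum sum ?part B) UNIV"
      using has_sum_reindex_bij_betw[OF bij, of "zeta_term p G s"] by blast
    thus "(zeta_term p G s has_sum (Q s / ?den)) UNIV"
      by (simp add: Q_def sum_divide_distrib)
  qed
qed

text \<open>By the identity theorem for meromorphic functions, Z den = Q holds away from a sparse
  set. If \<open>den s0\<close> were nonzero, Z would therefore have a finite limit at
  \<open>s0\<close>.\<close>

lemma pole_imp_denominator_zero:
  assumes "Z meromorphic_on UNIV" "Q holomorphic_on UNIV" "den holomorphic_on UNIV"
    and eq: "\<And>s. Re s > 0 \<Longrightarrow> Z s * den s = Q s" and pole: "is_pole Z s0"
  shows "den s0 = 0"
proof (rule ccontr)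
  assume nz: "den s0 \<noteq> 0"
  have analytic: "Q analytic_on UNIV" "den analytic_on UNIV"
    using assms(2,3) by (simp_all add: analytic_on_open)
  define F where "F s = Z s * den s - Q s" for s
  have "F meromorphic_on UNIV"
    unfolding F_def
    by (intro meromorphic_on_diff meromorphic_on_mult assms(1) analytic_on_imp_meromorphic_on analytic)
  hence "eventually (\<lambda>s. F s = 0) (cosparse UNIV) \<or> eventually (\<lambda>s. F s \<noteq> 0) (cosparse UNIV)"
    by (rule meromorphic_imp_constant_or_avoid) auto
  moreover have "\<not> eventually (\<lambda>s. F s \<noteq> 0) (cosparse UNIV)"
  proof
    assume "eventually (\<lambda>s. F s \<noteq> 0) (cosparse UNIV)"
    hence "eventually (\<lambda>s. F s \<noteq> 0) (at 1)" by (simp add: eventually_cosparse_open_eq)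
    moreover have "eventually (\<lambda>s. s \<in> {s. Re s > 0}) (at 1)"
      by (rule eventually_at_in_open') (auto simp: open_halfspace_Re_gt)
    ultimately have "eventually (\<lambda>s::complex. False) (at 1)"
      by eventually_elim (simp add: F_def eq)
    thus False by simp
  qed
  ultimately have "eventually (\<lambda>s. F s = 0) (cosparse UNIV)" by blast
  hence F0: "eventually (\<lambda>s. F s = 0) (at s0)" by (simp add: eventually_cosparse_open_eq)
  have cont: "isCont den s0" "isCont Q s0"
    using holomorphic_on_imp_continuous_on[OF assms(3)] holomorphic_on_imp_continuous_on[OF assms(2)]
    by (simp_all add: continuous_on_eq_continuous_at)
  have "eventually (\<lambda>s. den s \<noteq> 0) (at s0)"
    using tendsto_imp_eventually_ne[OF isContD[OF cont(1)] nz] .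
  with F0 have "eventually (\<lambda>s. Q s / den s = Z s) (at s0)"
    by eventually_elim (simp add: F_def field_simps)
  moreover have "((\<lambda>s. Q s / den s) \<longlongrightarrow> Q s0 / den s0) (at s0)"
    by (intro tendsto_divide isContD cont nz)
  ultimately have "(Z \<longlongrightarrow> Q s0 / den s0) (at s0)"
    by (rule Lim_transform_eventually[rotated])
  with pole show False
    unfolding is_pole_def using not_tendsto_and_filterlim_at_infinity[of "at s0"] by auto
qed

text \<open>A zero of the denominator makes some \<open>zeta_term\<close> equal to 1. Its modulus
  gives an equation for the real part alone, and |r| > 0 excludes
  \<open>min_dot G r = 0\<close>.\<close>

theorem zeta_pole_ray:
  fixes G :: "('n::finite \<Rightarrow> nat) set"
  assumes G: "finite G" "G \<noteq> {}" and p: "p > 1"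
    and Z: "Z meromorphic_on UNIV" "\<And>s S. Re s > 0 \<Longrightarrow> (zeta_term p G s has_sum S) UNIV \<Longrightarrow> Z s = C * S"
    and pole: "is_pole Z s0"
  obtains r where "min_dot G r > 0" "ones_in_span (face_exponents G r)"
    "Re s0 = - real (sum r UNIV) / real (min_dot G r)"
proof (rule zeta_rational[OF G p])
  fix R :: "('n \<Rightarrow> nat) set" and Q
  assume R: "finite R" "\<And>r. r \<in> R \<Longrightarrow> r \<noteq> (\<lambda>_. 0)"
    "\<And>r. r \<in> R \<Longrightarrow> min_dot G r > 0 \<Longrightarrow> ones_in_span (face_exponents G r)"
    and Q: "Q holomorphic_on UNIV"
    "\<And>s. Re s > 0 \<Longrightarrow> (zeta_term p G s has_sum (Q s / (\<Prod>r\<in>R. 1 - zeta_term p G s r))) UNIV"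
  have exponent: "min_dot G r > 0 \<and> Re s = - real (sum r UNIV) / real (min_dot G r)"
    if "r \<in> R" "zeta_term p G s r = 1" for r s
  proof -
    have pos: "sum r UNIV > 0" using R(2)[OF that(1)] by (auto simp: fun_eq_iff intro!: sum_pos2[of UNIV])
    have "norm (zeta_term p G s r) = exp (- ln (real p) * (Re s * real (min_dot G r) + real (sum r UNIV)))"
      by (simp add: zeta_term_def)
    hence "- ln (real p) * (Re s * real (min_dot G r) + real (sum r UNIV)) = 0" using that(2) by simp
    moreover have "ln (real p) > 0" using p by simp
    ultimately have eq: "Re s * real (min_dot G r) + real (sum r UNIV) = 0" by simp
    hence "min_dot G r \<noteq> 0" using pos by (intro notI) (simp del: of_nat_sum)
    with eq show ?thesis by (simp add: field_simps del: of_nat_sum)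
  qed
  have "(\<Prod>r\<in>R. 1 - zeta_term p G s0 r) = 0"
  proof (rule pole_imp_denominator_zero[OF Z(1) _ _ _ pole])
    show "(\<lambda>s. C * Q s) holomorphic_on UNIV" by (intro holomorphic_intros Q(1))
    show "(\<lambda>s. \<Prod>r\<in>R. 1 - zeta_term p G s r) holomorphic_on UNIV"
      unfolding zeta_term_def by (intro holomorphic_intros)
    fix s assume s: "Re s > 0"
    have "zeta_term p G s r \<noteq> 1" if "r \<in> R" for r
    proof
      assume "zeta_term p G s r = 1"
      from exponent[OF that this] s have "0 < - real (sum r UNIV) / real (min_dot G r)" by simp
      moreover have "- real (sum r UNIV) / real (min_dot G r) \<le> 0" by (simp add: divide_nonpos_nonneg del: of_nat_sum)
      ultimately show False by linarith
    qed
    hence "(\<Prod>r\<in>R. 1 - zeta_term p G s r) \<noteq> 0" using R(1) by simp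
    thus "Z s * (\<Prod>r\<in>R. 1 - zeta_term p G s r) = C * Q s"
      using Z(2)[OF s Q(2)[OF s]] by simp
  qed
  then obtain r where "r \<in> R" "zeta_term p G s0 r = 1" using R(1) by auto
  thus thesis using exponent R(3) that by blast
qed

section \<open>The integral over the p-adic integers\<close>

lemma mpoly_eval_single: "mpoly_eval (single m c) x = c * (\<Prod>i\<in>UNIV. x i ^ lookup m i)"
  by (simp add: mpoly_eval_def)

lemma mpoly_eval_mod:
  fixes f :: "('n::finite, int) mpoly"
  assumes "\<And>i. x i mod q = y i mod q"
  shows "mpoly_eval f x mod q = mpoly_eval f y mod q"
proof -
  have "(\<Prod>i\<in>UNIV. x i ^ lookup m i) mod q = (\<Prod>i\<in>UNIV. y i ^ lookup m i) mod q" for m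
  proof -
    have "x i ^ k mod q = y i ^ k mod q" for i k using assms by (metis power_mod)
    thus ?thesis
      by (subst (1 2) mod_prod_eq[symmetric]) simp
  qed
  hence "lookup f m * (\<Prod>i\<in>UNIV. x i ^ lookup m i) mod q =
      lookup f m * (\<Prod>i\<in>UNIV. y i ^ lookup m i) mod q" for m
    by (metis mod_mult_right_eq)
  thus ?thesis
    unfolding mpoly_eval_def by (subst (1 2) mod_sum_eq[symmetric]) simp
qed

lemma padic_eval_mod:
  assumes "y \<in> padic_space p" "k \<le> l"
  shows "padic_eval p f y l mod int p ^ k = padic_eval p f y k"
proof -
  have "padic_eval p f y l mod int p ^ k = mpoly_eval f (\<lambda>i. y i l) mod int p ^ k"
    using assms(2) by (simp add: padic_eval_def mod_mod_cancel le_imp_power_dvd)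
  also have "\<dots> = mpoly_eval f (\<lambda>i. y i k) mod int p ^ k"
    using assms padic_int_mod[of _ p k l] padic_int_mod[of _ p k k]
    by (intro mpoly_eval_mod) (simp add: padic_space_def)
  finally show ?thesis by (simp add: padic_eval_def)
qed

lemma padic_eval_box:
  assumes "z \<in> padic_box p y (\<lambda>_. k)"
  shows "padic_eval p f z k = padic_eval p f y k"
  using assms by (simp add: padic_eval_def padic_box_def)

text \<open>Residues are compatible, so the precisions at which they vanish form an initial segment,
  and its supremum decides membership.\<close>

lemma padic_ord_ge_iff:
  assumes "y \<in> padic_space p"
  shows "enat k \<le> padic_ord (padic_eval p f y) \<longleftrightarrow> padic_eval p f y k = 0"
proof
  assume "padic_eval p f y k = 0"
  thus "enat k \<le> padic_ord (padic_eval p f y)"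
    unfolding padic_ord_def by (intro Sup_upper) blast
next
  assume le: "enat k \<le> padic_ord (padic_eval p f y)"
  show "padic_eval p f y k = 0"
  proof (rule ccontr)
    assume nz: "padic_eval p f y k \<noteq> 0"
    have "k > 0" using nz by (cases k) (auto simp: padic_eval_def)
    have "padic_ord (padic_eval p f y) \<le> enat (k - 1)"
      unfolding padic_ord_def
    proof (rule Sup_least)
      fix x assume "x \<in> {enat l |l. padic_eval p f y l = 0}"
      then obtain l where l: "x = enat l" "padic_eval p f y l = 0" by blast
      have "l < k"
      proof (rule ccontr)
        assume "\<not> l < k"
        hence "padic_eval p f y k = 0" using padic_eval_mod[OF assms, of k l f] l(2) by simp
        with nz show False by simp
      qed
      thus "x \<le> enat (k - 1)" using l(1) by simp
    qed
    with le have "enat k \<le> enat (k - 1)" by (rule order_trans)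
    with \<open>k > 0\<close> show False by simp
  qed
qed

lemma padic_ord_ideal_ge_iff:
  assumes "y \<in> padic_space p"
  shows "enat k \<le> padic_ord_ideal p I y \<longleftrightarrow> (\<forall>f\<in>I. padic_eval p f y k = 0)"
  by (simp add: padic_ord_ideal_def le_INF_iff padic_ord_ge_iff[OF assms])

lemma padic_int_0: "a \<in> padic_int p \<Longrightarrow> a 0 = 0"
proof -
  assume "a \<in> padic_int p"
  hence "0 \<le> a 0 \<and> a 0 < int p ^ 0" unfolding padic_int_def by blast
  thus ?thesis by simp
qed

locale padic_haar_measure =
  fixes p :: nat and \<mu> :: "('n::finite \<Rightarrow> nat \<Rightarrow> int) measure"
  assumes prime: "prime p" and haar: "is_padic_haar p \<mu>"
begin

lemma p_gt_1: "p > 1"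
  using prime by (rule prime_gt_1_nat)

lemma space_mu: "space \<mu> = padic_space p"
  using haar by (simp add: is_padic_haar_def)

lemma box_in_sets: "y \<in> padic_space p \<Longrightarrow> padic_box p y m \<in> sets \<mu>"
  using haar unfolding is_padic_haar_def padic_boxes_def by (auto intro: sigma_sets.Basic)

lemma zero_in_space: "(\<lambda>(_ :: 'n) _. 0) \<in> padic_space p"
  using p_gt_1 by (simp add: padic_space_def padic_int_def)

lemma translate_box:
  assumes a: "a \<in> padic_space p"
  shows "padic_translate p a ` padic_box p (\<lambda>_ _. 0) m = padic_box p a m"
proof (intro equalityI subsetI)
  fix z assume "z \<in> padic_translate p a ` padic_box p (\<lambda>_ _. 0) m"
  then obtain y where y: "y \<in> padic_space p" "\<And>i. y i (m i) = 0" "z = padic_translate p a y"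
    by (auto simp: padic_box_def)
  have "a i (m i) mod int p ^ m i = a i (m i)" for i
    using a padic_int_mod[of "a i" p "m i" "m i"] by (simp add: padic_space_def)
  with y a p_gt_1 show "z \<in> padic_box p a m"
    by (simp add: padic_box_def padic_translate_in) (simp add: padic_translate_def padic_add_def)
next
  fix z assume z: "z \<in> padic_box p a m"
  define n where "n i = padic_neg p (a i)" for i
  have n: "n \<in> padic_space p" using a p_gt_1 by (simp add: n_def padic_space_def padic_neg_in)
  have zs: "z \<in> padic_space p" using z by (simp add: padic_box_def)
  have "padic_translate p n z \<in> padic_box p (\<lambda>_ _. 0) m"
    using z padic_translate_in[OF _ n zs] p_gt_1
    by (simp add: padic_box_def) (simp add: padic_translate_def padic_add_def n_def padic_neg_def mod_simps)
  moreover have "z = padic_translate p a (padic_translate p n z)"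
    using zs padic_add_neg(2) by (simp add: padic_translate_def n_def padic_space_def fun_eq_iff)
  ultimately show "z \<in> padic_translate p a ` padic_box p (\<lambda>_ _. 0) m" by blast
qed

lemma emeasure_box:
  assumes "a \<in> padic_space p"
  shows "emeasure \<mu> (padic_box p a m) = ennreal ((1 / real p) ^ (\<Sum>i\<in>UNIV. m i))"
proof -
  have "emeasure \<mu> (padic_translate p a ` padic_box p (\<lambda>_ _. 0) m) = emeasure \<mu> (padic_box p (\<lambda>_ _. 0) m)"
    using haar assms box_in_sets[OF zero_in_space] unfolding is_padic_haar_def by blast
  also have "\<dots> = ennreal ((1 / real p) ^ (\<Sum>i\<in>UNIV. m i))"
    using haar unfolding is_padic_haar_def by blast
  finally show ?thesis using translate_box[OF assms] by simp
qed

lemma box_zero: "padic_box p y (\<lambda>_. 0) = padic_space p" if "y \<in> padic_space p" for y :: "'n \<Rightarrow> nat \<Rightarrow> int"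
proof -
  have z0: "z i 0 = 0" if "z \<in> padic_space p" for z and i :: 'n
    using that padic_int_0[of "z i" p] by (simp add: padic_space_def)
  show ?thesis
  proof (intro equalityI subsetI)
    fix z :: "'n \<Rightarrow> nat \<Rightarrow> int" assume "z \<in> padic_space p"
    thus "z \<in> padic_box p y (\<lambda>_. 0)" using z0[OF that] z0[of z] by (simp add: padic_box_def)
  qed (auto simp: padic_box_def)
qed

lemma prob_space_mu: "prob_space \<mu>"
proof
  show "emeasure \<mu> (space \<mu>) = 1"
    using emeasure_box[OF zero_in_space, of "\<lambda>_. 0"] box_zero[OF zero_in_space] by (simp add: space_mu)
qed

section \<open>Shells of points with prescribed coordinate orders\<close>

definition shell :: "('n \<Rightarrow> nat) \<Rightarrow> ('n \<Rightarrow> nat \<Rightarrow> int) set" where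
  "shell v = {y \<in> padic_space p. \<forall>i. y i (v i) = 0 \<and> y i (Suc (v i)) \<noteq> 0}"

text \<open>The point with coordinates d_i p^(v_i); for nonzero digits d the boxes about these
  points partition the shell.\<close>

definition shell_center :: "('n \<Rightarrow> nat) \<Rightarrow> ('n \<Rightarrow> int) \<Rightarrow> 'n \<Rightarrow> nat \<Rightarrow> int" where
  "shell_center v d = (\<lambda>i k. (d i * int p ^ v i) mod int p ^ k)"

abbreviation shell_box :: "('n \<Rightarrow> nat) \<Rightarrow> ('n \<Rightarrow> int) \<Rightarrow> ('n \<Rightarrow> nat \<Rightarrow> int) set" where
  "shell_box v d \<equiv> padic_box p (shell_center v d) (\<lambda>i. Suc (v i))"

lemma shell_center_in: "shell_center v d \<in> padic_space p"
  using p_gt_1 by (simp add: shell_center_def padic_space_def padic_int_modI)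

lemma shell_center_val:
  assumes "d i \<in> {1..<int p}"
  shows "shell_center v d i (Suc (v i)) = d i * int p ^ v i"
proof -
  have "d i * int p ^ v i < int p * int p ^ v i" using assms p_gt_1 by (intro mult_strict_right_mono) auto
  moreover have "0 \<le> d i * int p ^ v i" using assms by simp
  ultimately show ?thesis by (simp add: shell_center_def)
qed

lemma shell_eq:
  "shell v = (\<Union>d\<in>PiE UNIV (\<lambda>_. {1..<int p}). shell_box v d)"
proof (intro equalityI subsetI)
  fix y assume y: "y \<in> shell v"
  define d where "d i = y i (Suc (v i)) div int p ^ v i" for i
  have d: "d i \<in> {1..<int p} \<and> y i (Suc (v i)) = d i * int p ^ v i" for i
  proof -
    have yi: "y i \<in> padic_int p" using y by (simp add: shell_def padic_space_def)
    have "y i (Suc (v i)) mod int p ^ v i = 0"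
      using padic_int_mod[OF yi, of "v i" "Suc (v i)"] y by (simp add: shell_def)
    hence eq: "y i (Suc (v i)) = d i * int p ^ v i" by (simp add: d_def dvd_eq_mod_eq_0)
    have "d i \<in> {0..<int p}" using padic_digit_bounds[OF _ yi, of "v i"] p_gt_1 by (simp add: d_def padic_digit_def)
    moreover have "d i \<noteq> 0" using y eq by (auto simp: shell_def)
    ultimately show ?thesis using eq by simp
  qed
  hence "y \<in> shell_box v d"
    using y shell_center_val[of d _ v] by (simp add: padic_box_def shell_def)
  moreover have "d \<in> PiE UNIV (\<lambda>_. {1..<int p})" using d by auto
  ultimately show "y \<in> (\<Union>d\<in>PiE UNIV (\<lambda>_. {1..<int p}). shell_box v d)"
    by blast
next
  fix y assume "y \<in> (\<Union>d\<in>PiE UNIV (\<lambda>_. {1..<int p}). shell_box v d)"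
  then obtain d where d': "d \<in> PiE UNIV (\<lambda>_. {1..<int p})" "y \<in> shell_box v d"
    by blast
  have d: "\<And>i. d i \<in> {1..<int p}" "y \<in> shell_box v d"
    using d' by (auto simp: PiE_iff)
  have ys: "y \<in> padic_space p" using d(2) by (simp add: padic_box_def)
  have eq: "y i (Suc (v i)) = d i * int p ^ v i" for i
    using d shell_center_val[of d i v] by (simp add: padic_box_def)
  have "y i (v i) = 0" for i
    using padic_int_mod[of "y i" p "v i" "Suc (v i)"] ys eq[of i] by (simp add: padic_space_def)
  moreover have "y i (Suc (v i)) \<noteq> 0" for i using eq[of i] d(1)[of i] p_gt_1 by simp
  ultimately show "y \<in> shell v" using ys by (simp add: shell_def)
qed

lemma shell_in_sets: "shell v \<in> sets \<mu>"
  unfolding shell_eq by (intro sets.finite_UN finite_PiE box_in_sets shell_center_in) auto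

text \<open>There are (p - 1)^n boxes, each of measure p^-(|v| + n).\<close>

lemma measure_shell: "measure \<mu> (shell v) = ((real p - 1) / real p) ^ CARD('n) * (1 / real p) ^ sum v UNIV"
proof -
  interpret prob_space \<mu> by (rule prob_space_mu)
  have disj: "disjoint_family_on (\<lambda>d. shell_box v d) (PiE UNIV (\<lambda>_. {1..<int p}))"
    unfolding disjoint_family_on_def
  proof (intro ballI impI)
    fix d d' :: "'n \<Rightarrow> int" assume d: "d \<in> PiE UNIV (\<lambda>_. {1..<int p})" "d' \<in> PiE UNIV (\<lambda>_. {1..<int p})" "d \<noteq> d'"
    from d(3) obtain i where i: "d i \<noteq> d' i" by (auto simp: fun_eq_iff)
    have "shell_center v d i (Suc (v i)) \<noteq> shell_center v d' i (Suc (v i))"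
      using d i p_gt_1 shell_center_val[of d i v] shell_center_val[of d' i v] by (auto simp: PiE_iff)
    thus "shell_box v d \<inter> shell_box v d' = {}"
      by (auto simp: padic_box_def)
  qed
  have box: "measure \<mu> (shell_box v d) = (1 / real p) ^ (\<Sum>i\<in>UNIV. Suc (v i))" for d
    unfolding measure_def emeasure_box[OF shell_center_in] by (simp add: enn2real_ennreal)
  have "measure \<mu> (shell v) = (\<Sum>d\<in>PiE UNIV (\<lambda>_. {1..<int p}). measure \<mu> (shell_box v d))"
    unfolding shell_eq using disj
    by (intro finite_measure_finite_Union) (auto intro!: finite_PiE box_in_sets shell_center_in)
  also have "\<dots> = real (card (PiE (UNIV :: 'n set) (\<lambda>_. {1..<int p}))) * (1 / real p) ^ (\<Sum>i\<in>(UNIV :: 'n set). Suc (v i))"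
    unfolding box by simp
  also have "real (card (PiE (UNIV :: 'n set) (\<lambda>_. {1..<int p}))) = (real p - 1) ^ CARD('n)"
    using p_gt_1 by (simp add: card_PiE of_nat_diff)
  also have "(\<Sum>i\<in>(UNIV :: 'n set). Suc (v i)) = sum v UNIV + CARD('n)"
    by (simp add: sum_Suc)
  finally show ?thesis by (simp add: power_add power_divide)
qed

lemma shell_disjoint:
  assumes "y \<in> shell v" "y \<in> shell w"
  shows "v = w"
proof (rule ext, rule ccontr)
  fix i assume ne: "v i \<noteq> w i"
  have yi: "y i \<in> padic_int p" using assms by (simp add: shell_def padic_space_def)
  from ne consider "Suc (v i) \<le> w i" | "Suc (w i) \<le> v i" by linarith
  thus False
  proof cases
    case 1
    thus ?thesis using padic_int_mod[OF yi 1] assms by (simp add: shell_def)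
  next
    case 2
    thus ?thesis using padic_int_mod[OF yi 2] assms by (simp add: shell_def)
  qed
qed

lemma nonzero_in_shell:
  assumes "y \<in> padic_space p" "\<And>i. \<exists>k. y i k \<noteq> 0"
  obtains v where "y \<in> shell v"
proof -
  have "\<exists>v. y i v = 0 \<and> y i (Suc v) \<noteq> 0" for i
  proof (rule ccontr)
    assume *: "\<nexists>v. y i v = 0 \<and> y i (Suc v) \<noteq> 0"
    have "y i k = 0" for k
    proof (induction k)
      case 0
      show ?case using assms(1) padic_int_0[of _ p] by (simp add: padic_space_def)
    next
      case (Suc k)
      with * show ?case by blast
    qed
    with assms(2) show False by blast
  qed
  then obtain v where "\<And>i. y i (v i) = 0 \<and> y i (Suc (v i)) \<noteq> 0" by metis
  with assms(1) that show ?thesis by (auto simp: shell_def)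
qed

lemma coordinate_zero_null: "{y \<in> padic_space p. \<forall>k. y i k = 0} \<in> null_sets \<mu>"
proof -
  interpret prob_space \<mu> by (rule prob_space_mu)
  let ?b = "\<lambda>k. padic_box p (\<lambda>_ _. 0) (\<lambda>j. if j = i then k else 0)"
  have "z j 0 = 0" if "z \<in> padic_space p" for z j
    using that padic_int_0[of _ p] by (simp add: padic_space_def)
  hence eq: "{y \<in> padic_space p. \<forall>k. y i k = 0} = (\<Inter>k. ?b k)"
    by (auto simp: padic_box_def)
  have sets: "{y \<in> padic_space p. \<forall>k. y i k = 0} \<in> sets \<mu>"
    unfolding eq by (intro sets.countable_INT) (auto intro: box_in_sets zero_in_space)
  have "emeasure \<mu> {y \<in> padic_space p. \<forall>k. y i k = 0} \<le> ennreal ((1 / real p) ^ k)" for k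
  proof -
    have "emeasure \<mu> {y \<in> padic_space p. \<forall>k. y i k = 0} \<le> emeasure \<mu> (?b k)"
      unfolding eq by (intro emeasure_mono box_in_sets zero_in_space) auto
    also have "\<dots> = ennreal ((1 / real p) ^ k)"
      unfolding emeasure_box[OF zero_in_space] by simp
    finally show ?thesis .
  qed
  moreover have "(\<lambda>k. ennreal ((1 / real p) ^ k)) \<longlonglongrightarrow> ennreal 0"
    using p_gt_1 by (intro tendsto_ennrealI LIMSEQ_power_zero) simp
  ultimately have "emeasure \<mu> {y \<in> padic_space p. \<forall>k. y i k = 0} \<le> ennreal 0"
    by (intro LIMSEQ_le_const) auto
  with sets show ?thesis by (simp add: null_sets_def)
qed

lemma AE_shell: "AE y in \<mu>. \<exists>v. y \<in> shell v"
proof -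
  have "AE y in \<mu>. \<forall>i. y \<notin> {y \<in> padic_space p. \<forall>k. y i k = 0}"
    unfolding AE_all_countable using AE_not_in[OF coordinate_zero_null] by blast
  moreover have "AE y in \<mu>. y \<in> padic_space p" using AE_space[of \<mu>] by (simp add: space_mu)
  ultimately show ?thesis
  proof eventually_elim
    case (elim y)
    hence "\<exists>k. y i k \<noteq> 0" for i by blast
    thus ?case using nonzero_in_shell[OF elim(2)] by blast
  qed
qed

lemma countable_boxes: "countable (padic_boxes p :: ('n \<Rightarrow> nat \<Rightarrow> int) set set)"
proof (rule countable_subset)
  show "padic_boxes p \<subseteq> range (\<lambda>(a, m). {z \<in> padic_space p. \<forall>i. z i (m i) = a i} :: ('n \<Rightarrow> nat \<Rightarrow> int) set)"
    by (force simp: padic_boxes_def padic_box_def image_iff)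
qed simp

text \<open>Whether the order is at least k depends only on residues modulo p^k, so this set is a
  union of boxes, and there are only countably many boxes.\<close>

lemma measurable_ord_ideal: "padic_ord_ideal p I \<in> measurable \<mu> (count_space UNIV)"
proof -
  define S where "S k = {y \<in> padic_space p. enat k \<le> padic_ord_ideal p I y}" for k
  have S: "S k \<in> sets \<mu>" for k
  proof -
    have "S k = \<Union>{b \<in> padic_boxes p. b \<subseteq> S k}"
    proof (intro equalityI subsetI)
      fix y assume y: "y \<in> S k"
      hence ys: "y \<in> padic_space p" by (simp add: S_def)
      have "padic_box p y (\<lambda>_. k) \<subseteq> S k"
      proof
        fix z assume z: "z \<in> padic_box p y (\<lambda>_. k)"
        hence "z \<in> padic_space p" by (simp add: padic_box_def)
        with y z ys show "z \<in> S k" by (simp add: S_def padic_ord_ideal_ge_iff padic_eval_box[OF z])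
      qed
      moreover have "y \<in> padic_box p y (\<lambda>_. k)" using ys by (simp add: padic_box_def)
      moreover have "padic_box p y (\<lambda>_. k) \<in> padic_boxes p" using ys by (auto simp: padic_boxes_def)
      ultimately show "y \<in> \<Union>{b \<in> padic_boxes p. b \<subseteq> S k}" by blast
    qed auto
    moreover have "\<Union>{b \<in> padic_boxes p. b \<subseteq> S k} \<in> sets \<mu>"
      by (intro sets.countable_Union countable_subset[OF _ countable_boxes])
         (auto simp: padic_boxes_def box_in_sets)
    ultimately show ?thesis by simp
  qed
  show ?thesis
  proof (subst measurable_count_space_eq_countable)
    have "padic_ord_ideal p I -` {x} \<inter> space \<mu> \<in> sets \<mu>" for x
    proof (cases x)
      case (enat k)
      have "padic_ord_ideal p I -` {x} \<inter> space \<mu> = S k - S (Suc k)"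
      proof -
        have "padic_ord_ideal p I y = enat k \<longleftrightarrow> enat k \<le> padic_ord_ideal p I y \<and> \<not> enat (Suc k) \<le> padic_ord_ideal p I y" for y
          by (cases "padic_ord_ideal p I y") auto
        thus ?thesis unfolding enat S_def space_mu by auto
      qed
      thus ?thesis using S by simp
    next
      case infinity
      have "padic_ord_ideal p I y = \<infinity> \<longleftrightarrow> (\<forall>k. enat k \<le> padic_ord_ideal p I y)" for y
        by (cases "padic_ord_ideal p I y") (auto, meson Suc_n_not_le_n)
      hence "padic_ord_ideal p I -` {x} \<inter> space \<mu> = (\<Inter>k. S k)"
        unfolding infinity S_def space_mu by auto
      thus ?thesis using S by auto
    qed
    thus "padic_ord_ideal p I \<in> space \<mu> \<rightarrow> UNIV \<and> (\<forall>a\<in>UNIV. padic_ord_ideal p I -` {a} \<inter> space \<mu> \<in> sets \<mu>)"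
      by simp
  qed simp
qed

theorem integral_shells:
  fixes F :: "enat \<Rightarrow> complex" and h :: "('n \<Rightarrow> nat) \<Rightarrow> nat"
  assumes ord: "\<And>v y. y \<in> shell v \<Longrightarrow> padic_ord_ideal p I y = enat (h v)"
    and S: "((\<lambda>v. of_real (measure \<mu> (shell v)) * F (enat (h v))) has_sum S) UNIV"
  shows "(LINT y|\<mu>. F (padic_ord_ideal p I y)) = S"
proof -
  interpret prob_space \<mu> by (rule prob_space_mu)
  \<comment> \<open>The integral is transported to the countable set of shell indices, where it
    becomes a sum; \<open>None\<close> collects the null set of points with a zero
    coordinate.\<close>
  define V where "V y = (if \<exists>v. y \<in> shell v then Some (THE v. y \<in> shell v) else None)" for y
  have V: "V y = Some v \<longleftrightarrow> y \<in> shell v" for y v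
  proof (cases "\<exists>v. y \<in> shell v")
    case True
    then obtain w where w: "y \<in> shell w" by blast
    have "(THE v. y \<in> shell v) = w"
      by (rule the_equality[of "\<lambda>v. y \<in> shell v", OF w]) (rule shell_disjoint[OF _ w])
    moreover have "y \<in> shell v \<longleftrightarrow> w = v" using w shell_disjoint by blast
    ultimately show ?thesis using True by (simp add: V_def)
  qed (auto simp: V_def)
  have V_None: "V y = None \<longleftrightarrow> (\<forall>v. y \<notin> shell v)" for y by (simp add: V_def)
  have shell_space: "shell v \<subseteq> space \<mu>" for v by (auto simp: shell_def space_mu)
  have measV: "V \<in> measurable \<mu> (count_space UNIV)"
  proof (subst measurable_count_space_eq_countable)
    have "V -` {x} \<inter> space \<mu> \<in> sets \<mu>" for x
    proof (cases x)
      case None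
      have "V -` {x} \<inter> space \<mu> = space \<mu> - (\<Union>v. shell v)" by (auto simp: None V_None)
      thus ?thesis using shell_in_sets by auto
    next
      case (Some v)
      have "V -` {x} \<inter> space \<mu> = shell v" using shell_space by (auto simp: Some V)
      thus ?thesis using shell_in_sets by auto
    qed
    thus "V \<in> space \<mu> \<rightarrow> UNIV \<and> (\<forall>a\<in>UNIV. V -` {a} \<inter> space \<mu> \<in> sets \<mu>)" by simp
  qed simp
  define g where "g x = (case x of None \<Rightarrow> 0 | Some v \<Rightarrow> F (enat (h v)))" for x
  define m where "m x = (case x of None \<Rightarrow> 0 | Some v \<Rightarrow> measure \<mu> (shell v))" for x
  have "(LINT y|\<mu>. F (padic_ord_ideal p I y)) = (LINT y|\<mu>. g (V y))"
  proof (rule integral_cong_AE)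
    show "(\<lambda>y. F (padic_ord_ideal p I y)) \<in> borel_measurable \<mu>"
      using measurable_ord_ideal by (rule measurable_compose) simp
    show "(\<lambda>y. g (V y)) \<in> borel_measurable \<mu>"
      using measV by (rule measurable_compose) simp
    show "AE y in \<mu>. F (padic_ord_ideal p I y) = g (V y)"
      using AE_shell
    proof eventually_elim
      case (elim y)
      then obtain v where v: "y \<in> shell v" by blast
      thus ?case using V[of y v] ord[OF v] by (simp add: g_def)
    qed
  qed
  also have "\<dots> = (LINT x|distr \<mu> (count_space UNIV) V. g x)"
    by (rule integral_distr[symmetric]) (use measV in auto)
  also have "distr \<mu> (count_space UNIV) V = density (count_space UNIV) (\<lambda>x. ennreal (m x))"
  proof (rule measure_eqI_countable[where A = UNIV])
    fix x :: "('n \<Rightarrow> nat) option"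
    have "emeasure (density (count_space UNIV) (\<lambda>x. ennreal (m x))) {x} = ennreal (m x)"
      by (subst emeasure_density) (auto simp: nn_integral_count_space_indicator[symmetric] nn_integral_count_space_finite)
    moreover have "emeasure (distr \<mu> (count_space UNIV) V) {x} = ennreal (m x)"
    proof (cases x)
      case None
      have "V -` {x} \<inter> space \<mu> = space \<mu> - (\<Union>v. shell v)" by (auto simp: None V_None)
      moreover have "emeasure \<mu> (space \<mu> - (\<Union>v. shell v)) = 0"
        using AE_shell shell_in_sets
        by (subst (asm) AE_iff_measurable[of "space \<mu> - (\<Union>v. shell v)"]) auto
      ultimately show ?thesis using measV by (simp add: emeasure_distr None m_def)
    next
      case (Some v)
      have "V -` {x} \<inter> space \<mu> = shell v" using shell_space by (auto simp: Some V)
      thus ?thesis using measV by (simp add: emeasure_distr Some m_def emeasure_eq_measure)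
    qed
    ultimately show "emeasure (distr \<mu> (count_space UNIV) V) {x} =
        emeasure (density (count_space UNIV) (\<lambda>x. ennreal (m x))) {x}" by simp
  qed auto
  also have "(LINT x|density (count_space UNIV) (\<lambda>x. ennreal (m x)). g x) =
      (LINT x|count_space UNIV. m x *\<^sub>R g x)"
    by (rule integral_density) (auto simp: m_def split: option.splits)
  also have "\<dots> = infsetsum (\<lambda>x. m x *\<^sub>R g x) UNIV" by (simp add: infsetsum_def)
  also have "\<dots> = S"
  proof -
    have "((\<lambda>x. m x *\<^sub>R g x) has_sum S) (range Some)"
      by (subst has_sum_reindex) (use S in \<open>auto simp: o_def m_def g_def scaleR_conv_of_real\<close>)
    hence sum: "((\<lambda>x. m x *\<^sub>R g x) has_sum S) UNIV"
      by (subst has_sum_cong_neutral[of "range Some"]) (auto simp: g_def notin_range_Some)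
    hence "(\<lambda>x. m x *\<^sub>R g x) summable_on UNIV" by (rule has_sum_imp_summable)
    hence "(\<lambda>x. norm (m x *\<^sub>R g x)) summable_on UNIV"
      by (simp only: summable_on_iff_abs_summable_on_complex)
    hence "Infinite_Set_Sum.abs_summable_on (\<lambda>x. m x *\<^sub>R g x) UNIV"
      by (simp only: abs_summable_equivalent)
    from infsetsum_infsum[OF this] sum show ?thesis by (simp add: infsumI)
  qed
  finally show ?thesis .
qed

end

section \<open>Monomial ideals\<close>

lemma is_ideal_ideal_gen: "is_ideal (ideal_gen S)"
  unfolding ideal_gen_def by (rule hull_in) (auto simp: is_ideal_def)

lemma ideal_gen_superset: "S \<subseteq> ideal_gen S"
  unfolding ideal_gen_def by (rule hull_subset)

lemma ideal_gen_minimal: "S \<subseteq> J \<Longrightarrow> is_ideal J \<Longrightarrow> ideal_gen S \<subseteq> J"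
  unfolding ideal_gen_def by (rule hull_minimal)

text \<open>The exponents of the monomials in the ideal generated by those from
  \<open>A\<close>.\<close>

definition multiples :: "('n \<Rightarrow>\<^sub>0 nat) set \<Rightarrow> ('n \<Rightarrow>\<^sub>0 nat) set" where
  "multiples A = {a + c | a c. a \<in> A}"

lemma is_ideal_keys_multiples: "is_ideal {f :: ('n, 'a::comm_ring_1) mpoly. keys f \<subseteq> multiples A}"
proof -
  have "keys (r * f) \<subseteq> multiples A" if "keys f \<subseteq> multiples A" for r f :: "('n, 'a) mpoly"
  proof
    fix m assume "m \<in> keys (r * f)"
    then obtain x y where "m = x + y" "y \<in> keys f" using Poly_Mapping.keys_mult[of r f] by auto
    moreover from this(2) that obtain a c where "y = a + c" "a \<in> A" by (auto simp: multiples_def)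
    ultimately have "m = a + (x + c)" "a \<in> A" by (simp_all add: add_ac)
    thus "m \<in> multiples A" unfolding multiples_def by blast
  qed
  moreover have "keys (f + g) \<subseteq> multiples A"
    if "keys f \<subseteq> multiples A" "keys g \<subseteq> multiples A" for f g :: "('n, 'a) mpoly"
    using Poly_Mapping.keys_add[of f g] that by blast
  ultimately show ?thesis by (simp add: is_ideal_def)
qed

lemma keys_subset_multiples:
  fixes f :: "('n, 'a::comm_ring_1) mpoly"
  assumes "f \<in> ideal_gen ((\<lambda>m. single m 1) ` A)"
  shows "keys f \<subseteq> multiples A"
proof -
  have "(\<lambda>m. single m 1) ` A \<subseteq> {f :: ('n, 'a) mpoly. keys f \<subseteq> multiples A}"
  proof safe
    fix m x assume "m \<in> A" "x \<in> keys (single m (1::'a))"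
    hence "x = m + 0" "m \<in> A" by (auto split: if_splits)
    thus "x \<in> multiples A" unfolding multiples_def by blast
  qed
  from ideal_gen_minimal[OF this is_ideal_keys_multiples] assms show ?thesis by blast
qed

lemma single_in_monomial_ideal:
  assumes "m \<in> multiples A"
  shows "single m 1 \<in> ideal_gen ((\<lambda>m. single m (1::'a::comm_ring_1)) ` A)"
proof -
  obtain a c where m: "m = a + c" "a \<in> A" using assms by (auto simp: multiples_def)
  let ?S = "(\<lambda>m. single m (1::'a)) ` A"
  have "single a 1 \<in> ideal_gen ?S" using m(2) ideal_gen_superset[of ?S] by blast
  hence "single c 1 * single a 1 \<in> ideal_gen ?S"
    using is_ideal_ideal_gen[of ?S] unfolding is_ideal_def by blast
  thus ?thesis by (simp add: mult_single m(1) add.commute)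
qed

lemma ideal_gen_list:
  assumes "f \<in> ideal_gen (set fs)"
  shows "\<exists>c. f = (\<Sum>i<length fs. c i * fs ! i)"
proof -
  have "is_ideal {f. \<exists>c. f = (\<Sum>i<length fs. c i * fs ! i)}"
    unfolding is_ideal_def mem_Collect_eq Ball_def
  proof (intro conjI allI impI)
    show "\<exists>c. 0 = (\<Sum>i<length fs. c i * fs ! i)" by (intro exI[of _ "\<lambda>_. 0"]) simp
    fix f assume "\<exists>c. f = (\<Sum>i<length fs. c i * fs ! i)"
    then obtain c where c: "f = (\<Sum>i<length fs. c i * fs ! i)" by blast
    show "\<exists>c. r * f = (\<Sum>i<length fs. c i * fs ! i)" for r
      by (intro exI[of _ "\<lambda>i. r * c i"]) (simp add: c sum_distrib_left mult.assoc)
    fix g assume "\<exists>c. g = (\<Sum>i<length fs. c i * fs ! i)"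
    then obtain c' where c': "g = (\<Sum>i<length fs. c' i * fs ! i)" by blast
    show "\<exists>c. f + g = (\<Sum>i<length fs. c i * fs ! i)"
      by (intro exI[of _ "\<lambda>i. c i + c' i"]) (simp add: c c' sum.distrib distrib_right)
  qed
  moreover have "set fs \<subseteq> {f. \<exists>c. f = (\<Sum>i<length fs. c i * fs ! i)}"
  proof
    fix f assume "f \<in> set fs"
    then obtain k where k: "k < length fs" "f = fs ! k" by (metis in_set_conv_nth)
    hence "f = (\<Sum>i<length fs. (if i = k then 1 else 0) * fs ! i)" by (simp add: mult_delta_left)
    thus "f \<in> {f. \<exists>c. f = (\<Sum>i<length fs. c i * fs ! i)}"
      by (intro CollectI exI[of _ "\<lambda>i. if i = k then 1 else 0"])
  qed
  ultimately show ?thesis using ideal_gen_minimal assms by blast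
qed

lemma keys_ideal_extension:
  assumes I: "I = ideal_gen ((\<lambda>m. single m 1) ` A)" and f: "f \<in> ideal_extension I"
  shows "keys f \<subseteq> multiples A"
proof -
  have "Poly_Mapping.map of_int ` I \<subseteq> {f :: ('a, complex) mpoly. keys f \<subseteq> multiples A}"
  proof safe
    fix g m assume "g \<in> I" "m \<in> keys (Poly_Mapping.map complex_of_int g)"
    moreover from this(2) have "m \<in> keys g"
      by (auto simp: in_keys_iff Poly_Mapping.map.rep_eq when_def split: if_splits)
    ultimately show "m \<in> multiples A" using keys_subset_multiples[of g A] I by blast
  qed
  from ideal_gen_minimal[OF this is_ideal_keys_multiples] f show ?thesis
    unfolding ideal_extension_def by blast
qed

lemma single_in_ideal_extension:
  assumes I: "I = ideal_gen ((\<lambda>m. single m 1) ` A)" and m: "m \<in> multiples A"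
  shows "single m 1 \<in> ideal_extension I"
proof -
  have "single m 1 \<in> I" unfolding I by (rule single_in_monomial_ideal[OF m])
  hence "Poly_Mapping.map complex_of_int (single m 1) \<in> ideal_extension I"
    unfolding ideal_extension_def by (intro subsetD[OF ideal_gen_superset] imageI)
  moreover have "Poly_Mapping.map complex_of_int (single m 1) = single m 1"
    by (simp add: map_single)
  ultimately show ?thesis by simp
qed

section \<open>The order of a monomial ideal on a shell\<close>

context padic_haar_measure begin

lemma shell_coordinate:
  assumes y: "y \<in> shell v" and k: "v i < k"
  obtains c where "y i k = int p ^ v i * c" "\<not> int p dvd c"
proof -
  have yi: "y i \<in> padic_int p" using y by (simp add: shell_def padic_space_def)
  have "y i k mod int p ^ v i = 0"
    using padic_int_mod[OF yi, of "v i" k] y k by (simp add: shell_def)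
  then obtain c where c: "y i k = int p ^ v i * c" by (auto simp: mod_eq_0_iff_dvd)
  have "y i k mod int p ^ Suc (v i) \<noteq> 0"
    using padic_int_mod[OF yi, of "Suc (v i)" k] y k by (simp add: shell_def)
  hence "\<not> int p dvd c"
    unfolding c by (auto simp: mod_eq_0_iff_dvd mult.commute[of "int p"] intro: mult_dvd_mono)
  with c that show ?thesis by blast
qed

text \<open>The residue of y_i at precision k shows its order only if \<open>v i < k\<close>.
  Otherwise the residue is 0 and, if u_i > 0, so is the whole product.\<close>

lemma monomial_dvd:
  assumes y: "y \<in> shell v" and k: "k \<le> dot u v"
  shows "int p ^ k dvd (\<Prod>i\<in>UNIV. y i k ^ u i)"
proof (cases "\<exists>i. u i > 0 \<and> k \<le> v i")
  case True
  then obtain i where i: "u i > 0" "k \<le> v i" by blast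
  have yi: "y i \<in> padic_int p" using y by (simp add: shell_def padic_space_def)
  have "y i k = 0" using padic_int_mod[OF yi i(2)] y by (simp add: shell_def)
  hence "(\<Prod>i\<in>UNIV. y i k ^ u i) = 0" using i(1) by (intro prod_zero) (auto intro!: bexI[of _ i])
  thus ?thesis by (simp only: dvd_0_right)
next
  case False
  have "(int p ^ v i) ^ u i dvd y i k ^ u i" for i
  proof (cases "u i = 0")
    case False
    have "\<not> (u i > 0 \<and> k \<le> v i)" using \<open>\<not> (\<exists>i. u i > 0 \<and> k \<le> v i)\<close> by blast
    with False have "v i < k" by simp
    from shell_coordinate[OF y this] show ?thesis by (metis dvd_power_same dvd_triv_left)
  qed simp
  hence "(\<Prod>i\<in>UNIV. (int p ^ v i) ^ u i) dvd (\<Prod>i\<in>UNIV. y i k ^ u i)" by (intro prod_dvd_prod)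
  moreover have "(\<Prod>i\<in>UNIV. (int p ^ v i) ^ u i) = int p ^ dot u v"
    by (simp add: dot_def power_sum power_mult[symmetric] mult.commute)
  ultimately show ?thesis using le_imp_power_dvd[OF k] dvd_trans by metis
qed

text \<open>Whenever u_i > 0, the precision exceeds \<open>v i\<close>, as \<open>dot u v\<close> is
  at least \<open>v i\<close>. So every residue that occurs shows its exact order.\<close>

lemma monomial_not_dvd:
  assumes y: "y \<in> shell v" and k: "dot u v < k"
  shows "\<not> int p ^ k dvd (\<Prod>i\<in>UNIV. y i k ^ u i)"
proof
  assume dvd: "int p ^ k dvd (\<Prod>i\<in>UNIV. y i k ^ u i)"
  have ip: "prime (int p)" using prime by simp
  have "\<exists>c. y i k ^ u i = int p ^ (u i * v i) * c \<and> \<not> int p dvd c" for i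
  proof (cases "u i = 0")
    case True
    thus ?thesis using p_gt_1 by (intro exI[of _ 1]) simp
  next
    case False
    have "u i * v i \<le> dot u v" unfolding dot_def by (rule member_le_sum) auto
    moreover have "v i \<le> u i * v i" using False by simp
    ultimately have "v i < k" using k by linarith
    from shell_coordinate[OF y this] obtain c where c: "y i k = int p ^ v i * c" "\<not> int p dvd c" by blast
    have "\<not> int p dvd c ^ u i" using prime_dvd_power[OF ip] c(2) by blast
    thus ?thesis
      by (intro exI[of _ "c ^ u i"]) (simp add: c(1) power_mult_distrib power_mult[symmetric] mult.commute)
  qed
  then obtain c where c: "\<And>i. y i k ^ u i = int p ^ (u i * v i) * c i" "\<And>i. \<not> int p dvd c i" by metis
  have "(\<Prod>i\<in>UNIV. y i k ^ u i) = int p ^ dot u v * prod c UNIV"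
    unfolding c(1) prod.distrib by (simp add: dot_def power_sum)
  moreover have "int p ^ Suc (dot u v) dvd int p ^ k" using k by (intro le_imp_power_dvd) simp
  ultimately have "int p ^ dot u v * int p dvd int p ^ dot u v * prod c UNIV"
    using dvd by (metis dvd_trans power_Suc2)
  hence "int p dvd prod c UNIV" using p_gt_1 by simp
  hence "\<exists>i\<in>UNIV. int p dvd c i" using prime_dvd_prod_iff[of UNIV "int p" c] ip by simp
  with c(2) show False by blast
qed

text \<open>Cancellation between terms can only raise the order, which gives the lower bound; the
  upper bound comes from a single monomial of the ideal, where no cancellation occurs.\<close>

lemma ord_ideal_shell:
  fixes I :: "('n, int) mpoly set"
  assumes y: "y \<in> shell v" and G: "finite G" "G \<noteq> {}"
    and lower: "\<And>f m. f \<in> I \<Longrightarrow> m \<in> keys f \<Longrightarrow> \<exists>g\<in>G. g \<le> lookup m"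
    and mem: "\<And>g. g \<in> G \<Longrightarrow> \<exists>m. lookup m = g \<and> single m 1 \<in> I"
  shows "padic_ord_ideal p I y = enat (min_dot G v)"
proof (rule antisym)
  have ys: "y \<in> padic_space p" using y by (simp add: shell_def)
  show "enat (min_dot G v) \<le> padic_ord_ideal p I y"
    unfolding padic_ord_ideal_ge_iff[OF ys]
  proof
    fix f assume f: "f \<in> I"
    have "int p ^ min_dot G v dvd mpoly_eval f (\<lambda>i. y i (min_dot G v))"
      unfolding mpoly_eval_def
    proof (intro dvd_sum dvd_mult monomial_dvd[OF y])
      fix m assume "m \<in> keys f"
      from lower[OF f this] obtain g where g: "g \<in> G" "g \<le> lookup m" by blast
      have "dot g v \<le> dot (lookup m) v"
        unfolding dot_def using g(2) by (intro sum_mono mult_right_mono) (auto simp: le_fun_def)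
      with min_dot_le[OF G(1) g(1), of v] show "min_dot G v \<le> dot (lookup m) v" by simp
    qed
    thus "padic_eval p f y (min_dot G v) = 0" by (simp add: padic_eval_def mod_eq_0_iff_dvd)
  qed
  obtain g where g: "g \<in> G" "min_dot G v = dot g v" using min_dot_attained[OF G] by blast
  from mem[OF g(1)] obtain m where m: "lookup m = g" "single m 1 \<in> I" by blast
  have "\<not> int p ^ Suc (dot g v) dvd mpoly_eval (single m 1) (\<lambda>i. y i (Suc (dot g v)))"
    using monomial_not_dvd[OF y, of g "Suc (dot g v)"] by (simp add: mpoly_eval_single m(1))
  hence "\<not> padic_eval p (single m 1) y (Suc (dot g v)) = 0"
    by (simp add: padic_eval_def mod_eq_0_iff_dvd)
  hence "\<not> enat (Suc (min_dot G v)) \<le> padic_ord_ideal p I y"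
    unfolding padic_ord_ideal_ge_iff[OF ys] using m(2) g(2) by auto
  thus "padic_ord_ideal p I y \<le> enat (min_dot G v)"
    by (cases "padic_ord_ideal p I y") auto
qed

lemma integrand_zeta_term:
  "of_real ((1 / real p) ^ sum v UNIV) * igusa_integrand p s (enat (min_dot G v)) = zeta_term p G s (v :: 'n \<Rightarrow> nat)"
proof -
  have exp: "1 / real p = exp (- ln (real p))" using p_gt_1 by (simp add: exp_minus inverse_eq_divide)
  have "(1 / real p) ^ sum v UNIV = exp (real (sum v UNIV) * (- ln (real p)))"
    unfolding exp exp_of_nat_mult ..
  moreover have "(1 / of_nat p) powr (s * of_nat (min_dot G v)) = exp (s * of_nat (min_dot G v) * of_real (- ln (real p)))"
  proof -
    have "(1 / of_nat p :: complex) = of_real (exp (- ln (real p)))" unfolding exp[symmetric] by simp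
    moreover have "Ln (of_real (exp (- ln (real p)))) = of_real (- ln (real p))"
      by (subst Ln_of_real) auto
    ultimately show ?thesis by (simp add: powr_def)
  qed
  ultimately show ?thesis
    by (simp add: igusa_integrand_def zeta_term_def exp_of_real[symmetric] exp_add[symmetric] algebra_simps del: of_nat_sum)
qed

end

text \<open>The constant is the measure of the shell of order 0, the points whose coordinates are
  all units.\<close>

theorem igusa_zeta_eq:
  fixes I :: "('n::finite, int) mpoly set"
  assumes "prime p" and G: "finite G" "G \<noteq> {}"
    and lower: "\<And>f m. f \<in> I \<Longrightarrow> m \<in> keys f \<Longrightarrow> \<exists>g\<in>G. g \<le> lookup m"
    and mem: "\<And>g. g \<in> G \<Longrightarrow> \<exists>m. lookup m = g \<and> single m 1 \<in> I"
    and S: "(zeta_term p G s has_sum S) UNIV"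
  shows "igusa_zeta p I s = of_real (((real p - 1) / real p) ^ CARD('n)) * S"
proof -
  interpret padic_haar_measure p "padic_haar p :: ('n \<Rightarrow> nat \<Rightarrow> int) measure"
    using assms(1) by unfold_locales (auto intro!: is_padic_haar_padic_haar prime_gt_0_nat)
  let ?C = "of_real (((real p - 1) / real p) ^ CARD('n)) :: complex"
  have "((\<lambda>v. ?C * zeta_term p G s v) has_sum ?C * S) UNIV"
    using S by (rule has_sum_cmult_right)
  moreover have "?C * zeta_term p G s v =
      of_real (measure (padic_haar p) (shell v)) * igusa_integrand p s (enat (min_dot G v))" for v
    unfolding measure_shell integrand_zeta_term[symmetric] by simp
  ultimately show ?thesis
    unfolding igusa_zeta_def
    by (intro integral_shells[OF ord_ideal_shell[OF _ G lower mem]]) simp_all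
qed

text \<open>All exponents in \<open>B\<close> have weight \<open>min_dot G r\<close>, so pairing the
  relation for (1, ..., 1) with r determines the sum of its coefficients as |r| / \<phi>(r).\<close>

theorem monomial_ideal_root:
  fixes I :: "('n::{finite,linorder}, int) mpoly set" and r :: "'n \<Rightarrow> nat"
  assumes I: "I = ideal_gen ((\<lambda>m. single m 1) ` A)"
    and G: "finite G" "\<And>m. m \<in> multiples A \<Longrightarrow> \<exists>g\<in>G. g \<le> lookup m"
      "\<And>g. g \<in> G \<Longrightarrow> \<exists>m\<in>multiples A. lookup m = g"
    and r: "min_dot G r > 0" "ones_in_span (face_exponents G r)"
    and b: "is_bernstein_sato_poly I b"
  shows "poly b (of_real (- real (sum r UNIV) / real (min_dot G r))) = 0"
proof -
  obtain fs where fs: "0 \<notin> set fs" "ideal_gen (set fs) = ideal_extension I" "bs_equation fs b"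
    using b unfolding is_bernstein_sato_poly_def by blast
  have keys_fs: "keys (fs ! i) \<subseteq> multiples A" if "i < length fs" for i
    using keys_ideal_extension[OF I, of "fs ! i"] ideal_gen_superset[of "set fs"] nth_mem[OF that] fs(2) by blast
  have lookup_Abs: "lookup (Abs_poly_mapping u) = u" for u :: "'n \<Rightarrow> nat"
    by (rule lookup_Abs_poly_mapping) simp
  define B where "B = Abs_poly_mapping ` face_exponents G r"
  have finB: "finite B" unfolding B_def using G(1) by (simp add: finite_face_exponents)
  have B_face: "lookup a \<in> face_exponents G r" if "a \<in> B" for a
    using that by (auto simp: B_def lookup_Abs)
  have B_up: "a \<in> multiples A" if a: "a \<in> B" for a
  proof -
    obtain g where g: "g \<in> G" "g \<le> lookup a" using face_exponents_ge[OF B_face[OF a]] by blast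
    from G(3)[OF g(1)] obtain m where m: "m \<in> multiples A" "lookup m = g" by blast
    have "a = m + (a - m)"
      by (rule poly_mapping_eqI) (use g(2) m(2) in \<open>simp add: lookup_add lookup_minus le_fun_def\<close>)
    moreover obtain x c where "m = x + c" "x \<in> A" using m(1) by (auto simp: multiples_def)
    ultimately have "a = x + (c + (a - m))" by (simp add: add.assoc)
    with \<open>x \<in> A\<close> show ?thesis unfolding multiples_def by blast
  qed
  have "\<forall>a\<in>B. \<exists>c. single a 1 = (\<Sum>i<length fs. c i * fs ! i)"
    using single_in_ideal_extension[OF I B_up] fs(2) by (intro ballI ideal_gen_list) simp
  from bchoice[OF this] obtain pc where
    pc: "\<And>a. a \<in> B \<Longrightarrow> single a 1 = (\<Sum>i<length fs. pc a i * fs ! i)" by blast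
  obtain z :: "('n \<Rightarrow> nat) \<Rightarrow> rat" where z: "\<And>j. (\<Sum>a\<in>face_exponents G r. z a * of_nat (a j)) = 1"
    using r(2) unfolding ones_in_span_def by blast
  define zB where "zB a = z (lookup a)" for a
  have zB: "(\<Sum>a\<in>B. zB a * of_nat (lookup a j)) = 1" for j
  proof -
    have "inj_on Abs_poly_mapping (face_exponents G r)"
      by (rule inj_on_inverseI[where g = lookup]) (simp add: lookup_Abs)
    thus ?thesis using z[of j] by (simp add: B_def sum.reindex zB_def lookup_Abs)
  qed
  \<comment> \<open>Here \<open>z\<close> combines to +(1, ..., 1), so \<open>u - d / q\<close> must
    be its negative. With u at least |z| the number u + z is nonnegative and can be taken as d / q
    for a common denominator q.\<close>
  define u where "u a = nat \<lceil>\<bar>zB a\<bar>\<rceil>" for a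
  have "of_nat (u a) + zB a \<ge> 0" for a
  proof -
    have "\<bar>zB a\<bar> \<le> of_int \<lceil>\<bar>zB a\<bar>\<rceil>" by (rule le_of_int_ceiling)
    also have "of_int \<lceil>\<bar>zB a\<bar>\<rceil> = rat_of_nat (u a)" by (simp add: u_def)
    finally show ?thesis by linarith
  qed
  then obtain q :: nat and d where q: "q > 0" "\<And>a. a \<in> B \<Longrightarrow> rat_of_nat (d a) = of_nat q * (of_nat (u a) + zB a)"
    using rat_common_denominator[OF finB, of "\<lambda>a. of_nat (u a) + zB a"] by metis
  have ud: "(\<Sum>a\<in>B. d a * lookup a j) = q * ((\<Sum>a\<in>B. u a * lookup a j) + 1)" for j
  proof -
    have "rat_of_nat (\<Sum>a\<in>B. d a * lookup a j) =
        (\<Sum>a\<in>B. of_nat q * (of_nat (u a * lookup a j) + zB a * of_nat (lookup a j)))"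
      by (simp add: q(2) algebra_simps)
    also have "\<dots> = of_nat (q * ((\<Sum>a\<in>B. u a * lookup a j) + 1))"
      unfolding sum_distrib_left[symmetric] sum.distrib zB by (simp add: distrib_left)
    finally show ?thesis by (simp only: of_nat_eq_iff)
  qed
  have wt: "(\<Sum>j\<in>UNIV. r j * lookup a j) = min_dot G r" if "a \<in> B" for a
    using face_exponents_dot[OF B_face[OF that]] by (simp add: dot_def mult.commute)
  interpret bernstein_data fs B pc r "min_dot G r" u d q
  proof unfold_locales
    fix i m assume "i < length fs" "m \<in> keys (fs ! i)"
    then obtain g where g: "g \<in> G" "g \<le> lookup m" using keys_fs G(2) by blast
    have "min_dot G r \<le> dot g r" by (rule min_dot_le[OF G(1) g(1)])
    also have "\<dots> \<le> (\<Sum>j\<in>UNIV. r j * lookup m j)"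
      unfolding dot_def using g(2) by (intro sum_mono) (simp add: le_fun_def mult.commute)
    finally show "min_dot G r \<le> (\<Sum>j\<in>UNIV. r j * lookup m j)" .
  qed (use finB fs(1) pc wt r(1) q(1) ud in auto)
  have "(\<Sum>a\<in>B. d a) * min_dot G r = (\<Sum>j\<in>UNIV. r j * (\<Sum>a\<in>B. d a * lookup a j))"
    unfolding sum_distrib_left sum_distrib_right
    by (subst sum.swap) (simp add: wt[symmetric] sum_distrib_left mult_ac)
  also have "\<dots> = q * ((\<Sum>j\<in>UNIV. r j * (\<Sum>a\<in>B. u a * lookup a j)) + sum r UNIV)"
    unfolding ud by (simp add: distrib_left sum.distrib sum_distrib_left mult_ac)
  also have "(\<Sum>j\<in>UNIV. r j * (\<Sum>a\<in>B. u a * lookup a j)) = (\<Sum>a\<in>B. u a) * min_dot G r"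
    unfolding sum_distrib_left sum_distrib_right
    by (subst sum.swap) (simp add: wt[symmetric] sum_distrib_left mult_ac)
  finally have "(\<Sum>a\<in>B. d a) * min_dot G r = q * ((\<Sum>a\<in>B. u a) * min_dot G r + sum r UNIV)" .
  from arg_cong[OF this, of complex_of_nat]
  have "of_nat (\<Sum>a\<in>B. d a) * of_nat (min_dot G r) =
      of_nat q * (of_nat (\<Sum>a\<in>B. u a) * of_nat (min_dot G r) + complex_of_nat (sum r UNIV))"
    by (simp only: of_nat_mult of_nat_add)
  hence "of_nat (\<Sum>a\<in>B. u a) - of_nat (\<Sum>a\<in>B. d a) / of_nat q = - complex_of_nat (sum r UNIV) / of_nat (min_dot G r)"
    using q(1) r(1) by (simp add: field_simps del: of_nat_sum)
  with bs_equation_root[OF fs(3)] show ?thesis by simp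
qed

theorem theorem1p2:
  fixes I :: "('n::{finite,linorder}, int) mpoly set"
    and p :: nat and Z :: "complex \<Rightarrow> complex" and s :: complex and b :: "complex poly"
  assumes "monomial_ideal I" and "I \<noteq> {0}" and "I \<noteq> UNIV"
    and "prime p"
    and "Z meromorphic_on UNIV" and "\<And>w. Re w > 0 \<Longrightarrow> Z w = igusa_zeta p I w"
    and "is_pole Z s"
    and "is_bernstein_sato_poly I b"
  shows "poly b (complex_of_real (Re s)) = 0"
proof -
  obtain A where I: "I = ideal_gen ((\<lambda>m. single m 1) ` A)"
    using assms(1) unfolding monomial_ideal_def by blast
  have "A \<noteq> {}"
  proof
    assume "A = {}"
    hence "I \<subseteq> {0}" unfolding I by (intro ideal_gen_minimal) (simp_all add: is_ideal_def)
    moreover have "0 \<in> I" using is_ideal_ideal_gen unfolding I is_ideal_def by blast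
    ultimately show False using assms(2) by blast
  qed
  then obtain a where "a \<in> A" by blast
  hence "a + 0 \<in> multiples A" unfolding multiples_def by blast
  \<comment> \<open>\<open>A\<close> may be infinite; a finite set of exponents dominated by all
    others suffices to compute \<phi>.\<close>
  obtain G where G: "finite G" "G \<subseteq> lookup ` multiples A"
    "\<And>u. u \<in> lookup ` multiples A \<Longrightarrow> \<exists>g\<in>G. g \<le> u"
    using dickson_finite_basis by blast
  have "G \<noteq> {}" using G(3)[of "lookup (a + 0)"] \<open>a + 0 \<in> multiples A\<close> by blast
  have lower: "\<exists>g\<in>G. g \<le> lookup m" if "f \<in> I" "m \<in> keys f" for f m
    using keys_subset_multiples[of f A] that I G(3) by blast
  have mem: "\<exists>m. lookup m = g \<and> single m 1 \<in> I" if g: "g \<in> G" for g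
  proof -
    obtain m where "m \<in> multiples A" "lookup m = g" using g G(2) by blast
    with single_in_monomial_ideal[OF this(1), where 'a = int] show ?thesis unfolding I by blast
  qed
  have "Z w = of_real (((real p - 1) / real p) ^ CARD('n)) * S"
    if "Re w > 0" "(zeta_term p G w has_sum S) UNIV" for w S
    using assms(6)[OF that(1)] igusa_zeta_eq[OF assms(4) G(1) \<open>G \<noteq> {}\<close> lower mem that(2)] by simp
  then obtain r where r: "min_dot G r > 0" "ones_in_span (face_exponents G r)"
    "Re s = - real (sum r UNIV) / real (min_dot G r)"
    using zeta_pole_ray[OF G(1) \<open>G \<noteq> {}\<close> prime_gt_1_nat[OF assms(4)] assms(5) _ assms(7)] by metis
  have "poly b (of_real (- real (sum r UNIV) / real (min_dot G r))) = 0"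
    by (rule monomial_ideal_root[OF I G(1) _ _ r(1,2) assms(8)]) (use G(2,3) in auto)
  thus ?thesis unfolding r(3) .
qed

end
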